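(* Let $n\in\{3,4,6\}$ and let $q$ be a fixed positive integer such that there is a generalized $n$-gon $\mathbb{G}_n(q,q)$ of order $(q,q)$ admitting a non-rotation polarity. Let $\mathcal{G}_{n,q}$ be the family of graphs $$\overline{P(\mathbb{G}_n(q,q)\odot\mathbb{G}_n(r,r))}\;\cong\;\overline{P_q(\mathbb{G}_n(q,q))\otimes P_r(\mathbb{G}_n(r,r))},$$ where $r$ ranges over the positive integers for which a generalized $n$-gon $\mathbb{G}_n(r,r)$ admitting a non-rotation polarity exists (admissible $r$), where $P_q$ and $P_r$ are the polarity quotients of $\mathbb{G}_n(q,q)$ and $\mathbb{G}_n(r,r)$ with respect to non-rotation polarities, and $P$ is the quotient with respect to the corresponding composed polarity. Then $\mathcal{G}_{n,q}$ is an infinite family of graphs; its member corresponding to $r$ has degree $(q+1)(r+1)$ and diameter $n-1$; and, as $r\to\infty$ through admissible values, the ratio of the order of the graph to the Moore bound $\mathrm{MB}((q+1)(r+1),\,n-1)$ tends to $$f_q=\frac{\sum_{i=0}^{n-1}q^i}{(q+1)^{n-1}}.$$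
   Context: Graphs are undirected, without multi-edges; self-loops are allowed. The degree of a graph is the maximum of its vertex degrees. $\overline{G}$ denotes the graph $G$ with all self-loops deleted (after the whole construction under the bar is complete). Moore bound: $\mathrm{MB}(\Delta,D)=1+\Delta\sum_{i=0}^{D-1}(\Delta-1)^i$. Generalized polygons: a generalized $n$-gon is a point-line geometry whose bipartite point-line incidence graph has diameter $n$ and girth $2n$. It has order $(s,t)$ if every line is incident with $s+1$ points and every point with $t+1$ lines. $\mathbb{G}_n(q,q)$ denotes the incidence graph (parts: points and lines) of a generalized $n$-gon of order $(q,q)$. The case $q=1$ (thin) is allowed: then $\mathbb{G}_n(1,1)$ is the cycle $C_{2n}$. Polarity: for a bipartite graph $\mathbb{G}$ with parts $A,B$, a polarity is a graph automorphism $\rho$ that is an involution with $\rho(A)=B$, $\rho(B)=A$. The rotation polarity is the rotation of $C_{2n}=\mathbb{G}_n(1,1)$ by $\pi$ radians when $n$ is odd; every other polarity of a generalized polygon is a non-rotation polarity. Polarity quotient: $P(\mathbb{G})$ has as vertices the orbits $[v]=\{v,\rho(v)\}$, with $[v],[w]$ adjacent whenever some $v'\in[v]$, $w'\in[w]$ are adjacent in $\mathbb{G}$; multi-edges are merged, self-loops are retained. Kronecker product: $H\otimes K$ has vertex set $V(H)\times V(K)$, with $((h_1,k_1),(h_2,k_2))$ an edge if and only if $(h_1,h_2)\in E(H)$ and $(k_1,k_2)\in E(K)$. If $\mathbb{H},\mathbb{K}$ are connected bipartite graphs with parts $A_H,B_H$ and $A_K,B_K$ that admit polarities $\rho_H,\rho_K$,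 then $\mathbb{H}\otimes\mathbb{K}$ has two isomorphic components, with vertex sets $(A_H\times A_K)\cup(B_H\times B_K)$ and $(A_H\times B_K)\cup(B_H\times A_K)$; $\mathbb{H}\odot\mathbb{K}$ denotes one of them, and the composed polarity on it is $\rho((h,k))=(\rho_H(h),\rho_K(k))$. *)

theory Defs
  imports Complex_Main "Graph_Theory.Graph_Theory"
begin

text \<open>
  An undirected graph without multi-edges, possibly with self-loops, is a symmetric
  \<open>pair_pre_digraph\<close>: an edge \<open>{u, v}\<close> is the pair of arcs \<open>(u, v)\<close>, \<open>(v, u)\<close>, and a self-loop
  at \<open>v\<close> is the single arc \<open>(v, v)\<close>.
\<close>

section \<open>Graph parameters and operations\<close>

definition graph_order :: "'a pair_pre_digraph \<Rightarrow> nat" where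
  "graph_order G = card (pverts G)"

definition graph_degree :: "'a pair_pre_digraph \<Rightarrow> nat" where
  "graph_degree G = Max (out_degree (with_proj G) ` pverts G)"

text \<open>\<open>wf_digraph.\<mu>\<close> with unit weights is the graph distance (\<open>\<infinity>\<close> between components).\<close>

definition graph_diameter :: "'a pair_pre_digraph \<Rightarrow> ereal" where
  "graph_diameter G =
     (SUP u\<in>pverts G. SUP v\<in>pverts G. wf_digraph.\<mu> (with_proj G) (\<lambda>_. 1) u v)"

text \<open>
  In a symmetric digraph the closed walk \<open>u, v, u\<close> along a single edge is a directed cycle of
  length 2. As there are no multi-edges, every directed cycle of length 2 is of this kind, and it
  is not a cycle of the undirected graph.
\<close>

definition graph_girth :: "'a pair_pre_digraph \<Rightarrow> enat" where
  "graph_girth G =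
     (INF c\<in>{c. pre_digraph.cycle (with_proj G) c \<and> length c \<noteq> 2}. enat (length c))"

definition graph_isomorphic :: "'a pair_pre_digraph \<Rightarrow> 'b pair_pre_digraph \<Rightarrow> bool" where
  "graph_isomorphic G H \<longleftrightarrow> digraph_iso (with_proj G) (with_proj H)"

definition graph_automorphism :: "'a pair_pre_digraph \<Rightarrow> ('a \<Rightarrow> 'a) \<Rightarrow> bool" where
  "graph_automorphism G \<phi> \<longleftrightarrow> bij_betw \<phi> (pverts G) (pverts G) \<and>
     (\<forall>u\<in>pverts G. \<forall>v\<in>pverts G. (\<phi> u, \<phi> v) \<in> parcs G \<longleftrightarrow> (u, v) \<in> parcs G)"

definition delete_loops :: "'a pair_pre_digraph \<Rightarrow> 'a pair_pre_digraph" where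
  "delete_loops G = \<lparr>pverts = pverts G, parcs = {(u, v) \<in> parcs G. u \<noteq> v}\<rparr>"

definition kronecker :: "'a pair_pre_digraph \<Rightarrow> 'b pair_pre_digraph \<Rightarrow> ('a \<times> 'b) pair_pre_digraph"
  (infixl \<open>\<otimes>\<^sub>K\<close> 70) where
  "H \<otimes>\<^sub>K K =
     \<lparr>pverts = pverts H \<times> pverts K,
      parcs = {((h1, k1), (h2, k2)) | h1 k1 h2 k2. (h1, h2) \<in> parcs H \<and> (k1, k2) \<in> parcs K}\<rparr>"

definition moore_bound :: "nat \<Rightarrow> nat \<Rightarrow> real" where
  "moore_bound \<Delta> D = 1 + real \<Delta> * (\<Sum>i<D. (real \<Delta> - 1) ^ i)"


section \<open>Polarities of bipartite graphs and their quotients\<close>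

definition polarity :: "'a pair_pre_digraph \<Rightarrow> 'a set \<Rightarrow> 'a set \<Rightarrow> ('a \<Rightarrow> 'a) \<Rightarrow> bool" where
  "polarity G A B \<rho> \<longleftrightarrow> graph_automorphism G \<rho> \<and> (\<forall>v\<in>pverts G. \<rho> (\<rho> v) = v) \<and>
     \<rho> ` A = B \<and> \<rho> ` B = A"

definition polarity_quotient :: "'a pair_pre_digraph \<Rightarrow> ('a \<Rightarrow> 'a) \<Rightarrow> 'a set pair_pre_digraph" where
  "polarity_quotient G \<rho> =
     \<lparr>pverts = (\<lambda>v. {v, \<rho> v}) ` pverts G,
      parcs = (\<lambda>(v, w). ({v, \<rho> v}, {w, \<rho> w})) ` parcs G\<rparr>"

text \<open>
  Of the two isomorphic components of the Kronecker product of bipartite graphs with parts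
  \<open>A\<^sub>H, B\<^sub>H\<close> and \<open>A\<^sub>K, B\<^sub>K\<close> we take the one on \<open>A\<^sub>H \<times> A\<^sub>K \<union> B\<^sub>H \<times> B\<^sub>K\<close>; exchanging the names of the
  two parts of one factor gives the other.
\<close>

definition odot :: "'a pair_pre_digraph \<Rightarrow> 'a set \<Rightarrow> 'a set \<Rightarrow> 'b pair_pre_digraph \<Rightarrow> 'b set \<Rightarrow> 'b set
    \<Rightarrow> ('a \<times> 'b) pair_pre_digraph" where
  "odot H A\<^sub>H B\<^sub>H K A\<^sub>K B\<^sub>K =
     (let V = A\<^sub>H \<times> A\<^sub>K \<union> B\<^sub>H \<times> B\<^sub>K in \<lparr>pverts = V, parcs = parcs (H \<otimes>\<^sub>K K) \<inter> V \<times> V\<rparr>)"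


section \<open>Generalized polygons\<close>

record ('p, 'l) geometry =
  points :: "'p set"
  lines :: "'l set"
  incid :: "('p \<times> 'l) set"

definition point_verts :: "('p, 'l) geometry \<Rightarrow> ('p + 'l) set" where
  "point_verts \<Gamma> = Inl ` points \<Gamma>"

definition line_verts :: "('p, 'l) geometry \<Rightarrow> ('p + 'l) set" where
  "line_verts \<Gamma> = Inr ` lines \<Gamma>"

definition incidence_graph :: "('p, 'l) geometry \<Rightarrow> ('p + 'l) pair_pre_digraph" where
  "incidence_graph \<Gamma> =
     \<lparr>pverts = point_verts \<Gamma> \<union> line_verts \<Gamma>,
      parcs = (\<lambda>(p, l). (Inl p, Inr l)) ` incid \<Gamma> \<union> (\<lambda>(p, l). (Inr l, Inl p)) ` incid \<Gamma>\<rparr>"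

definition generalized_polygon :: "nat \<Rightarrow> ('p, 'l) geometry \<Rightarrow> bool" where
  "generalized_polygon n \<Gamma> \<longleftrightarrow> incid \<Gamma> \<subseteq> points \<Gamma> \<times> lines \<Gamma> \<and>
     graph_diameter (incidence_graph \<Gamma>) = ereal (real n) \<and>
     graph_girth (incidence_graph \<Gamma>) = enat (2 * n)"

definition has_order :: "('p, 'l) geometry \<Rightarrow> nat \<Rightarrow> nat \<Rightarrow> bool" where
  "has_order \<Gamma> s t \<longleftrightarrow>
     (\<forall>l\<in>lines \<Gamma>. card {p \<in> points \<Gamma>. (p, l) \<in> incid \<Gamma>} = s + 1) \<and>
     (\<forall>p\<in>points \<Gamma>. card {l \<in> lines \<Gamma>. (p, l) \<in> incid \<Gamma>} = t + 1)"

text \<open>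
  The rotation by \<open>\<pi>\<close> of the cycle \<open>C\<^sub>2\<^sub>n\<close>: the map \<open>\<phi>\<close> is a labelling of the whole graph by
  \<open>0, \<dots>, 2n - 1\<close> in cyclic order, and \<open>\<rho>\<close> is the shift by \<open>n\<close>.
\<close>

definition rotation_polarity :: "nat \<Rightarrow> ('p, 'l) geometry \<Rightarrow> ('p + 'l \<Rightarrow> 'p + 'l) \<Rightarrow> bool" where
  "rotation_polarity n \<Gamma> \<rho> \<longleftrightarrow> odd n \<and>
     (\<exists>\<phi>. bij_betw \<phi> {..<2 * n} (pverts (incidence_graph \<Gamma>)) \<and>
        (\<forall>i<2 * n. \<forall>j<2 * n. (\<phi> i, \<phi> j) \<in> parcs (incidence_graph \<Gamma>) \<longleftrightarrow>
           j = (i + 1) mod (2 * n) \<or> i = (j + 1) mod (2 * n)) \<and>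
        (\<forall>i<2 * n. \<rho> (\<phi> i) = \<phi> ((i + n) mod (2 * n))))"

definition polarized_polygon ::
    "nat \<Rightarrow> nat \<Rightarrow> ('p, 'l) geometry \<Rightarrow> ('p + 'l \<Rightarrow> 'p + 'l) \<Rightarrow> bool" where
  "polarized_polygon n q \<Gamma> \<rho> \<longleftrightarrow> generalized_polygon n \<Gamma> \<and> has_order \<Gamma> q q \<and>
     polarity (incidence_graph \<Gamma>) (point_verts \<Gamma>) (line_verts \<Gamma>) \<rho> \<and>
     \<not> rotation_polarity n \<Gamma> \<rho>"

text \<open>
  A geometry of order \<open>(r, r)\<close> with finite diameter is finite, hence has an isomorphic copy on
  \<open>nat\<close>, so the restriction to this type is immaterial.
\<close>

definition admissible :: "nat \<Rightarrow> nat \<Rightarrow> bool" where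
  "admissible n r \<longleftrightarrow>
     r > 0 \<and> (\<exists>(\<Gamma> :: (nat, nat) geometry) \<rho>. polarized_polygon n r \<Gamma> \<rho>)"


section \<open>The family\<close>

definition composed_quotient ::
    "('p, 'l) geometry \<Rightarrow> ('p + 'l \<Rightarrow> 'p + 'l) \<Rightarrow> ('c, 'd) geometry \<Rightarrow> ('c + 'd \<Rightarrow> 'c + 'd)
     \<Rightarrow> (('p + 'l) \<times> ('c + 'd)) set pair_pre_digraph" where
  "composed_quotient \<Gamma> \<rho> \<Gamma>' \<rho>' =
     polarity_quotient
       (odot (incidence_graph \<Gamma>) (point_verts \<Gamma>) (line_verts \<Gamma>)
             (incidence_graph \<Gamma>') (point_verts \<Gamma>') (line_verts \<Gamma>'))
       (\<lambda>(h, k). (\<rho> h, \<rho>' k))"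

text \<open>
  The members corresponding to \<open>r\<close>, for all choices of the second polygon (on the given types)
  and of its polarity.
\<close>

definition family_members ::
    "nat \<Rightarrow> ('p, 'l) geometry \<Rightarrow> ('p + 'l \<Rightarrow> 'p + 'l) \<Rightarrow> nat
     \<Rightarrow> (('p + 'l) \<times> ('c + 'd)) set pair_pre_digraph set" where
  "family_members n \<Gamma> \<rho> r =
     {delete_loops (composed_quotient \<Gamma> \<rho> \<Gamma>' \<rho>') | (\<Gamma>' :: ('c, 'd) geometry) \<rho>'.
        r > 0 \<and> polarized_polygon n r \<Gamma>' \<rho>'}"

end

theory Submission
  imports Defs "HOL-Algebra.Algebraic_Closure_Type"
begin

text \<open>
  The proof has two independent parts: the graphs themselves, for arbitrary given polygons,
  and the existence of infinitely many admissible orders.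

  \<^bold>\<open>The graphs.\<close> A bipartite graph with parts \<open>P\<close>, \<open>L\<close> and a polarity \<open>\<rho>\<close> has a quotient
  whose vertices can be identified with the elements of \<open>P\<close>: every orbit contains exactly
  one of them, and \<open>x\<close>, \<open>y\<close> become adjacent if and only if \<open>x\<close> is adjacent to \<open>\<rho> y\<close>. For
  \<open>H \<odot> K\<close> with the composed polarity, whose first part is the product of the first parts of
  the factors, this relation is the product of the two relations; so both graphs of the
  isomorphism are relabellings of one and the same product on \<open>P \<times> P'\<close>, and all parameters
  are computed there.

  In a graph of girth \<open>2n\<close> two nonbacktracking walks with common ends and total length less
  than \<open>2n\<close> coincide (\<open>nonbacktracking_unique\<close>). Growing two trees from the ends of an edge
  therefore counts the vertices: there are \<open>1 + q + \<dots> + q\<^sup>n\<^sup>-\<^sup>1\<close> points, which gives the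
  order and the limit. For the diameter, walks of length \<open>m\<close> in the quotient are walks of
  length \<open>m\<close> in the polygon from \<open>x\<close> to \<open>y\<close> or to \<open>\<rho> y\<close>, according to the parity of \<open>m\<close>. The
  one of \<open>y\<close>, \<open>\<rho> y\<close> whose distance from \<open>x\<close> has the parity of \<open>n - 1\<close> is at distance at most
  \<open>n - 1\<close>, and walks can be lengthened by \<open>2\<close>; hence any two vertices of a quotient are
  joined by a walk of length exactly \<open>n - 1\<close> (\<open>polar_relpow_all\<close>). Since the length is the
  same in both factors, the product has diameter at most \<open>n - 1\<close>. It is not smaller. For
  even \<open>n\<close> there is a point \<open>x\<close> adjacent to \<open>\<rho> x\<close>: the geodesic from a point \<open>u\<close> to \<open>\<rho> u\<close>
  has odd length, so it is unique and \<open>\<rho>\<close> reverses it, and its middle edge has the form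
  \<open>{x, \<rho> x}\<close>. A point opposite to such an \<open>x\<close> is then far from both \<open>x\<close> and \<open>\<rho> x\<close>. For
  \<open>n = 3\<close> the product simply has too many vertices to be complete. The degree is
  \<open>(q + 1)(r + 1)\<close> because a loop lowers the degree only where both factors have one, and if
  every vertex of a quotient had a loop, the polygon would contain a quadrilateral
  (\<open>polar_non_loop\<close>).

  \<^bold>\<open>Existence.\<close> The polygons are built from coordinates over a finite field \<open>F\<close>. Two rooted
  trees of height \<open>n - 1\<close>, in which every inner vertex has one child for each element of
  \<open>F\<close>, are joined at their roots, and their leaves are joined by polynomial equations. A
  cycle through the root edge has length at least \<open>2n\<close> for trivial reasons: one has to
  descend one tree and climb the other one. So it suffices that the automorphism group is
  transitive on edges, and for this three kinds of automorphisms are enough (locale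
  \<open>field_polygon\<close>): a polarity, which swaps the two trees, translations of the first
  coordinate, and an inversion \<open>a \<mapsto> 1/a\<close>, which fixes one root and permutes its neighbours,
  moving the other root. Diameter, girth and valency all follow from edge-transitivity
  (locale \<open>coordinate_polygon\<close>).

  For \<open>n = 3\<close> this gives Desarguesian planes, for \<open>n = 4\<close> symplectic quadrangles and for
  \<open>n = 6\<close> split Cayley hexagons. In the last two cases the polarity exchanges short and long
  roots, which is possible in characteristic \<open>p = 2\<close> or \<open>p = 3\<close>, respectively, if the field
  has an automorphism whose square is the Frobenius map \<open>x \<mapsto> x\<^sup>p\<close>. The field of order
  \<open>p\<^sup>2\<^sup>e\<^sup>+\<^sup>1\<close> has one, namely \<open>x \<mapsto> x ^ p\<^sup>e\<^sup>+\<^sup>1\<close>; letting \<open>e\<close> vary yields infinitely many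
  admissible orders.
\<close>

section \<open>Distances and cycles\<close>

lemma pair_wf_digraph_iff: "pair_wf_digraph G \<longleftrightarrow> parcs G \<subseteq> pverts G \<times> pverts G"
  by (auto simp: pair_wf_digraph_def)

lemma awalk_relpow:
  assumes "pair_wf_digraph G"
  shows "(\<exists>p. pre_digraph.awalk (with_proj G) u p v \<and> length p = k) \<longleftrightarrow>
           u \<in> pverts G \<and> (u, v) \<in> parcs G ^^ k"
proof -
  interpret pair_wf_digraph G by fact
  show ?thesis
  proof (induction k arbitrary: u)
    case 0
    then show ?case by (auto simp: awalk_Nil_iff)
  next
    case (Suc k)
    show ?case
    proof
      assume "\<exists>p. awalk u p v \<and> length p = Suc k"
      then obtain e p where "awalk u (e # p) v" "length p = k" by (metis length_Suc_conv)
      then show "u \<in> pverts G \<and> (u, v) \<in> parcs G ^^ Suc k"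
        using Suc.IH[of "snd e"] arc_fst_in_verts[of e] relpow_Suc_I2[of u "snd e" "parcs G" v k]
        by (cases e) (auto simp: awalk_Cons_iff)
    next
      assume "u \<in> pverts G \<and> (u, v) \<in> parcs G ^^ Suc k"
      then obtain w where w: "(u, w) \<in> parcs G" "(w, v) \<in> parcs G ^^ k"
        by (metis relpow_Suc_D2)
      then obtain p where "awalk w p v" "length p = k"
        using Suc.IH[of w] in_arcsD2 by blast
      then have "awalk u ((u, w) # p) v \<and> length ((u, w) # p) = Suc k"
        using w by (auto simp: awalk_Cons_iff)
      then show "\<exists>p. awalk u p v \<and> length p = Suc k" by blast
    qed
  qed
qed

lemma (in wf_digraph) unit_awalk_cost: "awalk_cost (\<lambda>_. 1) p = real (length p)"
  by (induction p) auto

lemma unit_distance_le_iff: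
  assumes "pair_wf_digraph G" "u \<in> pverts G"
  shows "wf_digraph.\<mu> (with_proj G) (\<lambda>_. 1) u v \<le> ereal (real k) \<longleftrightarrow>
           (\<exists>j\<le>k. (u, v) \<in> parcs G ^^ j)"
proof -
  interpret pair_wf_digraph G by fact
  show ?thesis
  proof
    assume "\<mu> (\<lambda>_. 1) u v \<le> ereal (real k)"
    then have "(INF p\<in>{p. awalk u p v}. ereal (awalk_cost (\<lambda>_. 1) p)) < ereal (real (Suc k))"
      by (auto simp: \<mu>_def intro: le_less_trans)
    then obtain p where "awalk u p v" "length p < Suc k"
      unfolding INF_less_iff by (auto simp: unit_awalk_cost)
    then show "\<exists>j\<le>k. (u, v) \<in> parcs G ^^ j"
      using awalk_relpow[OF assms(1), of u v "length p"] by (auto simp: less_Suc_eq_le)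
  next
    assume "\<exists>j\<le>k. (u, v) \<in> parcs G ^^ j"
    then obtain j where "j \<le> k" "(u, v) \<in> parcs G ^^ j" by blast
    then obtain p where "awalk u p v" "length p \<le> k"
      using awalk_relpow[OF assms(1), of u v j] assms(2) by blast
    then show "\<mu> (\<lambda>_. 1) u v \<le> ereal (real k)"
      by (auto simp: \<mu>_def unit_awalk_cost intro!: INF_lower2)
  qed
qed

lemma unit_distance_geI:
  assumes "pair_wf_digraph G" "\<And>j. j < k \<Longrightarrow> (u, v) \<notin> parcs G ^^ j"
  shows "ereal (real k) \<le> wf_digraph.\<mu> (with_proj G) (\<lambda>_. 1) u v"
proof -
  interpret pair_wf_digraph G by fact
  show ?thesis
    unfolding \<mu>_def
  proof (rule INF_greatest)
    fix p assume "p \<in> {p. awalk u p v}"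
    then have "(u, v) \<in> parcs G ^^ length p"
      using awalk_relpow[OF assms(1)] by blast
    then have "k \<le> length p" using assms(2) by (meson not_le)
    then show "ereal (real k) \<le> ereal (awalk_cost (\<lambda>_. 1) p)"
      by (simp add: unit_awalk_cost)
  qed
qed

lemma graph_diameter_le_iff:
  assumes "pair_wf_digraph G"
  shows "graph_diameter G \<le> ereal (real k) \<longleftrightarrow>
    (\<forall>u\<in>pverts G. \<forall>v\<in>pverts G. \<exists>j\<le>k. (u, v) \<in> parcs G ^^ j)"
  using unit_distance_le_iff[OF assms] by (simp add: graph_diameter_def SUP_le_iff)

text \<open>
  Diameters are handled through powers of the arc relation, so that walks can be composed,
  reversed and projected without reference to arc lists. The same is done below for the
  girth, with lists of vertices in place of closed arc walks.
\<close>
lemma graph_diameter_eq_iff: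
  assumes wf: "pair_wf_digraph G" and "k > 0"
  shows "graph_diameter G = ereal (real k) \<longleftrightarrow>
    (\<forall>u\<in>pverts G. \<forall>v\<in>pverts G. \<exists>j\<le>k. (u, v) \<in> parcs G ^^ j) \<and>
    (\<exists>u\<in>pverts G. \<exists>v\<in>pverts G. \<forall>j<k. (u, v) \<notin> parcs G ^^ j)"
    (is "?L \<longleftrightarrow> ?R1 \<and> ?R2")
proof
  assume L: ?L
  then have ?R1 using graph_diameter_le_iff[OF wf, of k] by simp
  (* The diameter k is attained: otherwise all distances, being integers, would be at most k
     - 1. *)
  moreover have "\<not> graph_diameter G \<le> ereal (real (k - 1))"
    using L \<open>k > 0\<close> by simp
  then obtain u v where uv: "u \<in> pverts G" "v \<in> pverts G" "\<And>j. j \<le> k - 1 \<Longrightarrow> (u, v) \<notin> parcs G ^^ j"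
    unfolding graph_diameter_le_iff[OF wf] by blast
  have ?R2
    by (rule bexI[OF bexI[OF _ uv(2)] uv(1)]) (auto intro!: uv(3))
  ultimately show "?R1 \<and> ?R2" ..
next
  assume R: "?R1 \<and> ?R2"
  then obtain u v where uv: "u \<in> pverts G" "v \<in> pverts G" "\<forall>j<k. (u, v) \<notin> parcs G ^^ j"
    by blast
  then have "ereal (real k) \<le> wf_digraph.\<mu> (with_proj G) (\<lambda>_. 1) u v"
    by (auto intro: unit_distance_geI[OF wf])
  also have "\<dots> \<le> graph_diameter G"
    unfolding graph_diameter_def 
    by (rule SUP_upper2[OF uv(1)], rule SUP_upper2[OF uv(2)]) simp
  finally show ?L using R graph_diameter_le_iff[OF wf, of k] by (simp add: antisym)
qed

text \<open>
  The lists of length \<open>2\<close> that run back and forth along an edge are included, as the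
  corresponding directed cycles are. Statements about the girth exclude this length
  explicitly.
\<close>
definition is_cycle :: "'a rel \<Rightarrow> 'a list \<Rightarrow> bool" where
  "is_cycle E xs \<longleftrightarrow> xs \<noteq> [] \<and> distinct xs \<and>
     (\<forall>i<length xs. (xs ! i, xs ! (Suc i mod length xs)) \<in> E)"

lemma pcas_conv:
  "pcas u c v \<Longrightarrow> pawalk_verts u c = map fst c @ [v] \<and>
     (\<forall>i<length c. snd (c ! i) = (map fst c @ [v]) ! Suc i) \<and> hd (map fst c @ [v]) = u"
proof (induction c arbitrary: u)
  case (Cons e c)
  then have IH: "pawalk_verts (snd e) c = map fst c @ [v]"
    "\<forall>i<length c. snd (c ! i) = (map fst c @ [v]) ! Suc i" "hd (map fst c @ [v]) = snd e"
    by auto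
  have "snd ((e # c) ! i) = (map fst (e # c) @ [v]) ! Suc i" if "i < length (e # c)" for i
    using that IH by (cases i) (auto simp: hd_conv_nth)
  with IH Cons.prems show ?case by auto
qed auto

lemma pcas_map: "pcas (f 0) (map (\<lambda>i. (f i, f (Suc i))) [0..<m]) (f m) \<and>
   pawalk_verts (f 0) (map (\<lambda>i. (f i, f (Suc i))) [0..<m]) = map f [0..<Suc m]"
proof (induction m arbitrary: f)
  case (Suc m)
  have "[0..<Suc m] = 0 # map Suc [0..<m]" for m by (metis map_Suc_upt upt_conv_Cons zero_less_Suc)
  then show ?case using Suc[of "\<lambda>i. f (Suc i)"] by (simp add: comp_def del: upt_Suc)
qed simp

text \<open>
  A closed walk along arcs \<open>(v\<^sub>0, v\<^sub>1), \<dots>, (v\<^sub>m\<^sub>-\<^sub>1, v\<^sub>0)\<close> lists \<open>v\<^sub>0\<close> twice, as first and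
  as last vertex; this is why the library asks only the tail of its vertex list to be
  distinct, which amounts to the distinctness of \<open>v\<^sub>0, \<dots>, v\<^sub>m\<^sub>-\<^sub>1\<close>.
\<close>
lemma cycle_iff_is_cycle:
  assumes "pair_wf_digraph G"
  shows "(\<exists>c. pre_digraph.cycle (with_proj G) c \<and> length c = m) \<longleftrightarrow>
         (\<exists>xs. is_cycle (parcs G) xs \<and> length xs = m)"
proof -
  interpret pair_wf_digraph G by fact
  show ?thesis
  proof
    assume "\<exists>c. cycle c \<and> length c = m"
    then obtain u c where c: "awalk u c u" "distinct (tl (pawalk_verts u c))" "c \<noteq> []"
      and m: "length c = m"
      unfolding cycle_def by auto
    then have cas: "pcas u c u" and arcs: "set c \<subseteq> parcs G" by (auto simp: awalk_def)
    note conv = pcas_conv[OF cas]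
    let ?xs = "map fst c"
    have hd: "hd ?xs = u" using conv c by (cases c) auto
    have "distinct ?xs" using conv c hd by (cases c) auto
    moreover have "(?xs ! i, ?xs ! (Suc i mod length ?xs)) \<in> parcs G" if "i < length ?xs" for i
    proof -
      have "snd (c ! i) = ?xs ! (Suc i mod length ?xs)"
      proof (cases "Suc i = length c")
        case True
        then show ?thesis using conv that c hd by (auto simp: nth_append hd_conv_nth)
      next
        case False
        then show ?thesis using conv that by (auto simp: nth_append)
      qed
      moreover have "c ! i \<in> parcs G" using arcs that by auto
      ultimately show ?thesis using that by (metis length_map nth_map prod.collapse)
    qed
    ultimately have "is_cycle (parcs G) ?xs" using c by (auto simp: is_cycle_def)
    then show "\<exists>xs. is_cycle (parcs G) xs \<and> length xs = m" using m by (metis length_map)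
  next
    assume "\<exists>xs. is_cycle (parcs G) xs \<and> length xs = m"
    then obtain xs where xs: "is_cycle (parcs G) xs" and m: "length xs = m" by blast
    define f where "f i = xs ! (i mod m)" for i
    let ?c = "map (\<lambda>i. (f i, f (Suc i))) [0..<m]"
    have m0: "m > 0" using xs m by (auto simp: is_cycle_def)
    have arcs: "set ?c \<subseteq> parcs G"
      using xs m by (auto simp: is_cycle_def f_def)
    have "f m = f 0" by (simp add: f_def)
    then have cas: "pcas (f 0) ?c (f 0)" and verts: "pawalk_verts (f 0) ?c = map f [0..<Suc m]"
      using pcas_map[of f m] by auto
    have f0: "f 0 \<in> pverts G" using arcs m0 in_arcsD1 by fastforce
    have "tl (map f [0..<Suc m]) = map f ([1..<m] @ [m])"
      using m0 by (simp add: upt_rec[of 0])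
    also have "distinct \<dots>"
    proof -
      have "map f (0 # [1..<m]) = xs"
        using m m0 by (intro nth_equalityI) (auto simp: f_def upt_conv_Cons[symmetric])
      then have "distinct (map f (0 # [1..<m]))" using xs by (simp add: is_cycle_def)
      then show ?thesis using \<open>f m = f 0\<close> by auto
    qed
    finally have "cycle ?c"
      unfolding cycle_def awalk_def using cas verts arcs f0 m0 by (auto intro!: exI[of _ "f 0"] simp del: upt_Suc)
    then show "\<exists>c. cycle c \<and> length c = m"
      by (intro exI[of _ ?c]) simp
  qed
qed

lemma graph_girth_eq_iff:
  assumes wf: "pair_wf_digraph G" and "g \<noteq> 2"
  shows "graph_girth G = enat g \<longleftrightarrow>
    (\<exists>xs. is_cycle (parcs G) xs \<and> length xs = g) \<and>
    (\<forall>xs. is_cycle (parcs G) xs \<longrightarrow> length xs \<noteq> 2 \<longrightarrow> g \<le> length xs)"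
proof -
  define S where "S = {m. m \<noteq> 2 \<and> (\<exists>xs. is_cycle (parcs G) xs \<and> length xs = m)}"
  have "S = length ` {c. pre_digraph.cycle (with_proj G) c \<and> length c \<noteq> 2}"
    unfolding S_def cycle_iff_is_cycle[OF wf, symmetric] by auto
  then have eq: "graph_girth G = Inf (enat ` S)" by (simp add: graph_girth_def image_image)
  have iff: "Inf (enat ` S) = enat g \<longleftrightarrow> g \<in> S \<and> (\<forall>m\<in>S. g \<le> m)"
  proof
    assume L: "Inf (enat ` S) = enat g"
    then have ne: "enat ` S \<noteq> {}" by (auto simp: Inf_enat_def)
    then have "Inf (enat ` S) \<in> enat ` S"
      by (auto simp: Inf_enat_def intro: LeastI)
    then show "g \<in> S \<and> (\<forall>m\<in>S. g \<le> m)"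
      using L by (metis Inf_lower enat_ord_simps(1) image_iff enat.inject)
  next
    assume "g \<in> S \<and> (\<forall>m\<in>S. g \<le> m)"
    then show "Inf (enat ` S) = enat g"
      by (intro antisym Inf_lower Inf_greatest) auto
  qed
  show ?thesis unfolding eq iff using \<open>g \<noteq> 2\<close> by (auto simp: S_def)
qed

section \<open>Relabelling of vertices\<close>

text \<open>
  Quotients, their products and the incidence graph of a transported geometry are all images
  of a simpler graph under an injective map, and it is in this form that their parameters
  are computed.
\<close>
definition relabel :: "('a \<Rightarrow> 'b) \<Rightarrow> 'a pair_pre_digraph \<Rightarrow> 'b pair_pre_digraph" where
  "relabel f G = \<lparr>pverts = f ` pverts G, parcs = map_prod f f ` parcs G\<rparr>"

lemma relabel_simps [simp]:
  "pverts (relabel f G) = f ` pverts G" "parcs (relabel f G) = map_prod f f ` parcs G"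
  by (simp_all add: relabel_def)

lemma wf_relabel: "pair_wf_digraph G \<Longrightarrow> pair_wf_digraph (relabel f G)"
  by (auto simp: pair_wf_digraph_iff)

lemma relabel_arc_iff:
  assumes "pair_wf_digraph G" "inj_on f (pverts G)" "u \<in> pverts G" "v \<in> pverts G"
  shows "(f u, f v) \<in> parcs (relabel f G) \<longleftrightarrow> (u, v) \<in> parcs G"
proof
  assume "(f u, f v) \<in> parcs (relabel f G)"
  then obtain a b where ab: "(a, b) \<in> parcs G" "f u = f a" "f v = f b" by auto
  then have "a \<in> pverts G" "b \<in> pverts G" using assms(1) by (auto simp: pair_wf_digraph_iff)
  then show "(u, v) \<in> parcs G" using ab assms(2-4) by (metis inj_onD)
qed auto

lemma relpow_verts:
  assumes "pair_wf_digraph G" "(u, v) \<in> parcs G ^^ k" "u \<in> pverts G"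
  shows "v \<in> pverts G"
  using assms(2,3) by (induction k arbitrary: v) (use assms(1) in \<open>auto simp: pair_wf_digraph_iff\<close>)

lemma relabel_relpow_iff:
  assumes wf: "pair_wf_digraph G" and inj: "inj_on f (pverts G)"
    and "u \<in> pverts G" "v \<in> pverts G"
  shows "(f u, f v) \<in> parcs (relabel f G) ^^ k \<longleftrightarrow> (u, v) \<in> parcs G ^^ k"
  using \<open>v \<in> pverts G\<close>
proof (induction k arbitrary: v)
  case 0
  then show ?case using inj \<open>u \<in> pverts G\<close> by (auto dest: inj_onD)
next
  case (Suc k)
  show ?case
  proof
    assume "(f u, f v) \<in> parcs (relabel f G) ^^ Suc k"
    then obtain z where z: "(f u, z) \<in> parcs (relabel f G) ^^ k" "(z, f v) \<in> parcs (relabel f G)"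
      by (auto simp del: relabel_simps)
    then obtain w where w: "z = f w" "w \<in> pverts G" using wf by (auto simp: pair_wf_digraph_iff)
    then have "(w, v) \<in> parcs G" using z Suc.prems relabel_arc_iff[OF wf inj] by blast
    with z w show "(u, v) \<in> parcs G ^^ Suc k" using Suc.IH[of w] by auto
  next
    assume "(u, v) \<in> parcs G ^^ Suc k"
    then obtain w where w: "(u, w) \<in> parcs G ^^ k" "(w, v) \<in> parcs G" by auto
    then have "w \<in> pverts G" using relpow_verts[OF wf] \<open>u \<in> pverts G\<close> by blast
    then show "(f u, f v) \<in> parcs (relabel f G) ^^ Suc k"
      using w Suc.IH[of w] relabel_arc_iff[OF wf inj \<open>w \<in> pverts G\<close> Suc.prems]
      by (auto simp del: relabel_simps)
  qed
qed

lemma graph_diameter_relabel: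
  assumes "pair_wf_digraph G" "inj_on f (pverts G)" "k > 0"
  shows "graph_diameter (relabel f G) = ereal (real k) \<longleftrightarrow> graph_diameter G = ereal (real k)"
  using assms relabel_relpow_iff[OF assms(1,2)]
  by (simp add: graph_diameter_eq_iff wf_relabel del: relabel_simps(2))

lemma is_cycle_verts:
  assumes "pair_wf_digraph G" "is_cycle (parcs G) xs" shows "set xs \<subseteq> pverts G"
proof
  fix x assume "x \<in> set xs"
  then obtain i where "i < length xs" "x = xs ! i" by (auto simp: in_set_conv_nth)
  then have "(x, xs ! (Suc i mod length xs)) \<in> parcs G" using assms by (auto simp: is_cycle_def)
  then show "x \<in> pverts G" using assms by (auto simp: pair_wf_digraph_iff)
qed

lemma is_cycle_relabel:
  assumes wf: "pair_wf_digraph G" and inj: "inj_on f (pverts G)"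
  shows "(\<exists>xs. is_cycle (parcs (relabel f G)) xs \<and> length xs = m) \<longleftrightarrow>
         (\<exists>xs. is_cycle (parcs G) xs \<and> length xs = m)"
proof
  assume "\<exists>xs. is_cycle (parcs G) xs \<and> length xs = m"
  then obtain xs where xs: "is_cycle (parcs G) xs" "length xs = m" by blast
  have V: "set xs \<subseteq> pverts G" using is_cycle_verts[OF wf xs(1)] .
  have "is_cycle (parcs (relabel f G)) (map f xs)"
    using xs V inj_on_subset[OF inj V] by (auto simp: is_cycle_def distinct_map)
  then show "\<exists>xs. is_cycle (parcs (relabel f G)) xs \<and> length xs = m"
    using xs by (metis length_map)
next
  assume "\<exists>xs. is_cycle (parcs (relabel f G)) xs \<and> length xs = m"
  then obtain ys where ys: "is_cycle (parcs (relabel f G)) ys" "length ys = m" by blast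
  then have "set ys \<subseteq> f ` pverts G" using is_cycle_verts[OF wf_relabel[OF wf] ys(1)] by simp
  then have "ys \<in> lists (f ` pverts G)" by auto
  then obtain xs where xs: "set xs \<subseteq> pverts G" "ys = map f xs"
    unfolding lists_image by auto
  have "is_cycle (parcs G) xs"
    unfolding is_cycle_def
  proof (intro conjI allI impI)
    show "xs \<noteq> []" "distinct xs" using ys xs by (auto simp: is_cycle_def distinct_map)
    fix i assume i: "i < length xs"
    then have "length xs > 0" by linarith
    then have i': "Suc i mod length xs < length xs" by (rule mod_less_divisor)
    have "(ys ! i, ys ! (Suc i mod length ys)) \<in> parcs (relabel f G)"
      using ys i xs by (auto simp: is_cycle_def)
    then have "(f (xs ! i), f (xs ! (Suc i mod length xs))) \<in> parcs (relabel f G)"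
      using i i' by (simp add: xs(2))
    moreover have "xs ! i \<in> pverts G" "xs ! (Suc i mod length xs) \<in> pverts G"
      using i i' xs(1) by (auto dest: nth_mem)
    ultimately show "(xs ! i, xs ! (Suc i mod length xs)) \<in> parcs G"
      using relabel_arc_iff[OF wf inj] by blast
  qed
  then show "\<exists>xs. is_cycle (parcs G) xs \<and> length xs = m"
    using ys(2) by (intro exI[of _ xs]) (simp add: xs(2))
qed

lemma graph_girth_relabel:
  assumes "pair_wf_digraph G" "inj_on f (pverts G)" "g \<noteq> 2"
  shows "graph_girth (relabel f G) = enat g \<longleftrightarrow> graph_girth G = enat g"
proof -
  have all_lengths: "(\<forall>xs. is_cycle E xs \<longrightarrow> length xs \<noteq> 2 \<longrightarrow> g \<le> length xs) \<longleftrightarrow>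
      (\<forall>m. (\<exists>xs. is_cycle E xs \<and> length xs = m) \<longrightarrow> m \<noteq> 2 \<longrightarrow> g \<le> m)" for E :: "'c rel"
    by blast
  show ?thesis
    unfolding graph_girth_eq_iff[OF assms(1,3)] graph_girth_eq_iff[OF wf_relabel[OF assms(1)] assms(3)]
      all_lengths is_cycle_relabel[OF assms(1,2)] ..
qed

lemma out_degree_with_proj:
  "out_degree (with_proj G) v = card {w. (v, w) \<in> parcs G}"
proof -
  have "{e \<in> parcs G. fst e = v} = Pair v ` {w. (v, w) \<in> parcs G}" by force
  then show ?thesis by (simp add: out_degree_def out_arcs_def card_image inj_on_def)
qed

lemma graph_degree_relabel:
  assumes "pair_wf_digraph G" "inj_on f (pverts G)"
  shows "graph_degree (relabel f G) = graph_degree G"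
proof -
  have "card {w. (f v, w) \<in> parcs (relabel f G)} = card {w. (v, w) \<in> parcs G}"
    if "v \<in> pverts G" for v
  proof -
    have "{w. (f v, w) \<in> parcs (relabel f G)} = f ` {w. (v, w) \<in> parcs G}"
    proof (intro subset_antisym subsetI)
      fix w assume w: "w \<in> {w. (f v, w) \<in> parcs (relabel f G)}"
      then obtain b where b: "b \<in> pverts G" "w = f b"
        using assms(1) by (auto simp: pair_wf_digraph_iff)
      then show "w \<in> f ` {w. (v, w) \<in> parcs G}"
        using w relabel_arc_iff[OF assms that b(1)] by blast
    qed auto
    moreover have "inj_on f {w. (v, w) \<in> parcs G}"
      using assms by (auto simp: pair_wf_digraph_iff intro: inj_on_subset)
    ultimately show ?thesis by (simp add: card_image)
  qed
  then show ?thesis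
    by (simp add: graph_degree_def out_degree_with_proj image_image cong: image_cong del: relabel_simps(2))
qed

lemma graph_order_relabel: "inj_on f (pverts G) \<Longrightarrow> graph_order (relabel f G) = graph_order G"
  by (simp add: graph_order_def card_image)

lemma delete_loops_relabel:
  assumes "pair_wf_digraph G" "inj_on f (pverts G)"
  shows "delete_loops (relabel f G) = relabel f (delete_loops G)"
proof -
  have "{(x, y) \<in> map_prod f f ` parcs G. x \<noteq> y} = map_prod f f ` {(x, y) \<in> parcs G. x \<noteq> y}"
    (is "?A = ?B")
  proof (intro subset_antisym subsetI)
    fix e assume "e \<in> ?B"
    then obtain x y where xy: "(x, y) \<in> parcs G" "x \<noteq> y" "e = (f x, f y)" by auto
    then have "x \<in> pverts G" "y \<in> pverts G" using assms(1) by (auto simp: pair_wf_digraph_iff)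
    then have "f x \<noteq> f y" using xy assms(2) by (metis inj_onD)
    then show "e \<in> ?A" using xy by auto
  qed auto
  then show ?thesis by (simp add: delete_loops_def relabel_def)
qed

lemma wf_delete_loops: "pair_wf_digraph G \<Longrightarrow> pair_wf_digraph (delete_loops G)"
  by (auto simp: pair_wf_digraph_iff delete_loops_def)

lemma graph_isomorphic_relabel_relabel:
  assumes "pair_wf_digraph G" "inj_on f (pverts G)" "inj_on g (pverts G)"
  shows "graph_isomorphic (relabel f G) (relabel g G)"
proof -
  define h where "h = g \<circ> the_inv_into (pverts G) f"
  have h: "h (f v) = g v" if "v \<in> pverts G" for v
    using that assms by (simp add: h_def the_inv_into_f_f)
  let ?i = "\<lparr>iso_verts = h, iso_arcs = map_prod h h, iso_head = snd, iso_tail = fst\<rparr>"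
  have inj: "inj_on h (f ` pverts G)"
  proof (rule inj_onI)
    fix a b assume "a \<in> f ` pverts G" "b \<in> f ` pverts G" and eq: "h a = h b"
    then obtain x y where xy: "x \<in> pverts G" "y \<in> pverts G" "a = f x" "b = f y" by auto
    then have "x = y" using eq h assms(3) by (metis inj_onD)
    then show "a = b" using xy by simp
  qed
  have arcs: "map_prod f f ` parcs G \<subseteq> (f ` pverts G) \<times> (f ` pverts G)"
    using assms(1) by (auto simp: pair_wf_digraph_iff)
  have iso: "pre_digraph.digraph_isomorphism (with_proj (relabel f G)) ?i"
    unfolding pre_digraph.digraph_isomorphism_def
    using wf_relabel[OF assms(1), of f] inj inj_on_subset[OF map_prod_inj_on[OF inj inj] arcs]
    by (auto simp: wf_digraph_wp_iff)
  have "with_proj (relabel g G) = app_iso ?i (with_proj (relabel f G))"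
  proof -
    have "g ` pverts G = h ` f ` pverts G" using h by (simp add: image_image)
    moreover have "map_prod g g ` parcs G = map_prod h h ` map_prod f f ` parcs G"
      unfolding image_image
    proof (rule image_cong[OF refl])
      fix e assume "e \<in> parcs G"
      then have "fst e \<in> pverts G" "snd e \<in> pverts G"
        using assms(1) by (auto simp: pair_wf_digraph_iff)
      then show "map_prod g g e = map_prod h h (map_prod f f e)"
        using h by (cases e) auto
    qed
    ultimately show ?thesis by (simp add: with_proj_def app_iso_def)
  qed
  with iso show ?thesis unfolding graph_isomorphic_def digraph_iso_def by blast
qed

lemma graph_isomorphic_degree:
  assumes "graph_isomorphic G H"
  shows "graph_degree G = graph_degree H"
proof -
  obtain i where i: "pre_digraph.digraph_isomorphism (with_proj G) i"
    "with_proj H = app_iso i (with_proj G)"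
    using assms by (auto simp: graph_isomorphic_def digraph_iso_def)
  have wf: "wf_digraph (with_proj G)"
    using i(1) by (simp add: pre_digraph.digraph_isomorphism_def)
  have "pverts H = iso_verts i ` pverts G"
    using arg_cong[OF i(2), of verts] by simp
  moreover have "out_degree (with_proj H) (iso_verts i v) = out_degree (with_proj G) v"
    if "v \<in> pverts G" for v
    using wf_digraph.out_degree_app_iso_eq[OF wf i(1), of v] that i(2) by simp
  ultimately show ?thesis by (simp add: graph_degree_def image_image cong: image_cong)
qed

section \<open>Nonbacktracking walks\<close>

text \<open>
  A walk of length \<open>m\<close> is the restriction of \<open>f\<close> to \<open>{0..m}\<close>; the values beyond \<open>m\<close> are
  arbitrary.
\<close>
definition nonbacktracking :: "'a rel \<Rightarrow> (nat \<Rightarrow> 'a) \<Rightarrow> nat \<Rightarrow> bool" where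
  "nonbacktracking E f m \<longleftrightarrow> (\<forall>i<m. (f i, f (Suc i)) \<in> E) \<and>
     (\<forall>i. Suc (Suc i) \<le> m \<longrightarrow> f i \<noteq> f (Suc (Suc i)))"

lemma nonbacktracking_le: "nonbacktracking E f m \<Longrightarrow> k \<le> m \<Longrightarrow> nonbacktracking E f k"
  by (auto simp: nonbacktracking_def)

lemma nonbacktracking_shift: "nonbacktracking E f (Suc m) \<Longrightarrow> nonbacktracking E (\<lambda>i. f (Suc i)) m"
  by (auto simp: nonbacktracking_def)

lemma nonbacktracking_Cons:
  assumes "nonbacktracking E f m" "(x, f 0) \<in> E" "m = 0 \<or> f 1 \<noteq> x"
  shows "nonbacktracking E (case_nat x f) (Suc m)"
  using assms by (auto simp: nonbacktracking_def split: nat.splits)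

lemma nonbacktracking_snoc:
  assumes "nonbacktracking E f m" "(f m, y) \<in> E" "m = 0 \<or> f (m - 1) \<noteq> y"
  shows "nonbacktracking E (f(Suc m := y)) (Suc m)"
  using assms by (auto simp: nonbacktracking_def less_Suc_eq le_Suc_eq)

lemma nonbacktracking_relpow: "nonbacktracking E f m \<Longrightarrow> (f 0, f m) \<in> E ^^ m"
  unfolding relpow_fun_conv nonbacktracking_def by blast

text \<open>
  A shortest walk does not backtrack, for a piece \<open>x, y, x\<close> of it could be cut out.
\<close>
lemma relpow_imp_nonbacktracking:
  assumes "(u, v) \<in> E ^^ m"
  obtains j f where "j \<le> m" "nonbacktracking E f j" "f 0 = u" "f j = v"
proof -
  define j where "j = (LEAST j. (u, v) \<in> E ^^ j)"
  have j: "(u, v) \<in> E ^^ j" and least: "\<And>i. (u, v) \<in> E ^^ i \<Longrightarrow> j \<le> i"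
    unfolding j_def using assms by (auto intro: LeastI Least_le)
  then obtain f where f: "f 0 = u" "f j = v" "\<forall>i<j. (f i, f (Suc i)) \<in> E"
    unfolding relpow_fun_conv by blast
  have "f i \<noteq> f (Suc (Suc i))" if "Suc (Suc i) \<le> j" for i
  proof
    assume eq: "f i = f (Suc (Suc i))"
    have "(f 0, f i) \<in> E ^^ i"
      unfolding relpow_fun_conv using f that by (intro exI[of _ f]) auto
    moreover obtain l where l: "j = Suc (Suc i) + l" using \<open>Suc (Suc i) \<le> j\<close> le_Suc_ex by blast
    have "(f (Suc (Suc i)), f j) \<in> E ^^ l"
      unfolding relpow_fun_conv using f l by (intro exI[of _ "\<lambda>k. f (Suc (Suc i) + k)"]) auto
    ultimately have "(u, v) \<in> E ^^ (i + l)"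
      unfolding relpow_add using f eq by auto
    then show False using least[of "i + l"] l by simp
  qed
  then have "nonbacktracking E f j" using f by (auto simp: nonbacktracking_def)
  then show thesis using that[of j f] least[OF assms] f by blast
qed

text \<open>
  A shortest closed piece of a closed nonbacktracking walk is a cycle: its vertices are
  distinct by minimality, and its length is neither \<open>1\<close> (no loops) nor \<open>2\<close> (no
  backtracking). The walk itself is allowed to backtrack at the vertex where it closes up.
\<close>
lemma closed_nonbacktracking_length:
  assumes girth: "\<And>xs. is_cycle E xs \<Longrightarrow> length xs \<noteq> 2 \<Longrightarrow> g \<le> length xs"
    and loopless: "\<And>x. (x, x) \<notin> E"
    and f: "nonbacktracking E f m" "m > 0" "f 0 = f m"
  shows "g \<le> m"
proof -
  define P where "P d \<longleftrightarrow> d > 0 \<and> (\<exists>i. i + d \<le> m \<and> f i = f (i + d))" for d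
  define d where "d = (LEAST d. P d)"
  have "P m" using f unfolding P_def by (intro conjI exI[of _ 0]) auto
  then have "P d" and least: "\<And>d'. P d' \<Longrightarrow> d \<le> d'"
    unfolding d_def by (auto intro: LeastI Least_le)
  then obtain i where i: "d > 0" "i + d \<le> m" "f i = f (i + d)" by (auto simp: P_def)
  let ?xs = "map f [i..<i + d]"
  have "f a \<noteq> f b" if "i \<le> a" "a < b" "b < i + d" for a b
  proof
    assume "f a = f b"
    then have "P (b - a)" using that i by (auto simp: P_def intro!: exI[of _ a])
    then show False using least[of "b - a"] that by simp
  qed
  then have "inj_on f {i..<i + d}"
    by (intro linorder_inj_onI) auto
  then have "distinct ?xs" by (simp add: distinct_map)
  moreover have "(?xs ! k, ?xs ! (Suc k mod d)) \<in> E" if "k < d" for k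
  proof -
    have "?xs ! (Suc k mod d) = f (i + Suc k)"
      using that i by (cases "Suc k = d") auto
    then show ?thesis using f i that by (auto simp: nonbacktracking_def)
  qed
  ultimately have "is_cycle E ?xs" using i by (simp add: is_cycle_def)
  moreover have "d \<noteq> 1"
  proof
    assume "d = 1"
    then have "f (Suc i) = f i" using i(3) by simp
    moreover have "(f i, f (Suc i)) \<in> E"
      using f(1) i(2) \<open>d = 1\<close> unfolding nonbacktracking_def by auto
    ultimately show False using loopless[of "f i"] by simp
  qed
  moreover have "d \<noteq> 2"
    using f(1) i by (auto simp: nonbacktracking_def)
  ultimately show ?thesis using girth[of ?xs] i by simp
qed

text \<open>
  If the last steps of the two walks agree, they can be removed. If they differ, going along
  the first walk and back along the second one is a closed nonbacktracking walk that is
  shorter than the girth.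
\<close>
lemma nonbacktracking_unique:
  assumes girth: "\<And>xs. is_cycle E xs \<Longrightarrow> length xs \<noteq> 2 \<Longrightarrow> g \<le> length xs"
    and loopless: "\<And>x. (x, x) \<notin> E" and sym: "sym E"
    and "nonbacktracking E f i" "nonbacktracking E h j" "f 0 = h 0" "f i = h j" "i + j < g"
  shows "i = j \<and> (\<forall>k\<le>i. f k = h k)"
  using assms(4-8)
proof (induction i arbitrary: j)
  case 0
  then have "j = 0"
    using closed_nonbacktracking_length[OF girth loopless, of h j] by fastforce
  then show ?case using 0 by simp
next
  case (Suc i)
  show ?case
  proof (cases j)
    case 0
    then show ?thesis
      using Suc.prems closed_nonbacktracking_length[OF girth loopless, of f "Suc i"] by fastforce
  next
    case (Suc j')
    show ?thesis
    proof (cases "f i = h j'")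
      case True
      then have "i = j' \<and> (\<forall>k\<le>i. f k = h k)"
        using Suc Suc.prems by (intro Suc.IH) (auto intro: nonbacktracking_le)
      then show ?thesis using Suc Suc.prems by (auto simp: le_Suc_eq)
    next
      case False
      (* c runs along f and returns along h. *)
      define c where "c k = (if k \<le> Suc i then f k else h (Suc i + j - k))" for k
      have "nonbacktracking E c (Suc i + j)"
        unfolding nonbacktracking_def
      proof (intro conjI allI impI)
        fix k assume k: "k < Suc i + j"
        show "(c k, c (Suc k)) \<in> E"
        proof (cases "k < Suc i")
          case True
          then show ?thesis using Suc.prems by (auto simp: c_def nonbacktracking_def)
        next
          case False
          then have eq: "c k = h (Suc i + j - k)" "c (Suc k) = h (i + j - k)"
            using Suc.prems by (auto simp: c_def)
          have "Suc i + j - k = Suc (i + j - k)" "i + j - k < j" using k False by auto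
          then have "(h (i + j - k), h (Suc i + j - k)) \<in> E"
            using Suc.prems by (auto simp: nonbacktracking_def)
          then show ?thesis unfolding eq using sym by (auto dest: symD)
        qed
      next
        fix k assume k: "Suc (Suc k) \<le> Suc i + j"
        show "c k \<noteq> c (Suc (Suc k))"
        proof (cases "k < i")
          case True
          then show ?thesis using Suc.prems by (auto simp: c_def nonbacktracking_def)
        next
          case ki: False
          show ?thesis
          proof (cases "k = i")
            case True
            then show ?thesis using False Suc by (simp add: c_def)
          next
            case False
            define l where "l = i + j - Suc k"
            have l: "Suc (Suc l) \<le> j" "Suc i + j - k = Suc (Suc l)" "Suc i + j - Suc (Suc k) = l"
              using False ki k by (auto simp: l_def)
            have "c k = h (Suc i + j - k)"
              using False ki Suc.prems by (cases "k = Suc i") (auto simp: c_def)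
            moreover have "c (Suc (Suc k)) = h l"
              using False ki l by (simp add: c_def)
            ultimately have "c k = h (Suc (Suc l))" "c (Suc (Suc k)) = h l"
              using l by simp_all
            then show ?thesis using l Suc.prems by (auto simp: nonbacktracking_def)
          qed
        qed
      qed
      moreover have "c 0 = c (Suc i + j)" using Suc.prems Suc by (simp add: c_def)
      ultimately have "g \<le> Suc i + j"
        using closed_nonbacktracking_length[OF girth loopless, of c "Suc i + j"] by simp
      then show ?thesis using Suc.prems by simp
    qed
  qed
qed

section \<open>Polygons with a polarity\<close>

text \<open>
  The part of the definition of a generalized polygon of order \<open>(q, q)\<close> with a polarity that
  enters the computation, as a statement about the bipartite incidence graph on \<open>P \<union> L\<close>.
\<close>
locale polygon_with_polarity =
  fixes P L :: "'a set" and E :: "'a rel" and n q :: nat and \<rho> :: "'a \<Rightarrow> 'a"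
  assumes n_ge_3: "3 \<le> n" and q_pos: "q > 0"
    and arcs: "E \<subseteq> P \<times> L \<union> L \<times> P" and disjoint: "P \<inter> L = {}" and sym: "sym E"
    and nonempty: "P \<union> L \<noteq> {}"
    and valency: "\<And>v. v \<in> P \<union> L \<Longrightarrow> card {w. (v, w) \<in> E} = q + 1"
    and distance_bound: "\<And>u v. u \<in> P \<union> L \<Longrightarrow> v \<in> P \<union> L \<Longrightarrow> \<exists>j\<le>n. (u, v) \<in> E ^^ j"
    and girth: "\<And>xs. is_cycle E xs \<Longrightarrow> length xs \<noteq> 2 \<Longrightarrow> 2 * n \<le> length xs"
    and \<rho>_invol: "\<And>v. v \<in> P \<union> L \<Longrightarrow> \<rho> (\<rho> v) = v"
    and \<rho>_P: "\<rho> ` P = L" and \<rho>_L: "\<rho> ` L = P"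
    and \<rho>_arc: "\<And>u v. (u, v) \<in> E \<Longrightarrow> (\<rho> u, \<rho> v) \<in> E"
begin

text \<open>
  The quotient by \<open>\<rho>\<close>, with each orbit represented by the one point that it contains: a
  point \<open>x\<close> is related to \<open>y\<close> if \<open>x\<close> is incident with the line \<open>\<rho> y\<close>. Loops of the quotient
  are the absolute points, those incident with their own images.
\<close>
definition polar :: "'a rel" where
  "polar = {(x, y). x \<in> P \<and> y \<in> P \<and> (x, \<rho> y) \<in> E}"

lemma arcD: "(u, v) \<in> E \<Longrightarrow> u \<in> P \<union> L \<and> v \<in> P \<union> L \<and> (u \<in> P \<longleftrightarrow> v \<in> L) \<and> (u \<in> L \<longleftrightarrow> v \<in> P)"
  using arcs disjoint by blast

lemma loopless: "(x, x) \<notin> E"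
  using arcD disjoint by blast

lemma arc_sym: "(u, v) \<in> E \<Longrightarrow> (v, u) \<in> E"
  using sym by (auto dest: symD)

lemma \<rho>_in_L: "x \<in> P \<Longrightarrow> \<rho> x \<in> L" and \<rho>_in_P: "x \<in> L \<Longrightarrow> \<rho> x \<in> P"
  using \<rho>_P \<rho>_L by blast+

lemma \<rho>_inj: "u \<in> P \<union> L \<Longrightarrow> v \<in> P \<union> L \<Longrightarrow> \<rho> u = \<rho> v \<Longrightarrow> u = v"
  using \<rho>_invol by metis

lemma \<rho>_relpow: "(u, v) \<in> E ^^ m \<Longrightarrow> (\<rho> u, \<rho> v) \<in> E ^^ m"
proof (induction m arbitrary: v)
  case (Suc m)
  then show ?case using \<rho>_arc by (meson relpow_Suc_E relpow_Suc_I)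
qed simp

lemma path_unique:
  assumes "nonbacktracking E f i" "nonbacktracking E h j" "f 0 = h 0" "f i = h j" "i + j < 2 * n"
  shows "i = j \<and> (\<forall>k\<le>i. f k = h k)"
  by (rule nonbacktracking_unique[OF _ loopless sym assms]) (fact girth)

lemma finite_neighbours: "finite {w. (v, w) \<in> E}"
proof (cases "v \<in> P \<union> L")
  case True
  then show ?thesis using valency[OF True] card.infinite by fastforce
next
  case False
  then have "{w. (v, w) \<in> E} = {}" using arcD by blast
  then show ?thesis by simp
qed

lemma ex_other_neighbour:
  assumes "v \<in> P \<union> L" obtains w where "(v, w) \<in> E" "w \<noteq> x"
proof -
  have "\<not> {w. (v, w) \<in> E} \<subseteq> {x}"
  proof
    assume "{w. (v, w) \<in> E} \<subseteq> {x}"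
    from card_mono[OF _ this] valency[OF assms] q_pos show False by simp
  qed
  then show thesis using that by blast
qed

lemma relpow_parity:
  assumes "(u, v) \<in> E ^^ m" "u \<in> P \<union> L"
  shows "v \<in> P \<union> L \<and> (v \<in> P \<longleftrightarrow> (even m \<longleftrightarrow> u \<in> P))"
  using assms(1)
proof (induction m arbitrary: v)
  case (Suc m)
  then obtain w where "(u, w) \<in> E ^^ m" "(w, v) \<in> E" by auto
  then show ?case using Suc.IH[of w] arcD[of w v] disjoint by auto
qed (use assms in auto)

text \<open>
  The vertices at depth \<open>i\<close> of the tree that grows from \<open>u\<close> away from its neighbour \<open>v\<close>.
\<close>
definition branch :: "'a \<Rightarrow> 'a \<Rightarrow> nat \<Rightarrow> 'a set" where
  "branch v u i = {f i | f. nonbacktracking E f i \<and> f 0 = u \<and> (i > 0 \<longrightarrow> f 1 \<noteq> v)}"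

lemma branchE:
  assumes "x \<in> branch v u i"
  obtains f where "nonbacktracking E f i" "f 0 = u" "f i = x" "i > 0 \<longrightarrow> f 1 \<noteq> v"
  using assms unfolding branch_def by auto

lemma branch_verts: "u \<in> P \<union> L \<Longrightarrow> branch v u i \<subseteq> P \<union> L"
  using nonbacktracking_relpow relpow_parity unfolding branch_def by fastforce

text \<open>
  Below depth \<open>n\<close> the branches really are trees: a vertex that could be reached in two ways
  would violate \<open>path_unique\<close>. Hence every vertex has exactly \<open>q\<close> children, its neighbours
  other than the one it was reached from.
\<close>
lemma card_branch:
  assumes vu: "(v, u) \<in> E" and "i < n"
  shows "finite (branch v u i) \<and> card (branch v u i) = q ^ i"
  using \<open>i < n\<close>
proof (induction i)
  case 0
  have "branch v u 0 = {u}" by (auto simp: branch_def nonbacktracking_def)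
  then show ?case by simp
next
  case (Suc i)
  have u: "u \<in> P \<union> L" using arcD[OF vu] by blast
  define path where "path z = (SOME f. nonbacktracking E f i \<and> f 0 = u \<and> (i > 0 \<longrightarrow> f 1 \<noteq> v) \<and> f i = z)" for z
  have path: "nonbacktracking E (path z) i \<and> path z 0 = u \<and> (i > 0 \<longrightarrow> path z 1 \<noteq> v) \<and> path z i = z"
    if "z \<in> branch v u i" for z
  proof -
    have "\<exists>f. nonbacktracking E f i \<and> f 0 = u \<and> (i > 0 \<longrightarrow> f 1 \<noteq> v) \<and> f i = z"
      using that unfolding branch_def by blast
    then show ?thesis unfolding path_def by (rule someI_ex)
  qed
  (* The predecessor of z; the root u of the branch counts as reached from v. *)
  define prev where "prev z = (if i = 0 then v else path z (i - 1))" for z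
  define N where "N z = {w. (z, w) \<in> E} - {prev z}" for z
  have ext: "nonbacktracking E ((path z)(Suc i := w)) (Suc i)" if "z \<in> branch v u i" "w \<in> N z" for z w
    using path[OF that(1)] that(2) by (intro nonbacktracking_snoc) (auto simp: N_def prev_def)
  have union: "branch v u (Suc i) = (\<Union>z\<in>branch v u i. N z)"
  proof (intro subset_antisym subsetI)
    fix w assume "w \<in> branch v u (Suc i)"
    then obtain f where f: "nonbacktracking E f (Suc i)" "f 0 = u" "f 1 \<noteq> v" "w = f (Suc i)"
      by (auto simp: branch_def)
    then have z: "f i \<in> branch v u i" by (auto simp: branch_def intro!: exI[of _ f] intro: nonbacktracking_le)
    have "\<forall>k\<le>i. path (f i) k = f k"
      using path_unique[of "path (f i)" i f i] path[OF z] nonbacktracking_le[OF f(1), of i] f Suc.prems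
      by auto
    then have "prev (f i) \<noteq> w"
      using f by (cases i) (auto simp: prev_def nonbacktracking_def)
    then have "w \<in> N (f i)" using f by (auto simp: N_def nonbacktracking_def)
    with z show "w \<in> (\<Union>z\<in>branch v u i. N z)" by blast
  next
    fix w assume "w \<in> (\<Union>z\<in>branch v u i. N z)"
    then obtain z where z: "z \<in> branch v u i" "w \<in> N z" by blast
    then have "((path z)(Suc i := w)) 1 \<noteq> v"
      using path[OF z(1)] by (cases i) (auto simp: N_def prev_def)
    then show "w \<in> branch v u (Suc i)"
      unfolding branch_def using ext[OF z] path[OF z(1)]
      by (auto intro!: exI[of _ "(path z)(Suc i := w)"])
  qed
  have card_N: "card (N z) = q" if z: "z \<in> branch v u i" for z
  proof -
    have "(z, prev z) \<in> E"
    proof (cases i)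
      case 0
      then show ?thesis using path[OF z] vu by (auto simp: prev_def dest: arc_sym)
    next
      case (Suc k)
      then have "(path z k, path z i) \<in> E"
        using path[OF z] by (auto simp: nonbacktracking_def)
      then show ?thesis using path[OF z] Suc by (auto simp: prev_def dest: arc_sym)
    qed
    moreover have "z \<in> P \<union> L" using z branch_verts[OF u] by blast
    ultimately show ?thesis using valency[of z] finite_neighbours[of z] by (simp add: N_def)
  qed
  have disj: "N z \<inter> N z' = {}" if z: "z \<in> branch v u i" "z' \<in> branch v u i" "z \<noteq> z'" for z z'
  proof (rule ccontr)
    assume "N z \<inter> N z' \<noteq> {}"
    then obtain w where w: "w \<in> N z" "w \<in> N z'" by blast
    have "\<forall>k\<le>Suc i. ((path z)(Suc i := w)) k = ((path z')(Suc i := w)) k"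
      using path_unique[OF ext[OF z(1) w(1)] ext[OF z(2) w(2)]] path[OF z(1)] path[OF z(2)] Suc.prems
      by auto
    then have "path z i = path z' i" by (auto dest: spec[of _ i])
    then show False using path z by metis
  qed
  have "card (\<Union>z\<in>branch v u i. N z) = (\<Sum>z\<in>branch v u i. card (N z))"
    using Suc disj finite_neighbours by (intro card_UN_disjoint) (auto simp: N_def)
  also have "\<dots> = q ^ Suc i" using card_N Suc by simp
  finally show ?case
    unfolding union using Suc finite_neighbours by (auto simp: N_def)
qed

lemma ex_arc: obtains v u where "(v, u) \<in> E"
  using nonempty ex_other_neighbour by blast

text \<open>
  As the graph is bipartite, the distances of a vertex from the two ends of an edge differ.
  The smaller one is less than \<open>n\<close>, and a geodesic that realizes it does not use the edge.
\<close>
lemma verts_eq_branches: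
  assumes vu: "(v, u) \<in> E"
  shows "P \<union> L = (\<Union>i<n. branch v u i) \<union> (\<Union>i<n. branch u v i)"
proof (intro subset_antisym subsetI)
  fix x assume x: "x \<in> P \<union> L"
  define dist where "dist w = (LEAST j. (w, x) \<in> E ^^ j)" for w
  have dist: "(w, x) \<in> E ^^ dist w" "dist w \<le> n" "\<And>j. (w, x) \<in> E ^^ j \<Longrightarrow> dist w \<le> j"
    if w: "w \<in> P \<union> L" for w
  proof -
    obtain j where j: "j \<le> n" "(w, x) \<in> E ^^ j" using distance_bound[OF w x] by blast
    show "(w, x) \<in> E ^^ dist w" unfolding dist_def using j(2) by (rule LeastI)
    show "\<And>j. (w, x) \<in> E ^^ j \<Longrightarrow> dist w \<le> j" unfolding dist_def by (rule Least_le)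
    then show "dist w \<le> n" using j by fastforce
  qed
  have key: "x \<in> branch a b (dist b) \<and> dist b < n" if ab: "(a, b) \<in> E" "dist b < dist a" for a b
  proof -
    have V: "a \<in> P \<union> L" "b \<in> P \<union> L" using arcD[OF ab(1)] by blast+
    obtain j f where f: "j \<le> dist b" "nonbacktracking E f j" "f 0 = b" "f j = x"
      using relpow_imp_nonbacktracking[OF dist(1)[OF V(2)]] by blast
    have "(b, x) \<in> E ^^ j" using nonbacktracking_relpow[OF f(2)] unfolding f .
    then have "dist b \<le> j" by (rule dist(3)[OF V(2)])
    then have j: "j = dist b" using f(1) by simp
    moreover have "f 1 \<noteq> a" if "j > 0"
    proof
      assume "f 1 = a"
      define k where "k = j - 1"
      then have k: "j = Suc k" using that by simp
      have "(f (Suc 0), f (Suc k)) \<in> E ^^ k"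
        using nonbacktracking_relpow[OF nonbacktracking_shift[OF f(2)[unfolded k]]] .
      then have "(a, x) \<in> E ^^ k" using \<open>f 1 = a\<close> f(4) k by simp
      then have "dist a \<le> k" by (rule dist(3)[OF V(1)])
      then show False using ab(2) k j by simp
    qed
    ultimately have "x \<in> branch a b (dist b)"
      using f unfolding branch_def by (intro CollectI exI[of _ f]) simp
    then show ?thesis using ab(2) dist(2)[OF V(1)] by simp
  qed
  have V: "v \<in> P \<union> L" "u \<in> P \<union> L" using arcD[OF vu] by blast+
  have "dist v \<noteq> dist u"
    using relpow_parity[OF dist(1)[OF V(1)] V(1)] relpow_parity[OF dist(1)[OF V(2)] V(2)] arcD[OF vu]
      disjoint by auto
  then consider "dist u < dist v" | "dist v < dist u" by linarith
  then show "x \<in> (\<Union>i<n. branch v u i) \<union> (\<Union>i<n. branch u v i)"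
    using key[OF vu] key[OF arc_sym[OF vu]] by cases blast+
next
  fix x assume "x \<in> (\<Union>i<n. branch v u i) \<union> (\<Union>i<n. branch u v i)"
  then show "x \<in> P \<union> L" using branch_verts arcD[OF vu] by blast
qed

lemma branch_disjoint:
  assumes "i < n" "j < n" "i \<noteq> j"
  shows "branch v u i \<inter> branch v u j = {}"
proof (rule ccontr)
  assume "branch v u i \<inter> branch v u j \<noteq> {}"
  then obtain x where x: "x \<in> branch v u i" "x \<in> branch v u j" by blast
  obtain f where "nonbacktracking E f i" "f 0 = u" "f i = x" by (rule branchE[OF x(1)])
  moreover obtain h where "nonbacktracking E h j" "h 0 = u" "h j = x" by (rule branchE[OF x(2)])
  ultimately show False using path_unique[of f i h j] assms by auto
qed

lemma opposite_branch_disjoint: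
  assumes vu: "(v, u) \<in> E" and "i < n" "j < n"
  shows "branch v u i \<inter> branch u v j = {}"
proof (rule ccontr)
  assume "branch v u i \<inter> branch u v j \<noteq> {}"
  then obtain x where x: "x \<in> branch v u i" "x \<in> branch u v j" by blast
  obtain f where f: "nonbacktracking E f i" "f 0 = u" "f i = x" "i > 0 \<longrightarrow> f 1 \<noteq> v"
    by (rule branchE[OF x(1)])
  obtain h where h: "nonbacktracking E h j" "h 0 = v" "h j = x" "j > 0 \<longrightarrow> h 1 \<noteq> u"
    by (rule branchE[OF x(2)])
  note fh = f h
  have "nonbacktracking E (case_nat v f) (Suc i)"
    using fh vu by (intro nonbacktracking_Cons) auto
  then have eq: "Suc i = j \<and> (\<forall>k\<le>Suc i. case_nat v f k = h k)"
    using fh assms by (intro path_unique) auto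
  then have "case_nat v f (Suc 0) = h (Suc 0)" by (metis Suc_le_mono le0)
  then show False using eq fh by auto
qed

lemma card_verts: "finite (P \<union> L) \<and> card (P \<union> L) = 2 * (\<Sum>i<n. q ^ i)"
proof -
  obtain v u where vu: "(v, u) \<in> E" by (rule ex_arc)
  note uv = arc_sym[OF vu]
  have one: "finite (\<Union>i<n. branch a b i) \<and> card (\<Union>i<n. branch a b i) = (\<Sum>i<n. q ^ i)"
    if "(a, b) \<in> E" for a b
  proof
    show "finite (\<Union>i<n. branch a b i)" using card_branch[OF that] by auto
    have "card (\<Union>i<n. branch a b i) = (\<Sum>i<n. card (branch a b i))"
      using card_branch[OF that] branch_disjoint by (intro card_UN_disjoint) auto
    then show "card (\<Union>i<n. branch a b i) = (\<Sum>i<n. q ^ i)" using card_branch[OF that] by simp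
  qed
  have "(\<Union>i<n. branch v u i) \<inter> (\<Union>i<n. branch u v i) = {}"
    using opposite_branch_disjoint[OF vu] by blast
  then show ?thesis
    unfolding verts_eq_branches[OF vu] using one[OF vu] one[OF uv] by (simp add: card_Un_disjoint)
qed

lemma finite_P: "finite P" and finite_L: "finite L"
  using card_verts by auto

lemma card_P: "card P = (\<Sum>i<n. q ^ i)"
proof -
  have "inj_on \<rho> P" using \<rho>_inj by (intro inj_onI) blast
  then have "card L = card P" using \<rho>_P card_image by metis
  then show ?thesis using card_verts card_Un_disjoint[OF finite_P finite_L disjoint] by simp
qed

lemma polar_verts: "polar \<subseteq> P \<times> P"
  by (auto simp: polar_def)

lemma polar_sym: "(x, y) \<in> polar \<Longrightarrow> (y, x) \<in> polar"
  using \<rho>_arc[of x "\<rho> y"] \<rho>_invol arc_sym by (auto simp: polar_def)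

lemma polar_valency:
  assumes "x \<in> P"
  shows "card {y. (x, y) \<in> polar} = q + 1"
proof -
  have "{w. (x, w) \<in> E} = \<rho> ` {y. (x, y) \<in> polar}"
  proof (intro subset_antisym subsetI)
    fix w assume "w \<in> {w. (x, w) \<in> E}"
    then have "w \<in> L" "(x, w) \<in> E" using assms arcD by auto
    then have "\<rho> w \<in> {y. (x, y) \<in> polar}" "w = \<rho> (\<rho> w)"
      using assms \<rho>_in_P \<rho>_invol by (auto simp: polar_def)
    then show "w \<in> \<rho> ` {y. (x, y) \<in> polar}" by blast
  qed (auto simp: polar_def)
  moreover have "inj_on \<rho> {y. (x, y) \<in> polar}"
    using \<rho>_inj by (intro inj_onI) (auto simp: polar_def)
  ultimately show ?thesis using valency[of x] assms card_image by fastforce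
qed

text \<open>
  A walk in the quotient lifts to a walk in the polygon that starts at \<open>x\<close>. Every step of
  the lift changes sides, so that it ends at the point \<open>y\<close> after an even number of steps and
  at the line \<open>\<rho> y\<close> after an odd number.
\<close>
lemma polar_relpow:
  assumes "x \<in> P"
  shows "(x, y) \<in> polar ^^ m \<longleftrightarrow> y \<in> P \<and> (x, if even m then y else \<rho> y) \<in> E ^^ m"
proof (induction m arbitrary: y)
  case 0
  then show ?case using assms by auto
next
  case (Suc m)
  have x: "x \<in> P \<union> L" using assms by blast
  show ?case
  proof
    assume "(x, y) \<in> polar ^^ Suc m"
    then obtain z where z: "(x, z) \<in> polar ^^ m" "(z, y) \<in> polar" by auto
    then have zy: "z \<in> P" "y \<in> P" "(z, \<rho> y) \<in> E" by (auto simp: polar_def)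
    have "(\<rho> z, y) \<in> E" using \<rho>_arc[OF zy(3)] \<rho>_invol zy by auto
    then show "y \<in> P \<and> (x, if even (Suc m) then y else \<rho> y) \<in> E ^^ Suc m"
      using z(1) zy unfolding Suc.IH by (auto split: if_splits)
  next
    assume R: "y \<in> P \<and> (x, if even (Suc m) then y else \<rho> y) \<in> E ^^ Suc m"
    then obtain w where w: "(x, w) \<in> E ^^ m" "(w, if even (Suc m) then y else \<rho> y) \<in> E"
      by (meson relpow_Suc_E)
    have parity: "w \<in> P \<union> L \<and> (w \<in> P \<longleftrightarrow> even m)"
      using relpow_parity[OF w(1) x] assms by auto
    show "(x, y) \<in> polar ^^ Suc m"
    proof (cases "even m")
      case True
      then have "(x, w) \<in> polar ^^ m" "(w, y) \<in> polar"
        using w R parity unfolding Suc.IH by (auto simp: polar_def)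
      then show ?thesis by auto
    next
      case False
      then have "\<rho> w \<in> P" "\<rho> (\<rho> w) = w" "(\<rho> w, \<rho> y) \<in> E"
        using w parity \<rho>_in_P \<rho>_invol \<rho>_arc by auto
      then have "(x, \<rho> w) \<in> polar ^^ m" "(\<rho> w, y) \<in> polar"
        using w R False unfolding Suc.IH by (auto simp: polar_def)
      then show ?thesis by auto
    qed
  qed
qed

lemma relpow_add_2:
  assumes "(u, v) \<in> E ^^ m" "v \<in> P \<union> L"
  shows "(u, v) \<in> E ^^ (m + 2 * k)"
proof (induction k)
  case (Suc k)
  obtain w where w: "(v, w) \<in> E" using ex_other_neighbour[OF assms(2)] by blast
  have "(u, v) \<in> E ^^ Suc (Suc (m + 2 * k))"
    using relpow_Suc_I[OF relpow_Suc_I[OF Suc.IH w] arc_sym[OF w]] .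
  then show ?case by simp
qed (use assms in simp)

text \<open>
  Of \<open>y\<close> and \<open>\<rho> y\<close>, one is separated from \<open>x\<close> by a distance of the parity of \<open>n - 1\<close>. That
  distance is at most \<open>n\<close>, hence at most \<open>n - 1\<close>, and a walk can be lengthened by going back
  and forth along an edge.
\<close>
lemma polar_relpow_all:
  assumes xy: "x \<in> P" "y \<in> P"
  shows "(x, y) \<in> polar ^^ (n - 1)"
proof -
  define t where "t = (if even (n - 1) then y else \<rho> y)"
  have t: "t \<in> P \<union> L" "t \<in> P \<longleftrightarrow> even (n - 1)"
    using xy \<rho>_in_L disjoint by (auto simp: t_def)
  obtain j where j: "j \<le> n" "(x, t) \<in> E ^^ j" using distance_bound[of x t] xy t by blast
  have parity: "even j \<longleftrightarrow> even (n - 1)"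
    using relpow_parity[OF j(2)] xy t by auto
  then have "j \<noteq> n" using n_ge_3 by auto
  then have "j \<le> n - 1" using j by simp
  then have "even (n - 1 - j)" using parity by (simp only: even_diff_nat) auto
  then obtain k where "n - 1 - j = 2 * k" by (rule evenE)
  then have "j + 2 * k = n - 1" using \<open>j \<le> n - 1\<close> by simp
  then have "(x, t) \<in> E ^^ (n - 1)"
    using relpow_add_2[OF j(2) t(1), of k] by simp
  then show ?thesis using polar_relpow[OF xy(1)] xy by (simp add: t_def)
qed

text \<open>
  The distance \<open>j\<close> of a point \<open>x\<close> from the line \<open>\<rho> x\<close> is odd, so it is less than \<open>n\<close> if \<open>n\<close>
  is even and the geodesic between the two is unique. The polarity maps it to a geodesic
  with the same ends, that is, reverses it, and therefore swaps the two ends of its middle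
  edge.
\<close>
lemma ex_absolute:
  assumes "even n"
  obtains x where "x \<in> P" "(x, \<rho> x) \<in> E"
proof -
  obtain v u where "(v, u) \<in> E" by (rule ex_arc)
  then obtain x where x: "x \<in> P" using arcD by blast
  have V: "x \<in> P \<union> L" "\<rho> x \<in> P \<union> L" using x \<rho>_in_L by auto
  obtain m where "m \<le> n" "(x, \<rho> x) \<in> E ^^ m" using distance_bound[OF V] by blast
  then obtain j f where f: "j \<le> n" "nonbacktracking E f j" "f 0 = x" "f j = \<rho> x"
    using relpow_imp_nonbacktracking by (metis order.trans)
  have "odd j"
    using relpow_parity[OF nonbacktracking_relpow[OF f(2)]] f x \<rho>_in_L[OF x] disjoint by auto
  then have "j < n" using f(1) assms by (metis le_neq_implies_less)
  (* The middle edge joins f a and f (a + 1). *)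
  obtain a where a: "j = 2 * a + 1" using \<open>odd j\<close> by (rule oddE)
  have f_verts: "f k \<in> P \<union> L" if "k \<le> j" for k
    using relpow_parity[OF nonbacktracking_relpow[OF nonbacktracking_le[OF f(2) that]]] f x by auto
  define h where "h k = \<rho> (f (j - k))" for k
  have "nonbacktracking E h j"
    unfolding nonbacktracking_def
  proof (intro conjI allI impI)
    fix k assume k: "k < j"
    then have "(f (j - Suc k), f (Suc (j - Suc k))) \<in> E" using f by (auto simp: nonbacktracking_def)
    moreover have "Suc (j - Suc k) = j - k" using k by simp
    ultimately show "(h k, h (Suc k)) \<in> E" unfolding h_def by (simp add: \<rho>_arc arc_sym)
  next
    fix k assume k: "Suc (Suc k) \<le> j"
    define l where "l = j - Suc (Suc k)"
    have l: "j - k = Suc (Suc l)" "Suc (Suc l) \<le> j" using k by (auto simp: l_def)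
    then have "f l \<noteq> f (Suc (Suc l))" using f by (auto simp: nonbacktracking_def)
    then show "h k \<noteq> h (Suc (Suc k))"
      unfolding h_def using \<rho>_inj[OF f_verts[of l] f_verts[of "Suc (Suc l)"]] l by (auto simp: l_def)
  qed
  moreover have "f 0 = h 0" "f j = h j" using f(3,4) \<rho>_invol[OF V(1)] by (simp_all add: h_def)
  ultimately have "\<forall>k\<le>j. f k = h k"
    using path_unique[OF f(2), of h j] \<open>j < n\<close> by simp
  then have "f a = h a" using a by simp
  then have "f a = \<rho> (f (Suc a))" using a by (simp add: h_def)
  then have eq: "\<rho> (f a) = f (Suc a)" using \<rho>_invol[OF f_verts[of "Suc a"]] a by simp
  have arc: "(f a, \<rho> (f a)) \<in> E" using f a unfolding eq by (auto simp: nonbacktracking_def)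
  show thesis
  proof (cases "f a \<in> P")
    case True
    then show ?thesis using that arc by blast
  next
    case False
    then have "f a \<in> L" using f_verts[of a] a by auto
    then have "\<rho> (f a) \<in> P" "\<rho> (\<rho> (f a)) = f a" using \<rho>_in_P \<rho>_invol by auto
    then show ?thesis using that[of "\<rho> (f a)"] arc_sym[OF arc] by simp
  qed
qed

lemma ex_nonbacktracking:
  assumes "x \<in> P \<union> L"
  shows "\<exists>f. nonbacktracking E f m \<and> f 0 = x"
proof (induction m)
  case 0
  then show ?case by (auto simp: nonbacktracking_def)
next
  case (Suc m)
  then obtain f where f: "nonbacktracking E f m" "f 0 = x" by blast
  then have "f m \<in> P \<union> L" using relpow_parity[OF nonbacktracking_relpow[OF f(1)]] assms by auto
  then obtain w where "(f m, w) \<in> E" "w \<noteq> f (m - 1)" using ex_other_neighbour by blast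
  then have "nonbacktracking E (f(Suc m := w)) (Suc m) \<and> (f(Suc m := w)) 0 = x"
    using f by (auto intro: nonbacktracking_snoc)
  then show ?case by blast
qed

text \<open>
  Take an absolute point \<open>x\<close> and a point \<open>y\<close> at distance \<open>n\<close> from it. As \<open>x\<close> and \<open>\<rho> x\<close> are
  adjacent, \<open>\<rho> x\<close> has distance at least \<open>n - 1\<close> from \<open>y\<close>; equivalently, \<open>x\<close> has distance at
  least \<open>n - 1\<close> from \<open>\<rho> y\<close>.
\<close>
lemma polar_far:
  assumes "even n"
  obtains x y where "x \<in> P" "y \<in> P" "\<And>m. m < n - 1 \<Longrightarrow> (x, y) \<notin> polar ^^ m"
proof -
  obtain x where x: "x \<in> P" "(x, \<rho> x) \<in> E" using ex_absolute[OF assms] by blast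
  obtain f where f: "nonbacktracking E f n" "f 0 = x" using ex_nonbacktracking[of x n] x by blast
  have y: "f n \<in> P" using relpow_parity[OF nonbacktracking_relpow[OF f(1)]] f x assms by auto
  have far: "(x, f n) \<notin> E ^^ m" if "m < n" for m
  proof
    assume "(x, f n) \<in> E ^^ m"
    then obtain j h where "j \<le> m" "nonbacktracking E h j" "h 0 = x" "h j = f n"
      by (rule relpow_imp_nonbacktracking)
    then show False using path_unique[OF f(1), of h j] f \<open>m < n\<close> by auto
  qed
  have "(x, f n) \<notin> polar ^^ m" if "m < n - 1" for m
  proof
    assume "(x, f n) \<in> polar ^^ m"
    then have walk: "(x, if even m then f n else \<rho> (f n)) \<in> E ^^ m" unfolding polar_relpow[OF x(1)] by blast
    show False
    proof (cases "even m")
      case True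
      then show ?thesis using walk far[of m] that by simp
    next
      case False
      then have "(\<rho> x, f n) \<in> E ^^ m"
        using \<rho>_relpow[OF walk] \<rho>_invol y by simp
      then have "(x, f n) \<in> E ^^ Suc m" using x(2) by (rule relpow_Suc_I2[rotated])
      then show ?thesis using far[of "Suc m"] that by (simp del: relpow.simps)
    qed
  qed
  then show thesis using that[OF x(1) y] by blast
qed

text \<open>
  If all points were absolute, then for any edge \<open>{x, w}\<close> with \<open>w \<noteq> \<rho> x\<close> the vertices
  \<open>x, w, \<rho> w, \<rho> x\<close> would form a quadrilateral.
\<close>
lemma polar_non_loop: "\<exists>x\<in>P. (x, x) \<notin> polar"
proof (rule ccontr)
  assume "\<not> ?thesis"
  then have abs: "(x, \<rho> x) \<in> E" if "x \<in> P" for x using that by (auto simp: polar_def)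
  obtain v u where "(v, u) \<in> E" by (rule ex_arc)
  then obtain x where x: "x \<in> P" using arcD by blast
  then obtain w where w: "(x, w) \<in> E" "w \<noteq> \<rho> x" using ex_other_neighbour[of x "\<rho> x"] by blast
  then have "w \<in> L" using arcD x disjoint by blast
  then have rw: "\<rho> w \<in> P" "\<rho> (\<rho> w) = w" using \<rho>_in_P \<rho>_invol by auto
  define c where "c = [x, w, \<rho> w, \<rho> x]"
  have e: "(w, \<rho> w) \<in> E" "(\<rho> w, \<rho> x) \<in> E" "(\<rho> x, x) \<in> E"
    using abs[OF rw(1)] rw \<rho>_arc[OF w(1)] abs[OF x] arc_sym by auto
  have P_neq_L: "a \<noteq> b" if "a \<in> P" "b \<in> L" for a b using that disjoint by blast
  have "x \<noteq> \<rho> w"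
  proof
    assume "x = \<rho> w"
    then show False using w(2) rw(2) by simp
  qed
  moreover have "x \<noteq> w" "x \<noteq> \<rho> x" "w \<noteq> \<rho> w" "\<rho> w \<noteq> \<rho> x"
    using P_neq_L[OF x \<open>w \<in> L\<close>] P_neq_L[OF x \<rho>_in_L[OF x]] P_neq_L[OF rw(1) \<open>w \<in> L\<close>]
      P_neq_L[OF rw(1) \<rho>_in_L[OF x]] by simp_all
  ultimately have "distinct c"
    using w(2) by (simp add: c_def)
  then have "is_cycle E c"
    using w(1) e by (simp add: is_cycle_def c_def less_Suc_eq all_simps(6) imp_disjL all_conj_distrib)
  then show False using girth[of c] n_ge_3 by (simp add: c_def)
qed

end

section \<open>Quotients and Kronecker products\<close>

text \<open>
  Every orbit meets \<open>A\<close> in exactly one vertex, and an arc of the quotient comes from an arc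
  that starts in \<open>A\<close>, because \<open>\<rho>\<close> moves an arc that starts in \<open>B\<close> to such an arc between the
  same orbits.
\<close>
lemma bipartite_polarity_quotient:
  assumes V: "pverts G = A \<union> B" and E: "parcs G \<subseteq> A \<times> B \<union> B \<times> A"
    and inv: "\<And>v. v \<in> A \<union> B \<Longrightarrow> \<rho> (\<rho> v) = v" and AB: "\<rho> ` A = B"
    and arc: "\<And>u v. (u, v) \<in> parcs G \<Longrightarrow> (\<rho> u, \<rho> v) \<in> parcs G"
  shows "polarity_quotient G \<rho> = relabel (\<lambda>v. {v, \<rho> v})
     \<lparr>pverts = A, parcs = {(x, y). x \<in> A \<and> y \<in> A \<and> (x, \<rho> y) \<in> parcs G}\<rparr>"
proof -
  let ?o = "\<lambda>v. {v, \<rho> v}"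
  have o_\<rho>: "?o (\<rho> v) = ?o v" if "v \<in> A \<union> B" for v using inv[OF that] by auto
  have "?o ` (A \<union> B) = ?o ` A"
    using o_\<rho> AB by (auto simp: image_iff)
  moreover have "(\<lambda>(v, w). (?o v, ?o w)) ` parcs G =
      map_prod ?o ?o ` {(x, y). x \<in> A \<and> y \<in> A \<and> (x, \<rho> y) \<in> parcs G}" (is "?L = ?R")
  proof (intro subset_antisym subsetI)
    fix e assume "e \<in> ?L"
    then obtain v w where vw: "(v, w) \<in> parcs G" "e = (?o v, ?o w)" by auto
    consider "v \<in> A" "w \<in> B" | "v \<in> B" "w \<in> A" using vw E by auto
    then show "e \<in> ?R"
    proof cases
      case 1
      then have "\<rho> w \<in> A" using AB inv by auto
      then have "(v, \<rho> w) \<in> {(x, y). x \<in> A \<and> y \<in> A \<and> (x, \<rho> y) \<in> parcs G}"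
        using vw inv[of w] 1 by auto
      moreover have "e = map_prod ?o ?o (v, \<rho> w)" using vw o_\<rho>[of w] 1 by simp
      ultimately show ?thesis by blast
    next
      case 2
      then have "\<rho> v \<in> A" using AB inv by auto
      then have "(\<rho> v, w) \<in> {(x, y). x \<in> A \<and> y \<in> A \<and> (x, \<rho> y) \<in> parcs G}"
        using vw arc 2 by auto
      moreover have "e = map_prod ?o ?o (\<rho> v, w)" using vw o_\<rho>[of v] 2 by simp
      ultimately show ?thesis by blast
    qed
  next
    fix e assume "e \<in> ?R"
    then obtain x y where xy: "x \<in> A" "y \<in> A" "(x, \<rho> y) \<in> parcs G" "e = (?o x, ?o y)" by auto
    then have "e = (?o x, ?o (\<rho> y))" using o_\<rho>[of y] by simp
    then show "e \<in> ?L" using xy(3) by force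
  qed
  ultimately show ?thesis
    by (simp add: polarity_quotient_def relabel_def V)
qed

lemma inj_on_orbit:
  assumes "A \<inter> B = {}" "\<rho> ` A = B"
  shows "inj_on (\<lambda>v. {v, \<rho> v}) A"
proof (rule inj_onI)
  fix u v assume uv: "u \<in> A" "v \<in> A" "{u, \<rho> u} = {v, \<rho> v}"
  then have "u \<noteq> \<rho> v" using assms by auto
  then show "u = v" using uv(3) by auto
qed

lemma kronecker_relabel:
  "relabel f G \<otimes>\<^sub>K relabel g H = relabel (map_prod f g) (G \<otimes>\<^sub>K H)"
proof -
  let ?R = "\<lambda>E F. {((h1, k1), (h2, k2)) | h1 k1 h2 k2. (h1, h2) \<in> E \<and> (k1, k2) \<in> F}"
  have "?R (map_prod f f ` parcs G) (map_prod g g ` parcs H) =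
     map_prod (map_prod f g) (map_prod f g) ` ?R (parcs G) (parcs H)" (is "?A = ?B")
  proof (intro subset_antisym subsetI)
    fix e assume "e \<in> ?A"
    then obtain a b c d where "(a, b) \<in> parcs G" "(c, d) \<in> parcs H" "e = ((f a, g c), (f b, g d))"
      by auto
    then show "e \<in> ?B" by (intro image_eqI[of _ _ "((a, c), (b, d))"]) auto
  qed auto
  moreover have "f ` pverts G \<times> g ` pverts H = map_prod f g ` (pverts G \<times> pverts H)" by force
  ultimately show ?thesis by (simp add: kronecker_def relabel_def)
qed

lemma wf_kronecker: "pair_wf_digraph G \<Longrightarrow> pair_wf_digraph H \<Longrightarrow> pair_wf_digraph (G \<otimes>\<^sub>K H)"
  by (auto simp: pair_wf_digraph_iff kronecker_def)

lemma kronecker_arc_iff: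
  "((h1, k1), (h2, k2)) \<in> parcs (G \<otimes>\<^sub>K H) \<longleftrightarrow> (h1, h2) \<in> parcs G \<and> (k1, k2) \<in> parcs H"
  by (simp add: kronecker_def)

lemma kronecker_relpow_iff:
  "((h1, k1), (h2, k2)) \<in> parcs (G \<otimes>\<^sub>K H) ^^ m \<longleftrightarrow>
     (h1, h2) \<in> parcs G ^^ m \<and> (k1, k2) \<in> parcs H ^^ m"
proof (induction m arbitrary: h2 k2)
  case (Suc m)
  have "((h1, k1), (h2, k2)) \<in> parcs (G \<otimes>\<^sub>K H) ^^ Suc m \<longleftrightarrow>
     (\<exists>h k. ((h1, k1), (h, k)) \<in> parcs (G \<otimes>\<^sub>K H) ^^ m \<and> ((h, k), (h2, k2)) \<in> parcs (G \<otimes>\<^sub>K H))"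
    by auto
  also have "\<dots> \<longleftrightarrow> (h1, h2) \<in> parcs G ^^ Suc m \<and> (k1, k2) \<in> parcs H ^^ Suc m"
    unfolding Suc.IH kronecker_arc_iff by auto
  finally show ?case .
qed auto

lemma delete_loops_relpow:
  "(u, v) \<in> parcs G ^^ m \<Longrightarrow> \<exists>j\<le>m. (u, v) \<in> parcs (delete_loops G) ^^ j"
proof (induction m arbitrary: v)
  case (Suc m)
  then obtain w where w: "(u, w) \<in> parcs G ^^ m" "(w, v) \<in> parcs G" by auto
  then obtain j where j: "j \<le> m" "(u, w) \<in> parcs (delete_loops G) ^^ j" using Suc.IH by blast
  show ?case
  proof (cases "w = v")
    case True
    then show ?thesis using j by (intro exI[of _ j]) simp
  next
    case False
    then have "(w, v) \<in> parcs (delete_loops G)" using w by (simp add: delete_loops_def)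
    then show ?thesis using j by (intro exI[of _ "Suc j"]) auto
  qed
qed auto

lemma relpow_delete_loops_subset: "parcs (delete_loops G) ^^ m \<subseteq> parcs G ^^ m"
  by (induction m) (auto simp: delete_loops_def)

lemma pair_graph_delete_loops:
  assumes wf: "pair_wf_digraph G" and "finite (pverts G)" "sym (parcs G)"
  shows "pair_graph (delete_loops G)"
proof -
  have sub: "parcs (delete_loops G) \<subseteq> pverts G \<times> pverts G"
    using wf_delete_loops[OF wf] by (simp add: pair_wf_digraph_iff delete_loops_def)
  have "sym (parcs (delete_loops G))" using assms(3) by (auto simp: sym_def delete_loops_def)
  then have "symmetric (with_proj (delete_loops G))" by (simp add: symmetric_def)
  then show ?thesis
    using sub assms(2) finite_subset[OF sub]
    by unfold_locales (auto simp: delete_loops_def)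
qed

section \<open>The members of the family\<close>

locale polarity_graph_pair =
  H: polygon_with_polarity P L E n q \<rho> + K: polygon_with_polarity P' L' E' n r \<rho>'
  for P L :: "'a set" and E n q \<rho> and P' L' :: "'b set" and E' r \<rho>'
begin

text \<open>
  The common model, up to relabelling, of the quotient of \<open>H \<odot> K\<close> and of the product of the
  quotients.
\<close>
definition prod_graph :: "('a \<times> 'b) pair_pre_digraph" where
  "prod_graph = \<lparr>pverts = P, parcs = H.polar\<rparr> \<otimes>\<^sub>K \<lparr>pverts = P', parcs = K.polar\<rparr>"

lemma wf_factors: "pair_wf_digraph \<lparr>pverts = P, parcs = H.polar\<rparr>"
  "pair_wf_digraph \<lparr>pverts = P', parcs = K.polar\<rparr>"
  using H.polar_verts K.polar_verts by (auto simp: pair_wf_digraph_iff)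

lemma wf_prod: "pair_wf_digraph prod_graph"
  unfolding prod_graph_def by (intro wf_kronecker wf_factors)

lemma pverts_prod: "pverts prod_graph = P \<times> P'"
  by (simp add: prod_graph_def kronecker_def)

lemma finite_prod: "finite (pverts prod_graph)"
  using H.finite_P K.finite_P by (simp add: pverts_prod)

lemma sym_prod: "sym (parcs prod_graph)"
  using H.polar_sym K.polar_sym by (auto simp: sym_def prod_graph_def kronecker_def)

lemma arc_prod: "((x, x'), (y, y')) \<in> parcs prod_graph \<longleftrightarrow> (x, y) \<in> H.polar \<and> (x', y') \<in> K.polar"
  by (simp add: prod_graph_def kronecker_arc_iff)

lemma relpow_prod:
  "((x, x'), (y, y')) \<in> parcs prod_graph ^^ m \<longleftrightarrow> (x, y) \<in> H.polar ^^ m \<and> (x', y') \<in> K.polar ^^ m"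
  by (simp add: prod_graph_def kronecker_relpow_iff)

lemma order_prod: "graph_order (delete_loops prod_graph) = (\<Sum>i<n. q ^ i) * (\<Sum>i<n. r ^ i)"
  by (simp add: graph_order_def delete_loops_def pverts_prod card_cartesian_product H.card_P K.card_P)

lemma neighbours_prod:
  "{w. ((x, x'), w) \<in> parcs (delete_loops prod_graph)} =
     {y. (x, y) \<in> H.polar} \<times> {y'. (x', y') \<in> K.polar} - {(x, x')}"
  by (auto simp: delete_loops_def arc_prod)

lemma card_neighbours_with_loop:
  assumes "x \<in> P" "x' \<in> P'"
  shows "card ({y. (x, y) \<in> H.polar} \<times> {y'. (x', y') \<in> K.polar}) = (q + 1) * (r + 1)"
  using H.polar_valency K.polar_valency assms by (simp add: card_cartesian_product)

lemma finite_neighbours_prod: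
  assumes "x \<in> P" "x' \<in> P'"
  shows "finite ({y. (x, y) \<in> H.polar} \<times> {y'. (x', y') \<in> K.polar})"
  using card_neighbours_with_loop[OF assms] by (intro card_ge_0_finite) simp

text \<open>
  Deleting loops reduces the degree only at pairs of absolute points, and by
  \<open>polar_non_loop\<close> not all points of the first factor are absolute.
\<close>
lemma degree_prod: "graph_degree (delete_loops prod_graph) = (q + 1) * (r + 1)"
proof -
  have le: "card {w. (v, w) \<in> parcs (delete_loops prod_graph)} \<le> (q + 1) * (r + 1)"
    if vP: "v \<in> P \<times> P'" for v
  proof -
    obtain x x' where v: "v = (x, x')" "x \<in> P" "x' \<in> P'" using vP by auto
    show ?thesis
      unfolding v(1) neighbours_prod card_neighbours_with_loop[OF v(2,3), symmetric]
      by (rule card_mono[OF finite_neighbours_prod[OF v(2,3)]]) blast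
  qed
  obtain x where x: "x \<in> P" "(x, x) \<notin> H.polar" using H.polar_non_loop by blast
  obtain x' where x': "x' \<in> P'" using K.polar_non_loop by blast
  have eq: "card {w. ((x, x'), w) \<in> parcs (delete_loops prod_graph)} = (q + 1) * (r + 1)"
    unfolding neighbours_prod card_neighbours_with_loop[OF x(1) x', symmetric]
    using x(2) by (intro arg_cong[of _ _ card]) blast
  have vs: "pverts (delete_loops prod_graph) = P \<times> P'" by (simp add: delete_loops_def pverts_prod)
  show ?thesis
    unfolding graph_degree_def out_degree_with_proj vs
  proof (rule Max_eqI)
    show "finite ((\<lambda>v. card {w. (v, w) \<in> parcs (delete_loops prod_graph)}) ` (P \<times> P'))"
      using H.finite_P K.finite_P by blast
    show "\<And>y. y \<in> (\<lambda>v. card {w. (v, w) \<in> parcs (delete_loops prod_graph)}) ` (P \<times> P') \<Longrightarrow>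
       y \<le> (q + 1) * (r + 1)" using le by blast
    show "(q + 1) * (r + 1) \<in> (\<lambda>v. card {w. (v, w) \<in> parcs (delete_loops prod_graph)}) ` (P \<times> P')"
      using eq x(1) x' by (intro image_eqI[of _ _ "(x, x')"]) auto
  qed
qed

text \<open>
  For \<open>n = 3\<close> it is enough that the graph is not complete, which follows by counting: it has
  \<open>(1 + q + q\<^sup>2) (1 + r + r\<^sup>2)\<close> vertices, more than the \<open>(q + 1) (r + 1) + 1\<close> that a
  complete graph of this degree has. The intermediate bound \<open>(q + 2) (r + 2)\<close> separates the
  two.
\<close>
lemma prod_far_3:
  assumes "n = 3"
  obtains u v where "u \<in> P \<times> P'" "v \<in> P \<times> P'" "u \<noteq> v" "(u, v) \<notin> parcs prod_graph"
proof -
  obtain x where x: "x \<in> P" using H.polar_non_loop by blast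
  obtain x' where x': "x' \<in> P'" using K.polar_non_loop by blast
  let ?N = "{y. (x, y) \<in> H.polar} \<times> {y'. (x', y') \<in> K.polar}"
  have "card (insert (x, x') ?N) \<le> (q + 1) * (r + 1) + 1"
    by (simp only: card_insert_if[OF finite_neighbours_prod[OF x x']] card_neighbours_with_loop[OF x x'])
      simp
  also have "\<dots> < (q + 2) * (r + 2)" by (simp add: algebra_simps)
  also have "\<dots> \<le> (1 + q + q\<^sup>2) * (1 + r + r\<^sup>2)"
    using H.q_pos K.q_pos by (intro mult_le_mono) (auto simp: power2_eq_square)
  also have "\<dots> = card (P \<times> P')"
    by (simp add: card_cartesian_product H.card_P K.card_P assms numeral_3_eq_3 power2_eq_square)
  finally have "\<not> P \<times> P' \<subseteq> insert (x, x') ?N"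
    using card_mono[of "insert (x, x') ?N" "P \<times> P'"] finite_neighbours_prod[OF x x'] by auto
  then obtain y y' where "y \<in> P" "y' \<in> P'" "(y, y') \<noteq> (x, x')" "(y, y') \<notin> ?N" by blast
  then show thesis using that[of "(x, x')" "(y, y')"] x x' by (auto simp: arc_prod)
qed

text \<open>
  For even \<open>n\<close> two vertices are already far apart if their first components are, as a walk
  in the product projects to a walk of the same length.
\<close>
lemma prod_far:
  assumes "n \<in> {3, 4, 6}"
  shows "\<exists>u\<in>P \<times> P'. \<exists>v\<in>P \<times> P'. \<forall>m<n - 1. (u, v) \<notin> parcs (delete_loops prod_graph) ^^ m"
proof (cases "n = 3")
  case True
  obtain u v where uv: "u \<in> P \<times> P'" "v \<in> P \<times> P'" "u \<noteq> v" "(u, v) \<notin> parcs prod_graph"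
    by (rule prod_far_3[OF True])
  have "(u, v) \<notin> parcs (delete_loops prod_graph) ^^ m" if m: "m < n - 1" for m
  proof -
    consider "m = 0" | "m = 1" using m True by linarith
    then show ?thesis using uv by cases (auto simp: delete_loops_def)
  qed
  then show ?thesis using uv by blast
next
  case False
  then have "even n" using assms by auto
  then obtain x y where xy: "x \<in> P" "y \<in> P" "\<And>m. m < n - 1 \<Longrightarrow> (x, y) \<notin> H.polar ^^ m"
    by (rule H.polar_far) blast
  obtain x' where x': "x' \<in> P'" using K.polar_non_loop by blast
  have "((x, x'), (y, x')) \<notin> parcs (delete_loops prod_graph) ^^ m" if "m < n - 1" for m
    using relpow_delete_loops_subset[where G = prod_graph and m = m] xy(3)[OF that] relpow_prod by blast
  then show ?thesis using xy x' by (intro bexI[of _ "(x, x')"] bexI[of _ "(y, x')"]) auto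
qed

lemma diameter_prod:
  assumes "n \<in> {3, 4, 6}"
  shows "graph_diameter (delete_loops prod_graph) = ereal (real (n - 1))"
proof -
  have vs: "pverts (delete_loops prod_graph) = P \<times> P'" by (simp add: delete_loops_def pverts_prod)
  have n: "n - 1 > 0" using H.n_ge_3 by simp
  have "\<exists>j\<le>n - 1. (u, v) \<in> parcs (delete_loops prod_graph) ^^ j" if "u \<in> P \<times> P'" "v \<in> P \<times> P'" for u v
  proof -
    have "(u, v) \<in> parcs prod_graph ^^ (n - 1)"
      using that H.polar_relpow_all K.polar_relpow_all by (cases u; cases v) (auto simp: relpow_prod)
    then show ?thesis by (rule delete_loops_relpow)
  qed
  then show ?thesis
    unfolding graph_diameter_eq_iff[OF wf_delete_loops[OF wf_prod] n] vs
    using prod_far[OF assms] by blast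
qed

end

lemma polarized_polygon_imp_polygon_with_polarity:
  assumes n: "n \<ge> 3" and "q > 0" and pp: "polarized_polygon n q \<Gamma> \<rho>"
  shows "polygon_with_polarity (point_verts \<Gamma>) (line_verts \<Gamma>) (parcs (incidence_graph \<Gamma>)) n q \<rho>"
proof -
  let ?G = "incidence_graph \<Gamma>"
  have gp: "generalized_polygon n \<Gamma>" and ord: "has_order \<Gamma> q q"
    and pol: "polarity ?G (point_verts \<Gamma>) (line_verts \<Gamma>) \<rho>"
    using pp by (auto simp: polarized_polygon_def)
  have inc: "incid \<Gamma> \<subseteq> points \<Gamma> \<times> lines \<Gamma>"
    and diam: "graph_diameter ?G = ereal (real n)" and girth: "graph_girth ?G = enat (2 * n)"
    using gp by (auto simp: generalized_polygon_def)
  have V: "pverts ?G = point_verts \<Gamma> \<union> line_verts \<Gamma>" by (simp add: incidence_graph_def)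
  have arcs: "parcs ?G \<subseteq> point_verts \<Gamma> \<times> line_verts \<Gamma> \<union> line_verts \<Gamma> \<times> point_verts \<Gamma>"
    using inc by (auto simp: incidence_graph_def point_verts_def line_verts_def)
  then have wf: "pair_wf_digraph ?G" by (auto simp: pair_wf_digraph_iff V)
  have n0: "n > 0" "2 * n \<noteq> 2" using n by auto
  note diam' = diam[unfolded graph_diameter_eq_iff[OF wf n0(1)]]
  note girth' = girth[unfolded graph_girth_eq_iff[OF wf n0(2)]]
  show ?thesis
  proof
    show "3 \<le> n" "q > 0" by fact+
    show "parcs ?G \<subseteq> point_verts \<Gamma> \<times> line_verts \<Gamma> \<union> line_verts \<Gamma> \<times> point_verts \<Gamma>" by fact
    show "point_verts \<Gamma> \<inter> line_verts \<Gamma> = {}" by (auto simp: point_verts_def line_verts_def)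
    show "sym (parcs ?G)" by (auto simp: sym_def incidence_graph_def)
    show "point_verts \<Gamma> \<union> line_verts \<Gamma> \<noteq> {}" using diam' V by auto
    show "\<exists>j\<le>n. (u, v) \<in> parcs ?G ^^ j"
      if "u \<in> point_verts \<Gamma> \<union> line_verts \<Gamma>" "v \<in> point_verts \<Gamma> \<union> line_verts \<Gamma>" for u v
      using that diam' unfolding V by blast
    show "2 * n \<le> length xs" if "is_cycle (parcs ?G) xs" "length xs \<noteq> 2" for xs
      using that girth' by blast
    show "card {w. (v, w) \<in> parcs ?G} = q + 1" if v: "v \<in> point_verts \<Gamma> \<union> line_verts \<Gamma>" for v
    proof (cases v)
      case (Inl p)
      then have "{w. (v, w) \<in> parcs ?G} = Inr ` {l \<in> lines \<Gamma>. (p, l) \<in> incid \<Gamma>}"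
        using inc by (auto simp: incidence_graph_def)
      moreover have "p \<in> points \<Gamma>" using v Inl by (auto simp: point_verts_def line_verts_def)
      ultimately show ?thesis using ord by (simp add: card_image has_order_def)
    next
      case (Inr l)
      then have "{w. (v, w) \<in> parcs ?G} = Inl ` {p \<in> points \<Gamma>. (p, l) \<in> incid \<Gamma>}"
        using inc by (auto simp: incidence_graph_def)
      moreover have "l \<in> lines \<Gamma>" using v Inr by (auto simp: point_verts_def line_verts_def)
      ultimately show ?thesis using ord by (simp add: card_image has_order_def)
    qed
    show "\<rho> (\<rho> v) = v" if "v \<in> point_verts \<Gamma> \<union> line_verts \<Gamma>" for v
      using pol that unfolding polarity_def V by blast
    show "\<rho> ` point_verts \<Gamma> = line_verts \<Gamma>" "\<rho> ` line_verts \<Gamma> = point_verts \<Gamma>"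
      using pol by (auto simp: polarity_def)
    show "(\<rho> u, \<rho> v) \<in> parcs ?G" if "(u, v) \<in> parcs ?G" for u v
    proof -
      have "u \<in> pverts ?G" "v \<in> pverts ?G" using wf that by (auto simp: pair_wf_digraph_iff)
      then show ?thesis using pol that unfolding polarity_def graph_automorphism_def by blast
    qed
  qed
qed

text \<open>
  Induction on \<open>m\<close> with \<open>1 + a + \<dots> + a\<^sup>m\<^sup>+\<^sup>1 = 1 + a (1 + a + \<dots> + a\<^sup>m)\<close>. Both the number of
  points of the second polygon and the Moore bound are such sums, with \<open>a r = r\<close> and with
  \<open>a r = (q + 1) (r + 1) - 1\<close>.
\<close>
lemma geometric_sum_asymptotics:
  fixes a :: "nat \<Rightarrow> real"
  assumes "((\<lambda>r. a r / real r) \<longlongrightarrow> c) sequentially"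
  shows "((\<lambda>r. (\<Sum>i<Suc m. a r ^ i) / real r ^ m) \<longlongrightarrow> c ^ m) sequentially"
proof (induction m)
  case (Suc m)
  have "((\<lambda>r. (1 / real r) ^ Suc m + a r / real r * ((\<Sum>i<Suc m. a r ^ i) / real r ^ m))
      \<longlongrightarrow> 0 ^ Suc m + c * c ^ m) sequentially"
    by (intro tendsto_intros lim_1_over_n assms Suc.IH)
  moreover have "(1 / real r) ^ Suc m + a r / real r * ((\<Sum>i<Suc m. a r ^ i) / real r ^ m) =
      (\<Sum>i<Suc (Suc m). a r ^ i) / real r ^ Suc m" for r
  proof -
    have "(\<Sum>i<Suc (Suc m). a r ^ i) = 1 + a r * (\<Sum>i<Suc m. a r ^ i)"
      unfolding sum.lessThan_Suc_shift[of _ "Suc m"] by (simp add: sum_distrib_left del: sum.lessThan_Suc)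
    then show ?thesis by (simp add: power_one_over add_divide_distrib del: sum.lessThan_Suc)
  qed
  ultimately show ?case by simp
qed simp

lemma moore_ratio_tendsto:
  assumes "n \<ge> 2"
  shows "((\<lambda>r. real ((\<Sum>i<n. q ^ i) * (\<Sum>i<n. r ^ i)) / moore_bound ((q + 1) * (r + 1)) (n - 1))
     \<longlongrightarrow> (\<Sum>i<n. real q ^ i) / (real q + 1) ^ (n - 1)) sequentially"
proof -
  define S where "S = (\<Sum>i<n. real q ^ i)"
  define c where "c = real q + 1"
  obtain m where m: "n = Suc (Suc m)" using assms by (metis add_2_eq_Suc le_Suc_ex)
  define MB where "MB r = 1 + c * (real r + 1) * (\<Sum>i<Suc m. (c * (real r + 1) - 1) ^ i)" for r
  have linear: "((\<lambda>r. (b * real r + d) / real r) \<longlongrightarrow> b) sequentially" for b d :: real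
  proof -
    have "((\<lambda>r. b + d * (1 / real r)) \<longlongrightarrow> b + d * 0) sequentially"
      by (intro tendsto_intros lim_1_over_n)
    moreover have "\<forall>\<^sub>F r in sequentially. b + d * (1 / real r) = (b * real r + d) / real r"
      using eventually_gt_at_top[of "0 :: nat"] by eventually_elim (simp add: add_divide_distrib)
    ultimately have "((\<lambda>r. (b * real r + d) / real r) \<longlongrightarrow> b + d * 0) sequentially"
      by (rule Lim_transform_eventually)
    then show ?thesis by simp
  qed
  have lin1: "((\<lambda>r. real r / real r) \<longlongrightarrow> 1) sequentially"
    and lin2: "((\<lambda>r. c * (real r + 1) / real r) \<longlongrightarrow> c) sequentially"
    and lin3: "((\<lambda>r. (c * (real r + 1) - 1) / real r) \<longlongrightarrow> c) sequentially"
    using linear[of 1 0] linear[of c c] linear[of c "c - 1"] by (simp_all add: algebra_simps)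
  have num: "((\<lambda>r. (\<Sum>i<n. real r ^ i) / real r ^ Suc m) \<longlongrightarrow> 1) sequentially"
    using geometric_sum_asymptotics[OF lin1, of "Suc m"] m by simp
  have "((\<lambda>r. (1 / real r) ^ Suc m + c * (real r + 1) / real r *
        ((\<Sum>i<Suc m. (c * (real r + 1) - 1) ^ i) / real r ^ m)) \<longlongrightarrow> 0 ^ Suc m + c * c ^ m) sequentially"
    by (intro tendsto_intros lim_1_over_n lin2 geometric_sum_asymptotics lin3)
  then have den: "((\<lambda>r. MB r / real r ^ Suc m) \<longlongrightarrow> c ^ Suc m) sequentially"
    by (simp add: MB_def power_one_over add_divide_distrib mult.assoc del: sum.lessThan_Suc)
  have "c ^ Suc m \<noteq> 0" by (simp add: c_def)
  from tendsto_mult[OF tendsto_const[of S] tendsto_divide[OF num den this]]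
  have "((\<lambda>r. S * (((\<Sum>i<n. real r ^ i) / real r ^ Suc m) / (MB r / real r ^ Suc m)))
      \<longlongrightarrow> S / c ^ Suc m) sequentially" by simp
  moreover have "\<forall>\<^sub>F r in sequentially.
      S * (((\<Sum>i<n. real r ^ i) / real r ^ Suc m) / (MB r / real r ^ Suc m)) =
      S * (\<Sum>i<n. real r ^ i) / MB r"
    using eventually_gt_at_top[of "0 :: nat"] by eventually_elim simp
  ultimately have "((\<lambda>r. S * (\<Sum>i<n. real r ^ i) / MB r) \<longlongrightarrow> S / c ^ Suc m) sequentially"
    by (rule Lim_transform_eventually)
  moreover have "moore_bound ((q + 1) * (r + 1)) (n - 1) = MB r" for r
    by (simp add: moore_bound_def MB_def c_def m algebra_simps)
  ultimately show ?thesis by (simp add: S_def c_def m del: sum.lessThan_Suc)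
qed

lemma sym_relabel:
  assumes "sym (parcs G)"
  shows "sym (parcs (relabel f G))"
proof (rule symI)
  fix a b assume "(a, b) \<in> parcs (relabel f G)"
  then obtain x y where "(x, y) \<in> parcs G" "a = f x" "b = f y" by auto
  then show "(b, a) \<in> parcs (relabel f G)"
    using symD[OF assms] by (auto intro!: rev_image_eqI[of "(y, x)"])
qed

text \<open>
  Both quotients are relabelled to \<open>prod_graph\<close>: the quotient of the composed graph by
  choosing in each orbit the pair of points, the product of the quotients by choosing the
  point in each component.
\<close>
lemma composed_quotient_properties:
  fixes \<Gamma> :: "('p, 'l) geometry" and \<Gamma>' :: "('c, 'd) geometry"
  assumes n: "n \<in> {3, 4, 6}" and q: "q > 0" and pp: "polarized_polygon n q \<Gamma> \<rho>"
    and r: "r > 0" and pp': "polarized_polygon n r \<Gamma>' \<rho>'"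
  shows "graph_isomorphic
          (delete_loops (composed_quotient \<Gamma> \<rho> \<Gamma>' \<rho>'))
          (delete_loops (polarity_quotient (incidence_graph \<Gamma>) \<rho> \<otimes>\<^sub>K
                         polarity_quotient (incidence_graph \<Gamma>') \<rho>'))" (is ?iso)
    and "pair_graph (delete_loops (composed_quotient \<Gamma> \<rho> \<Gamma>' \<rho>'))" (is ?graph)
    and "graph_degree (delete_loops (composed_quotient \<Gamma> \<rho> \<Gamma>' \<rho>')) = (q + 1) * (r + 1)" (is ?deg)
    and "graph_diameter (delete_loops (composed_quotient \<Gamma> \<rho> \<Gamma>' \<rho>')) = ereal (real (n - 1))" (is ?diam)
    and "graph_order (delete_loops (composed_quotient \<Gamma> \<rho> \<Gamma>' \<rho>')) =
           (\<Sum>i<n. q ^ i) * (\<Sum>i<n. r ^ i)" (is ?ord)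
proof -
  let ?G = "incidence_graph \<Gamma>" and ?G' = "incidence_graph \<Gamma>'"
  let ?P = "point_verts \<Gamma>" and ?L = "line_verts \<Gamma>"
  let ?P' = "point_verts \<Gamma>'" and ?L' = "line_verts \<Gamma>'"
  have n3: "3 \<le> n" using n by auto
  interpret H: polygon_with_polarity ?P ?L "parcs ?G" n q \<rho>
    by (rule polarized_polygon_imp_polygon_with_polarity[OF n3 q pp])
  interpret K: polygon_with_polarity ?P' ?L' "parcs ?G'" n r \<rho>'
    by (rule polarized_polygon_imp_polygon_with_polarity[OF n3 r pp'])
  interpret polarity_graph_pair ?P ?L "parcs ?G" n q \<rho> ?P' ?L' "parcs ?G'" r \<rho>' ..
  have V: "pverts ?G = ?P \<union> ?L" "pverts ?G' = ?P' \<union> ?L'" by (simp_all add: incidence_graph_def)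
  let ?o = "\<lambda>v. {v, \<rho> v}" and ?o' = "\<lambda>v. {v, \<rho>' v}"
  let ?pi = "\<lambda>(h, k). (\<rho> h, \<rho>' k)"
  let ?oo = "\<lambda>v. {v, ?pi v}"
  let ?O = "odot ?G ?P ?L ?G' ?P' ?L'"
  have inj: "inj_on ?o ?P" "inj_on ?o' ?P'"
    by (rule inj_on_orbit[OF H.disjoint H.\<rho>_P]) (rule inj_on_orbit[OF K.disjoint K.\<rho>_P])
  have pi: "?pi ` (?P \<times> ?P') = ?L \<times> ?L'"
    using map_prod_surj_on[OF H.\<rho>_P K.\<rho>_P] by (simp add: map_prod_def)
  have injoo: "inj_on ?oo (?P \<times> ?P')"
    using H.disjoint by (intro inj_on_orbit[OF _ pi]) blast
  have quot: "polarity_quotient ?G \<rho> = relabel ?o \<lparr>pverts = ?P, parcs = H.polar\<rparr>"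
    unfolding H.polar_def using V H.arcs H.\<rho>_invol H.\<rho>_P H.\<rho>_arc by (intro bipartite_polarity_quotient) auto
  have quot': "polarity_quotient ?G' \<rho>' = relabel ?o' \<lparr>pverts = ?P', parcs = K.polar\<rparr>"
    unfolding K.polar_def using V K.arcs K.\<rho>_invol K.\<rho>_P K.\<rho>_arc by (intro bipartite_polarity_quotient) auto
  have kron: "polarity_quotient ?G \<rho> \<otimes>\<^sub>K polarity_quotient ?G' \<rho>' = relabel (map_prod ?o ?o') prod_graph"
    unfolding quot quot' kronecker_relabel prod_graph_def ..
  have arc_O: "((h, k), (h', k')) \<in> parcs ?O \<longleftrightarrow> (h, h') \<in> parcs ?G \<and> (k, k') \<in> parcs ?G' \<and>
      (h, k) \<in> ?P \<times> ?P' \<union> ?L \<times> ?L' \<and> (h', k') \<in> ?P \<times> ?P' \<union> ?L \<times> ?L'" for h k h' k'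
    by (simp add: odot_def Let_def kronecker_arc_iff)
  have "composed_quotient \<Gamma> \<rho> \<Gamma>' \<rho>' = relabel ?oo \<lparr>pverts = ?P \<times> ?P',
      parcs = {(x, y). x \<in> ?P \<times> ?P' \<and> y \<in> ?P \<times> ?P' \<and> (x, ?pi y) \<in> parcs ?O}\<rparr>"
    unfolding composed_quotient_def
  proof (rule bipartite_polarity_quotient[where B = "?L \<times> ?L'"])
    show "pverts ?O = ?P \<times> ?P' \<union> ?L \<times> ?L'" by (simp add: odot_def Let_def)
    show "parcs ?O \<subseteq> (?P \<times> ?P') \<times> ?L \<times> ?L' \<union> (?L \<times> ?L') \<times> ?P \<times> ?P'"
    proof
      fix e assume e: "e \<in> parcs ?O"
      obtain h k h' k' where [simp]: "e = ((h, k), (h', k'))" by (metis prod.collapse)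
      show "e \<in> (?P \<times> ?P') \<times> ?L \<times> ?L' \<union> (?L \<times> ?L') \<times> ?P \<times> ?P'"
        using e H.arcD[of h h'] K.arcD[of k k'] H.disjoint K.disjoint by (auto simp: arc_O)
    qed
    show "?pi (?pi v) = v" if "v \<in> ?P \<times> ?P' \<union> ?L \<times> ?L'" for v
      using that H.\<rho>_invol K.\<rho>_invol by auto
    show "?pi ` (?P \<times> ?P') = ?L \<times> ?L'" by (rule pi)
    show "(?pi u, ?pi v) \<in> parcs ?O" if "(u, v) \<in> parcs ?O" for u v
    proof -
      obtain h k h' k' where [simp]: "u = (h, k)" "v = (h', k')" by (metis prod.collapse)
      show ?thesis
        using that H.\<rho>_arc[of h h'] K.\<rho>_arc[of k k'] H.\<rho>_in_L H.\<rho>_in_P K.\<rho>_in_L K.\<rho>_in_P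
        by (auto simp: arc_O)
    qed
  qed
  also have "\<lparr>pverts = ?P \<times> ?P',
      parcs = {(x, y). x \<in> ?P \<times> ?P' \<and> y \<in> ?P \<times> ?P' \<and> (x, ?pi y) \<in> parcs ?O}\<rparr> = prod_graph"
  proof -
    have "{(x, y). x \<in> ?P \<times> ?P' \<and> y \<in> ?P \<times> ?P' \<and> (x, ?pi y) \<in> parcs ?O} = parcs prod_graph"
    proof (intro subset_antisym subsetI)
      fix e assume e: "e \<in> {(x, y). x \<in> ?P \<times> ?P' \<and> y \<in> ?P \<times> ?P' \<and> (x, ?pi y) \<in> parcs ?O}"
      obtain h k h' k' where [simp]: "e = ((h, k), (h', k'))" by (metis prod.collapse)
      show "e \<in> parcs prod_graph"
        using e by (simp add: arc_O arc_prod H.polar_def K.polar_def)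
    next
      fix e assume e: "e \<in> parcs prod_graph"
      obtain h k h' k' where [simp]: "e = ((h, k), (h', k'))" by (metis prod.collapse)
      show "e \<in> {(x, y). x \<in> ?P \<times> ?P' \<and> y \<in> ?P \<times> ?P' \<and> (x, ?pi y) \<in> parcs ?O}"
        using e H.\<rho>_in_L K.\<rho>_in_L by (simp add: arc_O arc_prod H.polar_def K.polar_def)
    qed
    then show ?thesis using pverts_prod by simp
  qed
  finally have comp: "composed_quotient \<Gamma> \<rho> \<Gamma>' \<rho>' = relabel ?oo prod_graph" .
  have inj_oo: "inj_on ?oo (pverts prod_graph)" using injoo by (simp only: pverts_prod)
  have inj_mp: "inj_on (map_prod ?o ?o') (pverts prod_graph)"
    using map_prod_inj_on[OF inj] by (simp only: pverts_prod)
  have vs: "pverts (delete_loops prod_graph) = pverts prod_graph" by (simp add: delete_loops_def)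
  have del: "delete_loops (composed_quotient \<Gamma> \<rho> \<Gamma>' \<rho>') = relabel ?oo (delete_loops prod_graph)"
    unfolding comp by (rule delete_loops_relabel[OF wf_prod inj_oo])
  note wfd = wf_delete_loops[OF wf_prod]
  note inj_d = inj_oo[folded vs]
  show ?iso
    unfolding del kron delete_loops_relabel[OF wf_prod inj_mp]
    by (rule graph_isomorphic_relabel_relabel[OF wfd inj_d inj_mp[folded vs]])
  have "sym (parcs (relabel ?oo prod_graph))"
    using sym_prod by (rule sym_relabel)
  then show ?graph
    unfolding comp using finite_prod by (intro pair_graph_delete_loops wf_relabel wf_prod) simp_all
  show ?deg unfolding del graph_degree_relabel[OF wfd inj_d] by (rule degree_prod)
  have "n - 1 > 0" using n3 by simp
  then show ?diam unfolding del by (simp only: graph_diameter_relabel[OF wfd inj_d] diameter_prod[OF n])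
  show ?ord unfolding del graph_order_relabel[OF inj_d] by (rule order_prod)
qed

section \<open>From graphs to geometries on the natural numbers\<close>

text \<open>
  A finite bipartite graph with the right parameters is numbered injectively and read as a
  geometry. A rotation polarity is excluded by valencies: the vertices of the cycle \<open>C\<^sub>2\<^sub>n\<close>
  have only two neighbours, while here every vertex has \<open>q + 1 \<ge> 3\<close>.
\<close>
lemma admissibleI:
  fixes P L :: "'v set" and E :: "'v rel"
  assumes fin: "finite (P \<union> L)" and disj: "P \<inter> L = {}"
    and arcs: "E \<subseteq> P \<times> L \<union> L \<times> P" and sym: "sym E"
    and diam: "graph_diameter \<lparr>pverts = P \<union> L, parcs = E\<rparr> = ereal (real n)"
    and girth: "graph_girth \<lparr>pverts = P \<union> L, parcs = E\<rparr> = enat (2 * n)"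
    and valency: "\<And>v. v \<in> P \<union> L \<Longrightarrow> card {w. (v, w) \<in> E} = q + 1"
    and inv: "\<And>v. v \<in> P \<union> L \<Longrightarrow> \<rho> (\<rho> v) = v"
    and PL: "\<rho> ` P = L" and LP: "\<rho> ` L = P"
    and arc: "\<And>u v. (u, v) \<in> E \<Longrightarrow> (\<rho> u, \<rho> v) \<in> E"
    and n: "n \<ge> 2" and q: "q \<ge> 2"
  shows "admissible n q"
proof -
  let ?G = "\<lparr>pverts = P \<union> L, parcs = E\<rparr>"
  obtain f :: "'v \<Rightarrow> nat" where f: "inj_on f (P \<union> L)"
    using finite_imp_inj_to_nat_seg[OF fin] by blast
  define \<Gamma> :: "(nat, nat) geometry" where
    "\<Gamma> = \<lparr>points = f ` P, lines = f ` L, incid = map_prod f f ` (E \<inter> P \<times> L)\<rparr>"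
  define emb where "emb v = (if v \<in> P then Inl (f v) else Inr (f v))" for v
  have embP: "emb v = Inl (f v)" if "v \<in> P" for v using that by (simp add: emb_def)
  have embL: "emb v = Inr (f v)" if "v \<in> L" for v using that disj by (auto simp: emb_def)
  have inj: "inj_on emb (P \<union> L)"
  proof (rule inj_onI)
    fix u v assume "u \<in> P \<union> L" "v \<in> P \<union> L" "emb u = emb v"
    then show "u = v" using inj_onD[OF f, of u v] by (auto simp: emb_def split: if_splits)
  qed
  have pv: "point_verts \<Gamma> = emb ` P" and lv: "line_verts \<Gamma> = emb ` L"
    using embP embL by (auto simp: point_verts_def line_verts_def \<Gamma>_def image_image cong: image_cong)
  have V: "pverts (incidence_graph \<Gamma>) = emb ` (P \<union> L)"
    by (simp add: incidence_graph_def pv lv image_Un)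
  have wf: "pair_wf_digraph ?G" using arcs by (auto simp: pair_wf_digraph_iff)
  have E_split: "E = (E \<inter> P \<times> L) \<union> (E \<inter> P \<times> L)\<inverse>"
    using arcs sym by (auto dest: symD)
  have "parcs (incidence_graph \<Gamma>) = map_prod emb emb ` (E \<inter> P \<times> L) \<union> map_prod emb emb ` (E \<inter> P \<times> L)\<inverse>"
  proof -
    have "(\<lambda>(p, l). (Inl p, Inr l)) ` incid \<Gamma> = map_prod emb emb ` (E \<inter> P \<times> L)"
      unfolding \<Gamma>_def by (auto simp: image_image embP embL intro!: image_cong)
    moreover have "(\<lambda>(p, l). (Inr l, Inl p)) ` incid \<Gamma> = map_prod emb emb ` (E \<inter> P \<times> L)\<inverse>"
    proof -
      have "(E \<inter> P \<times> L)\<inverse> = prod.swap ` (E \<inter> P \<times> L)" by auto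
      then show ?thesis
        unfolding \<Gamma>_def by (auto simp: image_image embP embL intro!: image_cong)
    qed
    ultimately show ?thesis by (simp add: incidence_graph_def)
  qed
  also have "\<dots> = map_prod emb emb ` E"
    using E_split by (metis image_Un)
  finally have inc: "incidence_graph \<Gamma> = relabel emb ?G"
    using V by (simp add: relabel_def)
  have inj': "inj_on emb (pverts ?G)" using inj by simp
  have wf': "pair_wf_digraph (incidence_graph \<Gamma>)" unfolding inc by (rule wf_relabel[OF wf])
  have n': "n > 0" "2 * n \<noteq> 2" using n by auto
  have arc_iff: "(emb u, emb v) \<in> parcs (incidence_graph \<Gamma>) \<longleftrightarrow> (u, v) \<in> E"
    if "u \<in> P \<union> L" "v \<in> P \<union> L" for u v
    unfolding inc using relabel_arc_iff[OF wf inj'] that by simp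
  have "generalized_polygon n \<Gamma>"
    unfolding generalized_polygon_def inc graph_diameter_relabel[OF wf inj' n'(1)]
      graph_girth_relabel[OF wf inj' n'(2)]
    using diam girth by (auto simp: \<Gamma>_def)
  moreover have "has_order \<Gamma> q q"
  proof -
    have incid: "(f p, f l) \<in> incid \<Gamma> \<longleftrightarrow> (p, l) \<in> E" if pl: "p \<in> P" "l \<in> L" for p l
    proof
      assume "(f p, f l) \<in> incid \<Gamma>"
      then obtain p' l' where "(p', l') \<in> E" "p' \<in> P" "l' \<in> L" "f p' = f p" "f l' = f l"
        by (auto simp: \<Gamma>_def)
      then show "(p, l) \<in> E" using pl inj_onD[OF f, of p' p] inj_onD[OF f, of l' l] by simp
    qed (use pl in \<open>auto simp: \<Gamma>_def\<close>)
    have card: "card (f ` {w. (v, w) \<in> E}) = q + 1" if "v \<in> P \<union> L" for v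
    proof -
      have "inj_on f {w. (v, w) \<in> E}" using arcs by (intro inj_on_subset[OF f]) auto
      then show ?thesis using valency[OF that] by (simp add: card_image)
    qed
    have "card {x \<in> f ` P. (x, f l) \<in> incid \<Gamma>} = q + 1" if l: "l \<in> L" for l
    proof -
      have "{x \<in> f ` P. (x, f l) \<in> incid \<Gamma>} = f ` {w \<in> P. (f w, f l) \<in> incid \<Gamma>}" by auto
      also have "{w \<in> P. (f w, f l) \<in> incid \<Gamma>} = {w \<in> P. (w, l) \<in> E}" using l incid by blast
      also have "\<dots> = {w. (l, w) \<in> E}" using l arcs disj symD[OF sym] by blast
      finally show ?thesis using card l by simp
    qed
    moreover have "card {x \<in> f ` L. (f p, x) \<in> incid \<Gamma>} = q + 1" if p: "p \<in> P" for p
    proof -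
      have "{x \<in> f ` L. (f p, x) \<in> incid \<Gamma>} = f ` {w \<in> L. (f p, f w) \<in> incid \<Gamma>}" by auto
      also have "{w \<in> L. (f p, f w) \<in> incid \<Gamma>} = {w \<in> L. (p, w) \<in> E}" using p incid by blast
      also have "\<dots> = {w. (p, w) \<in> E}" using p arcs disj by blast
      finally show ?thesis using card p by simp
    qed
    ultimately show ?thesis by (auto simp: has_order_def \<Gamma>_def)
  qed
  moreover define \<rho>' where "\<rho>' = emb \<circ> \<rho> \<circ> the_inv_into (P \<union> L) emb"
  have \<rho>': "\<rho>' (emb v) = emb (\<rho> v)" if "v \<in> P \<union> L" for v
    using the_inv_into_f_f[OF inj that] by (simp add: \<rho>'_def)
  have \<rho>_in: "\<rho> v \<in> P \<union> L" if "v \<in> P \<union> L" for v using that PL LP by blast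
  have "polarity (incidence_graph \<Gamma>) (point_verts \<Gamma>) (line_verts \<Gamma>) \<rho>'"
    unfolding polarity_def graph_automorphism_def V pv lv
  proof (intro conjI)
    have inv': "\<rho>' (\<rho>' v) = v" if "v \<in> emb ` (P \<union> L)" for v
      using that \<rho>' \<rho>_in inv by auto
    then show "\<forall>v\<in>emb ` (P \<union> L). \<rho>' (\<rho>' v) = v" by blast
    have "\<rho>' v \<in> emb ` (P \<union> L)" if "v \<in> emb ` (P \<union> L)" for v using that \<rho>' \<rho>_in by auto
    then show "bij_betw \<rho>' (emb ` (P \<union> L)) (emb ` (P \<union> L))"
      using inv' by (intro bij_betw_byWitness[where f' = \<rho>']) auto
    have "(\<rho> u, \<rho> v) \<in> E \<longleftrightarrow> (u, v) \<in> E" if "u \<in> P \<union> L" "v \<in> P \<union> L" for u v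
      using arc[of u v] arc[of "\<rho> u" "\<rho> v"] inv that by auto
    then show "\<forall>u\<in>emb ` (P \<union> L). \<forall>v\<in>emb ` (P \<union> L).
        ((\<rho>' u, \<rho>' v) \<in> parcs (incidence_graph \<Gamma>)) = ((u, v) \<in> parcs (incidence_graph \<Gamma>))"
      using \<rho>' \<rho>_in arc_iff by auto
    have "\<rho>' ` emb ` P = emb ` \<rho> ` P" "\<rho>' ` emb ` L = emb ` \<rho> ` L"
      unfolding image_image using \<rho>' by (auto intro!: image_cong)
    then show "\<rho>' ` emb ` P = emb ` L" "\<rho>' ` emb ` L = emb ` P" using PL LP by simp_all
  qed
  moreover have "\<not> rotation_polarity n \<Gamma> \<rho>'"
  proof
    assume "rotation_polarity n \<Gamma> \<rho>'"
    then obtain \<phi> where \<phi>: "bij_betw \<phi> {..<2 * n} (pverts (incidence_graph \<Gamma>))"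
      "\<And>i j. i < 2 * n \<Longrightarrow> j < 2 * n \<Longrightarrow> (\<phi> i, \<phi> j) \<in> parcs (incidence_graph \<Gamma>) \<longleftrightarrow>
           j = (i + 1) mod (2 * n) \<or> i = (j + 1) mod (2 * n)"
      unfolding rotation_polarity_def by blast
    have "\<phi> 0 \<in> emb ` (P \<union> L)" using \<phi>(1) n V by (auto simp: bij_betw_def)
    then obtain v where v: "v \<in> P \<union> L" "\<phi> 0 = emb v" by blast
    have "emb ` {w. (v, w) \<in> E} \<subseteq> {\<phi> 1, \<phi> (2 * n - 1)}"
    proof
      fix x assume "x \<in> emb ` {w. (v, w) \<in> E}"
      then obtain w where w: "(v, w) \<in> E" "x = emb w" by blast
      then have "w \<in> P \<union> L" using arcs by auto
      then have x: "(\<phi> 0, x) \<in> parcs (incidence_graph \<Gamma>)" using arc_iff[OF v(1)] w v by simp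
      have "x \<in> \<phi> ` {..<2 * n}" using \<open>w \<in> P \<union> L\<close> w \<phi>(1) V by (auto simp: bij_betw_def)
      then obtain j where j: "j < 2 * n" "x = \<phi> j" by blast
      then have "j = 1 mod (2 * n) \<or> 0 = (j + 1) mod (2 * n)" using \<phi>(2)[of 0 j] x n by auto
      moreover have "j = 2 * n - 1" if "0 = (j + 1) mod (2 * n)"
      proof (rule ccontr)
        assume "j \<noteq> 2 * n - 1"
        then have "j + 1 < 2 * n" using j by simp
        then show False using that by simp
      qed
      ultimately show "x \<in> {\<phi> 1, \<phi> (2 * n - 1)}" using j n by auto
    qed
    then have "card (emb ` {w. (v, w) \<in> E}) \<le> card {\<phi> 1, \<phi> (2 * n - 1)}" by (intro card_mono) auto
    also have "\<dots> \<le> 2" by (simp add: card_insert_if)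
    finally have "card (emb ` {w. (v, w) \<in> E}) \<le> 2" .
    moreover have "inj_on emb {w. (v, w) \<in> E}" using arcs by (intro inj_on_subset[OF inj]) auto
    ultimately show False using valency[OF v(1)] q by (simp add: card_image)
  qed
  ultimately have "polarized_polygon n q \<Gamma> \<rho>'" by (simp add: polarized_polygon_def)
  then show ?thesis using q unfolding admissible_def by (intro conjI exI[of _ \<Gamma>] exI[of _ \<rho>']) auto
qed

section \<open>Polygons in coordinates\<close>

text \<open>
  A vertex consists of the tree that it belongs to and the path that leads to it from the
  root.
\<close>
type_synonym 'k vert = "bool \<times> 'k list"

text \<open>
  Two trees of height \<open>n - 1\<close> with joined roots; the relation \<open>R\<close> joins the leaves of the
  first tree to those of the second. In the geometry that arises, the leaves are the affine
  points and lines, and the inner vertices are the elements at infinity.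
\<close>
locale coordinate_graph =
  fixes n :: nat and F :: "'k set" and R :: "'k list \<Rightarrow> 'k list \<Rightarrow> bool"
  assumes n_ge_2: "n \<ge> 2" and finite_F: "finite F" and F_ne: "F \<noteq> {}"
begin

definition V :: "'k vert set" where
  "V = {(s, xs). set xs \<subseteq> F \<and> length xs < n}"

text \<open>
  Each edge once, directed from the \<open>False\<close> tree to the \<open>True\<close> tree or away from the root.
\<close>
definition E0 :: "'k vert rel" where
  "E0 = insert ((False, []), (True, []))
     ({((s, xs), (s, xs @ [x])) | s xs x. set xs \<subseteq> F \<and> x \<in> F \<and> Suc (length xs) < n} \<union>
      {((False, xs), (True, ys)) | xs ys. set xs \<subseteq> F \<and> set ys \<subseteq> F \<and>
          length xs = n - 1 \<and> length ys = n - 1 \<and> R xs ys})"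

definition E :: "'k vert rel" where "E = E0 \<union> E0\<inverse>"

abbreviation G :: "'k vert pair_pre_digraph" where "G \<equiv> \<lparr>pverts = V, parcs = E\<rparr>"

text \<open>
  Finiteness makes an injective map that preserves arcs an automorphism in the usual sense
  (\<open>automorphism_relabel\<close>); the weaker requirement is easier to verify in coordinates.
\<close>
definition automorphism :: "('k vert \<Rightarrow> 'k vert) \<Rightarrow> bool" where
  "automorphism g \<longleftrightarrow> g ` V \<subseteq> V \<and> inj_on g V \<and> (\<forall>u v. (u, v) \<in> E \<longrightarrow> (g u, g v) \<in> E)"

lemma E0_cases:
  assumes "(u, v) \<in> E0"
  obtains (root) "u = (False, [])" "v = (True, [])"
  | (tree) s xs x where "u = (s, xs)" "v = (s, xs @ [x])" "set xs \<subseteq> F" "x \<in> F" "Suc (length xs) < n"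
  | (affine) xs ys where "u = (False, xs)" "v = (True, ys)" "set xs \<subseteq> F" "set ys \<subseteq> F"
      "length xs = n - 1" "length ys = n - 1" "R xs ys"
  using assms unfolding E0_def by blast

lemma root_arc: "((False, []), (True, [])) \<in> E"
  and tree_arc: "set xs \<subseteq> F \<Longrightarrow> x \<in> F \<Longrightarrow> Suc (length xs) < n \<Longrightarrow> ((s, xs), (s, xs @ [x])) \<in> E"
  and affine_arc: "set xs \<subseteq> F \<Longrightarrow> set ys \<subseteq> F \<Longrightarrow> length xs = n - 1 \<Longrightarrow> length ys = n - 1 \<Longrightarrow>
     R xs ys \<Longrightarrow> ((False, xs), (True, ys)) \<in> E"
  by (auto simp: E_def E0_def)

lemma E_sym: "(u, v) \<in> E \<Longrightarrow> (v, u) \<in> E"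
  by (auto simp: E_def)

lemma sym_E: "sym E"
  using E_sym by (auto simp: sym_def)

lemma E_verts: "E \<subseteq> V \<times> V"
proof -
  have "u \<in> V \<and> v \<in> V" if "(u, v) \<in> E0" for u v
    using that n_ge_2 by (cases rule: E0_cases) (auto simp: V_def)
  then show ?thesis by (auto simp: E_def)
qed

lemma wf_G: "pair_wf_digraph G"
  using E_verts by (simp add: pair_wf_digraph_iff)

lemma finite_V: "finite V"
proof (rule finite_subset)
  show "V \<subseteq> UNIV \<times> {xs. set xs \<subseteq> F \<and> length xs \<le> n}" by (auto simp: V_def)
  show "finite ((UNIV :: bool set) \<times> {xs. set xs \<subseteq> F \<and> length xs \<le> n})"
    using finite_lists_length_le[OF finite_F] by simp
qed

lemma automorphismI:
  assumes "\<And>v. v \<in> V \<Longrightarrow> g v \<in> V" "inj_on g V" "\<And>u v. (u, v) \<in> E0 \<Longrightarrow> (g u, g v) \<in> E"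
  shows "automorphism g"
  using assms E_sym by (auto simp: automorphism_def E_def)

lemma automorphism_vert: "automorphism g \<Longrightarrow> v \<in> V \<Longrightarrow> g v \<in> V"
  and automorphism_inj: "automorphism g \<Longrightarrow> inj_on g V"
  and automorphism_arc: "automorphism g \<Longrightarrow> (u, v) \<in> E \<Longrightarrow> (g u, g v) \<in> E"
  unfolding automorphism_def by blast+

lemma automorphism_id: "automorphism id"
  by (simp add: automorphism_def)

lemma automorphism_comp:
  assumes g: "automorphism g" and h: "automorphism h"
  shows "automorphism (g \<circ> h)"
  unfolding automorphism_def
proof (intro conjI allI impI)
  show "(g \<circ> h) ` V \<subseteq> V" unfolding comp_def using automorphism_vert[OF g automorphism_vert[OF h]] by blast
  have "inj_on g (h ` V)"
    using automorphism_vert[OF h] by (intro inj_on_subset[OF automorphism_inj[OF g]]) blast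
  then show "inj_on (g \<circ> h) V" by (rule comp_inj_on[OF automorphism_inj[OF h]])
  show "((g \<circ> h) u, (g \<circ> h) v) \<in> E" if "(u, v) \<in> E" for u v
    using automorphism_arc[OF g automorphism_arc[OF h that]] by simp
qed

lemma automorphism_relabel:
  assumes "automorphism g"
  shows "relabel g G = G"
proof -
  have g: "g ` V \<subseteq> V" "inj_on g V" "map_prod g g ` E \<subseteq> E"
    using assms by (auto simp: automorphism_def)
  have "g ` V = V" using endo_inj_surj[OF finite_V g(1,2)] .
  moreover have "map_prod g g ` E = E"
    using g(3) inj_on_subset[OF map_prod_inj_on[OF g(2,2)] E_verts]
      finite_subset[OF E_verts] finite_V by (intro endo_inj_surj) auto
  ultimately show ?thesis by (simp add: relabel_def)
qed

lemma automorphism_arc_iff: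
  assumes "automorphism g" "u \<in> V" "v \<in> V"
  shows "(g u, g v) \<in> E \<longleftrightarrow> (u, v) \<in> E"
  using relabel_arc_iff[OF wf_G, of g u v] assms automorphism_relabel[OF assms(1)]
  by (simp add: automorphism_def)

lemma automorphism_relpow_iff:
  assumes "automorphism g" "u \<in> V" "v \<in> V"
  shows "(g u, g v) \<in> E ^^ m \<longleftrightarrow> (u, v) \<in> E ^^ m"
  using relabel_relpow_iff[OF wf_G, of g u v m] assms automorphism_relabel[OF assms(1)]
  by (simp add: automorphism_def)

lemma root_neighbours: "((False, []), v) \<in> E \<longleftrightarrow> v = (True, []) \<or> (\<exists>a\<in>F. v = (False, [a]))"
proof
  assume "((False, []), v) \<in> E"
  then consider "((False, []), v) \<in> E0" | "(v, (False, [])) \<in> E0" by (auto simp: E_def)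
  then show "v = (True, []) \<or> (\<exists>a\<in>F. v = (False, [a]))"
  proof cases
    case 1
    then show ?thesis using n_ge_2 by (cases rule: E0_cases) auto
  next
    case 2
    then show ?thesis by (cases rule: E0_cases) auto
  qed
next
  assume "v = (True, []) \<or> (\<exists>a\<in>F. v = (False, [a]))"
  then show "((False, []), v) \<in> E" using root_arc tree_arc[of "[]" _ False] n_ge_2 by auto
qed

lemma walk_from_root:
  assumes "set xs \<subseteq> F" "length xs < n"
  shows "((s, []), (s, xs)) \<in> E ^^ length xs"
  using assms
proof (induction xs rule: rev_induct)
  case (snoc x xs)
  then show ?case using tree_arc[of xs x s] by auto
qed simp

lemma root_distance_le:
  assumes "v \<in> V" shows "\<exists>j\<le>n. ((False, []), v) \<in> E ^^ j"
proof -
  obtain s xs where v: "v = (s, xs)" "set xs \<subseteq> F" "length xs < n" using assms by (auto simp: V_def)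
  show ?thesis
  proof (cases s)
    case True
    have "((False, []), v) \<in> E ^^ Suc (length xs)"
      using relpow_Suc_I2[OF root_arc] walk_from_root[OF v(2,3), of s] v True by simp
    then show ?thesis using v(3) Suc_leI by blast
  next
    case False
    then show ?thesis using walk_from_root[OF v(2,3), of s] v
      by (intro exI[of _ "length xs"]) auto
  qed
qed

text \<open>
  The function in the conclusion is the distance from the root \<open>(True, [])\<close>; it changes by
  at most \<open>1\<close> along every edge.
\<close>
lemma root_walk_length_ge:
  assumes "((True, []), (s, xs)) \<in> E ^^ m"
  shows "(if s then length xs else Suc (length xs)) \<le> m"
  using assms
proof (induction m arbitrary: s xs)
  case (Suc m)
  then obtain s' xs' where w: "((True, []), (s', xs')) \<in> E ^^ m" "((s', xs'), (s, xs)) \<in> E" by auto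
  then have IH: "(if s' then length xs' else Suc (length xs')) \<le> m" using Suc.IH by blast
  from w(2) consider "((s', xs'), (s, xs)) \<in> E0" | "((s, xs), (s', xs')) \<in> E0" by (auto simp: E_def)
  then show ?case
  proof cases
    case 1
    then show ?thesis using IH by (cases rule: E0_cases) (auto split: if_splits)
  next
    case 2
    then show ?thesis using IH by (cases rule: E0_cases) (auto split: if_splits)
  qed
qed simp

text \<open>
  A potential that grows from \<open>0\<close> at the root of the \<open>True\<close> tree, through its leaves and
  those of the \<open>False\<close> tree, to \<open>2n - 1\<close> at the other root. Only the root edge connects
  vertices whose heights differ by more than \<open>1\<close>.
\<close>
definition height :: "'k vert \<Rightarrow> nat" where
  "height v = (if fst v then length (snd v) else 2 * n - 1 - length (snd v))"

lemma height_step: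
  assumes "(u, v) \<in> E" "{u, v} \<noteq> {(False, []), (True, [])}"
  shows "height v \<le> Suc (height u)"
proof -
  consider "(u, v) \<in> E0" | "(v, u) \<in> E0" using assms by (auto simp: E_def)
  then show ?thesis
  proof cases
    case 1
    then show ?thesis
      by (cases rule: E0_cases) (use assms(2) n_ge_2 in \<open>auto simp: height_def\<close>)
  next
    case 2
    then show ?thesis
      by (cases rule: E0_cases) (use assms(2) n_ge_2 in \<open>auto simp: height_def\<close>)
  qed
qed

end

text \<open>
  With a polarity, it is enough to move the edges at one root to the root edge. The
  assumption \<open>move\<close> does so for the vertices \<open>(False, [a])\<close>.
\<close>
locale coordinate_polygon = coordinate_graph +
  fixes \<rho> :: "'a vert \<Rightarrow> 'a vert"
  assumes auto_\<rho>: "automorphism \<rho>"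
    and \<rho>_invol: "\<And>v. v \<in> V \<Longrightarrow> \<rho> (\<rho> v) = v"
    and \<rho>_swap: "\<And>s xs. (s, xs) \<in> V \<Longrightarrow> fst (\<rho> (s, xs)) = (\<not> s) \<and> length (snd (\<rho> (s, xs))) = length xs"
    and move: "\<And>a. a \<in> F \<Longrightarrow> \<exists>g. automorphism g \<and> g (False, []) = (False, []) \<and> g (False, [a]) = (True, [])"
begin

lemma \<rho>_root: "\<rho> (s, []) = (\<not> s, [])"
  using \<rho>_swap[of s "[]"] n_ge_2 by (cases "\<rho> (s, [])") (auto simp: V_def)

definition moves_to_root :: "'a vert \<Rightarrow> 'a vert \<Rightarrow> bool" where
  "moves_to_root u v \<longleftrightarrow> (\<exists>g. automorphism g \<and> g u = (False, []) \<and> g v = (True, []))"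

lemma moves_to_root_sym: "moves_to_root u v \<Longrightarrow> moves_to_root v u"
  unfolding moves_to_root_def using automorphism_comp[OF auto_\<rho>] \<rho>_root by fastforce

text \<open>
  If \<open>g\<close> takes the edge \<open>{u, v}\<close> to the root edge with \<open>v\<close> at the root \<open>(False, [])\<close>, then
  it takes \<open>w\<close> to a neighbour of that root, and the assumption \<open>move\<close> takes care of the
  rest.
\<close>
lemma moves_to_root_step:
  assumes "moves_to_root u v" "(v, w) \<in> E"
  shows "moves_to_root v w"
proof -
  obtain g where g: "automorphism g" "g v = (False, [])"
    using moves_to_root_sym[OF assms(1)] by (auto simp: moves_to_root_def)
  then have "((False, []), g w) \<in> E" using assms(2) by (metis automorphism_def)
  then consider "g w = (True, [])" | a where "a \<in> F" "g w = (False, [a])"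
    unfolding root_neighbours by blast
  then show ?thesis
  proof cases
    case 1
    then show ?thesis using g by (auto simp: moves_to_root_def)
  next
    case 2
    obtain h where "automorphism h" "h (False, []) = (False, [])" "h (False, [a]) = (True, [])"
      using move[OF 2(1)] by blast
    then show ?thesis
      unfolding moves_to_root_def using g 2 automorphism_comp[of h g] by (intro exI[of _ "h \<circ> g"]) simp
  qed
qed

text \<open>
  Edge-transitivity: the property is passed on from an edge to every edge that shares a
  vertex with it, starting from the root edge, down the trees and then to the edges between
  leaves.
\<close>
lemma arc_moves_to_root:
  assumes "(u, v) \<in> E" shows "moves_to_root u v"
proof -
  have root: "moves_to_root (False, []) (True, [])"
    unfolding moves_to_root_def using automorphism_id by (intro exI[of _ id]) simp
  have tree: "moves_to_root (s, xs) (s, xs @ [x])"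
    if "set xs \<subseteq> F" "x \<in> F" "Suc (length xs) < n" for s xs x
    using that
  proof (induction xs arbitrary: x rule: rev_induct)
    case Nil
    have "moves_to_root (\<not> s, []) (s, [])" using root moves_to_root_sym[OF root] by (cases s) auto
    then show ?case using tree_arc[OF Nil] by (rule moves_to_root_step)
  next
    case (snoc y xs)
    then have "moves_to_root (s, xs) (s, xs @ [y])" by auto
    then show ?case using tree_arc[OF snoc.prems] by (rule moves_to_root_step)
  qed
  have E0: "moves_to_root u v" if "(u, v) \<in> E0" for u v
    using that
  proof (cases rule: E0_cases)
    case root
    then show ?thesis using \<open>moves_to_root (False, []) (True, [])\<close> by simp
  next
    case (tree s xs x)
    then show ?thesis using \<open>\<And>x xs s. _ \<Longrightarrow> _ \<Longrightarrow> _ \<Longrightarrow> moves_to_root (s, xs) (s, xs @ [x])\<close> by simp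
  next
    case (affine xs ys)
    then have "xs \<noteq> []" using n_ge_2 by auto
    then obtain zs z where xs: "xs = zs @ [z]" by (metis rev_exhaust)
    have "moves_to_root (False, zs) (False, zs @ [z])"
      using affine xs by (intro tree) auto
    moreover have "((False, zs @ [z]), v) \<in> E" using affine affine_arc xs by auto
    ultimately show ?thesis using affine xs moves_to_root_step by blast
  qed
  from assms consider "(u, v) \<in> E0" | "(v, u) \<in> E0" by (auto simp: E_def)
  then show ?thesis using E0 moves_to_root_sym by cases blast+
qed

lemma vertex_to_root:
  assumes "v \<in> V"
  obtains g where "automorphism g" "g v = (False, [])"
proof -
  have "\<exists>w. (v, w) \<in> E"
  proof -
    obtain s xs where v: "v = (s, xs)" "set xs \<subseteq> F" "length xs < n" using assms by (auto simp: V_def)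
    show ?thesis
    proof (cases xs rule: rev_cases)
      case Nil
      then show ?thesis using v root_arc E_sym[OF root_arc] by (cases s) auto
    next
      case (snoc ys y)
      then have "((s, ys), v) \<in> E" using v tree_arc[of ys y s] by auto
      then show ?thesis using E_sym by blast
    qed
  qed
  then show thesis using arc_moves_to_root that unfolding moves_to_root_def by blast
qed

text \<open>
  An automorphism moves any given vertex to a root, and every vertex is within distance \<open>n\<close>
  of a root.
\<close>
lemma diameter_G: "graph_diameter G = ereal (real n)"
proof -
  have n0: "n > 0" using n_ge_2 by simp
  have "\<exists>j\<le>n. (u, v) \<in> E ^^ j" if uv: "u \<in> V" "v \<in> V" for u v
  proof -
    obtain g where g: "automorphism g" "g u = (False, [])" by (rule vertex_to_root[OF uv(1)])
    then have "g v \<in> V" using uv by (auto simp: automorphism_def)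
    then show ?thesis using root_distance_le automorphism_relpow_iff[OF g(1) uv] g(2) by metis
  qed
  moreover obtain a where a: "a \<in> F" using F_ne by blast
  have "((True, []), (False, replicate (n - 1) a)) \<notin> E ^^ m" if "m < n" for m
    using root_walk_length_ge[of False "replicate (n - 1) a" m] that by auto
  moreover have "(True, []) \<in> V" "(False, replicate (n - 1) a) \<in> V" using a n0 by (auto simp: V_def)
  ultimately show ?thesis
    unfolding graph_diameter_eq_iff[OF wf_G n0] pair_pre_digraph.simps by blast
qed

text \<open>
  Move an edge of the cycle to the root edge. The rest of the cycle is a path from one root
  to the other that avoids the root edge, so it has to climb from height \<open>0\<close> to height
  \<open>2n - 1\<close> in steps of at most \<open>1\<close>.
\<close>
lemma cycle_length:
  assumes c: "is_cycle E c" and len: "length c \<noteq> 2"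
  shows "2 * n \<le> length c"
proof -
  define m where "m = length c"
  have m0: "m > 0" using c by (simp add: is_cycle_def m_def)
  have "m \<noteq> 1"
  proof
    assume "m = 1"
    then have "(c ! 0, c ! 0) \<in> E" using c by (auto simp: is_cycle_def m_def)
    moreover have "(v, v) \<notin> E" for v
    proof -
      have "u \<noteq> v" if "(u, v) \<in> E0" for u v using that by (cases rule: E0_cases) auto
      then show ?thesis unfolding E_def by blast
    qed
    ultimately show False by blast
  qed
  then have m3: "m \<ge> 3" using m0 len m_def by linarith
  have "(c ! 0, c ! 1) \<in> E" using c m3 by (auto simp: is_cycle_def m_def)
  then obtain g where g: "automorphism g" "g (c ! 0) = (False, [])" "g (c ! 1) = (True, [])"
    using arc_moves_to_root unfolding moves_to_root_def by blast
  have cV: "set c \<subseteq> V" using is_cycle_verts[OF wf_G] c by simp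
  (* The image of the cycle; its first edge is the root edge. *)
  define d where "d i = g (c ! i)" for i
  have inj: "inj_on d {..<m}"
  proof (rule inj_onI)
    fix i j assume ij: "i \<in> {..<m}" "j \<in> {..<m}" "d i = d j"
    then have "c ! i \<in> V" "c ! j \<in> V" using cV m_def by auto
    then have "c ! i = c ! j"
      using ij inj_onD[OF automorphism_inj[OF g(1)], of "c ! i" "c ! j"] by (simp add: d_def)
    then show "i = j" using ij c by (auto simp: is_cycle_def m_def nth_eq_iff_index_eq)
  qed
  have step: "height (d (Suc i mod m)) \<le> Suc (height (d i))" if i: "0 < i" "i < m" for i
  proof (rule height_step)
    show "(d i, d (Suc i mod m)) \<in> E"
      using c i unfolding is_cycle_def d_def m_def by (intro automorphism_arc[OF g(1)]) blast
    show "{d i, d (Suc i mod m)} \<noteq> {(False, []), (True, [])}"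
    proof
      assume "{d i, d (Suc i mod m)} = {(False, []), (True, [])}"
      then have eq: "{d i, d (Suc i mod m)} = {d 0, d 1}" using g by (simp add: d_def)
      have "d i \<noteq> d 0" using inj_onD[OF inj, of i 0] i by auto
      then have "d i = d 1" "d (Suc i mod m) = d 0" using eq by (auto simp: doubleton_eq_iff)
      then have "i = 1" "Suc i mod m = 0"
        using inj_onD[OF inj, of i 1] inj_onD[OF inj, of "Suc i mod m" 0] i m3 by auto
      then show False using m3 by simp
    qed
  qed
  have "height (d (Suc i)) \<le> i" if "Suc i < m" for i
    using that
  proof (induction i)
    case 0
    then show ?case using g by (simp add: d_def height_def)
  next
    case (Suc i)
    then show ?case using step[of "Suc i"] by simp
  qed
  moreover have "Suc (m - 2) = m - 1" using m3 by simp
  ultimately have "height (d (m - 1)) \<le> m - 2" using m3 by (metis diff_less zero_less_one m0)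
  moreover have "height (d 0) \<le> Suc (height (d (m - 1)))" using step[of "m - 1"] m3 by simp
  moreover have "height (d 0) = 2 * n - 1" using g by (simp add: d_def height_def)
  ultimately show ?thesis using m3 n_ge_2 by (simp add: m_def)
qed

lemma valency_G:
  assumes "v \<in> V"
  shows "card {w. (v, w) \<in> E} = card F + 1"
proof -
  obtain g where g: "automorphism g" "g v = (False, [])" by (rule vertex_to_root[OF assms])
  have gV: "g ` V = V" using arg_cong[OF automorphism_relabel[OF g(1)], of pverts] by simp
  have sub: "{w. (u, w) \<in> E} \<subseteq> V" for u using E_verts by auto
  have "{w. (g v, w) \<in> E} = g ` {w. (v, w) \<in> E}"
  proof (intro subset_antisym subsetI)
    fix w assume w: "w \<in> {w. (g v, w) \<in> E}"
    then obtain x where x: "x \<in> V" "w = g x" using sub gV by blast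
    then show "w \<in> g ` {w. (v, w) \<in> E}" using w automorphism_arc_iff[OF g(1) assms x(1)] by blast
  qed (use automorphism_arc[OF g(1)] in blast)
  moreover have "inj_on g {w. (v, w) \<in> E}"
    using g(1) by (auto simp: automorphism_def intro: inj_on_subset[OF _ sub])
  ultimately have "card {w. (v, w) \<in> E} = card {w. ((False, []), w) \<in> E}"
    using g(2) by (simp add: card_image)
  also have "{w. ((False, []), w) \<in> E} = insert (True, []) ((\<lambda>a. (False, [a])) ` F)"
    unfolding root_neighbours by auto
  also have "card \<dots> = card F + 1"
    using finite_F by (subst card_insert_disjoint) (auto simp: card_image inj_on_def)
  finally show ?thesis .
qed

text \<open>
  A leaf has \<open>|F| + 1\<close> neighbours and only one of them is its parent.
\<close>
lemma ex_affine:
  obtains xs ys where "set xs \<subseteq> F" "set ys \<subseteq> F" "length xs = n - 1" "length ys = n - 1" "R xs ys"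
proof -
  obtain a where a: "a \<in> F" using F_ne by blast
  let ?xs = "replicate (n - 1) a"
  have v: "(False, ?xs) \<in> V" using a n_ge_2 by (auto simp: V_def)
  have "card F > 0" using finite_F F_ne by (simp add: card_gt_0_iff)
  have "\<not> {w. ((False, ?xs), w) \<in> E} \<subseteq> {(False, butlast ?xs)}"
  proof
    assume "{w. ((False, ?xs), w) \<in> E} \<subseteq> {(False, butlast ?xs)}"
    from card_mono[OF _ this] show False using valency_G[OF v] \<open>card F > 0\<close> by simp
  qed
  then obtain w where w: "((False, ?xs), w) \<in> E" "w \<noteq> (False, butlast ?xs)" by blast
  then consider "((False, ?xs), w) \<in> E0" | "(w, (False, ?xs)) \<in> E0" by (auto simp: E_def)
  then show thesis
  proof cases
    case 1
    then show thesis
    proof (cases rule: E0_cases)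
      case root
      then show ?thesis using n_ge_2 by simp
    next
      case (tree s xs x)
      then show ?thesis by auto
    next
      case (affine xs ys)
      then show ?thesis using that by blast
    qed
  next
    case 2
    then show thesis
    proof (cases rule: E0_cases)
      case (tree s xs x)
      then have "?xs = xs @ [x]" "\<not> s" by simp_all
      then have "w = (False, butlast ?xs)" using tree(1) by (metis butlast_snoc)
      then show ?thesis using w by blast
    qed auto
  qed
qed

text \<open>
  Any edge between two leaves closes a cycle of length \<open>2n\<close> with the paths from these leaves
  to the roots.
\<close>
lemma girth_G: "graph_girth G = enat (2 * n)"
proof -
  obtain xs ys where xy: "set xs \<subseteq> F" "set ys \<subseteq> F" "length xs = n - 1" "length ys = n - 1" "R xs ys"
    by (rule ex_affine)
  (* Down one tree from its root to a leaf, across, and up the other tree. *)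
  define d where "d i = (if i < n then (False, take i xs) else (True, take (2 * n - 1 - i) ys))" for i
  define c where "c = map d [0..<2 * n]"
  have len: "length c = 2 * n" by (simp add: c_def)
  have "inj_on d {0..<2 * n}"
  proof (rule inj_onI)
    fix i j assume ij: "i \<in> {0..<2 * n}" "j \<in> {0..<2 * n}" "d i = d j"
    then have "(i < n) = (j < n)" by (auto simp: d_def split: if_splits)
    then show "i = j"
    proof (cases "i < n")
      case True
      then have "length (take i xs) = length (take j xs)"
        using ij \<open>(i < n) = (j < n)\<close> by (auto simp: d_def)
      then show ?thesis using True \<open>(i < n) = (j < n)\<close> xy by simp
    next
      case False
      then have "length (take (2 * n - 1 - i) ys) = length (take (2 * n - 1 - j) ys)"
        using ij \<open>(i < n) = (j < n)\<close> by (auto simp: d_def)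
      then show ?thesis using False \<open>(i < n) = (j < n)\<close> xy ij by simp
    qed
  qed
  then have dist: "distinct c" by (simp add: c_def distinct_map)
  have tree: "((s, take i zs), (s, take (Suc i) zs)) \<in> E"
    if "set zs \<subseteq> F" "length zs = n - 1" "Suc i < n" for s i zs
  proof -
    have "take (Suc i) zs = take i zs @ [zs ! i]" using that by (simp add: take_Suc_conv_app_nth)
    moreover have "set (take i zs) \<subseteq> F" "zs ! i \<in> F"
      using that set_take_subset[of i zs] nth_mem[of i zs] by auto
    ultimately show ?thesis using tree_arc[of "take i zs" "zs ! i" s] that by simp
  qed
  have "(d i, d (Suc i mod (2 * n))) \<in> E" if i: "i < 2 * n" for i
  proof -
    consider "Suc i < n" | "Suc i = n" | "n \<le> i" "Suc i < 2 * n" | "Suc i = 2 * n" using i by linarith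
    then show ?thesis
    proof cases
      case 1
      then show ?thesis using tree[OF xy(1,3) 1] by (simp add: d_def)
    next
      case 2
      then have "i = n - 1" "Suc i mod (2 * n) = n" using n_ge_2 by auto
      then show ?thesis using affine_arc[OF xy] xy n_ge_2 by (simp add: d_def)
    next
      case 3
      then have "2 * n - 1 - i = Suc (2 * n - 1 - Suc i)" "Suc (2 * n - 1 - Suc i) < n" by auto
      then show ?thesis using tree[OF xy(2,4), of "2 * n - 1 - Suc i" True] 3 E_sym by (simp add: d_def)
    next
      case 4
      then have "d i = (True, [])" "d (Suc i mod (2 * n)) = (False, [])" using n_ge_2 by (auto simp: d_def)
      then show ?thesis using E_sym[OF root_arc] by simp
    qed
  qed
  then have "is_cycle E c"
    using dist n_ge_2 by (simp add: is_cycle_def c_def)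
  moreover have "2 * n \<noteq> 2" using n_ge_2 by simp
  ultimately show ?thesis
    unfolding graph_girth_eq_iff[OF wf_G \<open>2 * n \<noteq> 2\<close>] pair_pre_digraph.simps
    using cycle_length len by blast
qed

text \<open>
  The polarity swaps the trees and keeps depths, so the points are the vertices of even
  depth in the one tree and of odd depth in the other.
\<close>
theorem admissible_card:
  assumes "card F \<ge> 2"
  shows "admissible n (card F)"
proof -
  let ?P = "{v \<in> V. fst v \<longleftrightarrow> even (length (snd v))}"
  let ?L = "{v \<in> V. fst v \<longleftrightarrow> odd (length (snd v))}"
  have V: "?P \<union> ?L = V" by auto
  have \<rho>V: "\<rho> v \<in> V" if "v \<in> V" for v using auto_\<rho> that by (auto simp: automorphism_def)
  have swap: "fst (\<rho> v) = (\<not> fst v)" "length (snd (\<rho> v)) = length (snd v)" if "v \<in> V" for v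
    using \<rho>_swap[of "fst v" "snd v"] that by simp_all
  have arcs: "E \<subseteq> ?P \<times> ?L \<union> ?L \<times> ?P"
  proof -
    have "(u, v) \<in> ?P \<times> ?L \<union> ?L \<times> ?P" if uv: "(u, v) \<in> E0" for u v
    proof -
      have "u \<in> V" "v \<in> V" using E_verts uv by (auto simp: E_def)
      with uv show ?thesis by (cases rule: E0_cases) auto
    qed
    then have E0: "E0 \<subseteq> ?P \<times> ?L \<union> ?L \<times> ?P" by (rule subrelI)
    have "E0\<inverse> \<subseteq> (?P \<times> ?L \<union> ?L \<times> ?P)\<inverse>" using E0 by (simp only: converse_mono)
    then have "E0\<inverse> \<subseteq> ?P \<times> ?L \<union> ?L \<times> ?P" by (simp only: converse_Un converse_Times Un_commute)
    then show ?thesis using E0 unfolding E_def by (rule Un_least[rotated])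
  qed
  show ?thesis
  proof (rule admissibleI[where P = ?P and L = ?L and E = E and \<rho> = \<rho>])
    show "finite (?P \<union> ?L)" using finite_V V by simp
    show "?P \<inter> ?L = {}" by auto
    show "graph_diameter \<lparr>pverts = ?P \<union> ?L, parcs = E\<rparr> = ereal (real n)" unfolding V by (rule diameter_G)
    show "graph_girth \<lparr>pverts = ?P \<union> ?L, parcs = E\<rparr> = enat (2 * n)" unfolding V by (rule girth_G)
    have PL: "\<rho> v \<in> ?L" if "v \<in> ?P" for v using that swap[of v] \<rho>V[of v] by simp
    have LP: "\<rho> v \<in> ?P" if "v \<in> ?L" for v using that swap[of v] \<rho>V[of v] by simp
    show "\<rho> ` ?P = ?L"
    proof (intro subset_antisym subsetI)
      fix v assume v: "v \<in> ?L"
      then have "v = \<rho> (\<rho> v)" using \<rho>_invol[of v] by simp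
      then show "v \<in> \<rho> ` ?P" using LP[OF v] by (rule image_eqI)
    qed (use PL in blast)
    show "\<rho> ` ?L = ?P"
    proof (intro subset_antisym subsetI)
      fix v assume v: "v \<in> ?P"
      then have "v = \<rho> (\<rho> v)" using \<rho>_invol[of v] by simp
      then show "v \<in> \<rho> ` ?L" using PL[OF v] by (rule image_eqI)
    qed (use LP in blast)
    show "card {w. (v, w) \<in> E} = card F + 1" if "v \<in> ?P \<union> ?L" for v
      using that valency_G[of v] unfolding V by simp
    show "\<rho> (\<rho> v) = v" if "v \<in> ?P \<union> ?L" for v using that \<rho>_invol[of v] unfolding V by simp
    show "(\<rho> u, \<rho> v) \<in> E" if "(u, v) \<in> E" for u v using automorphism_arc[OF auto_\<rho> that] .
  qed (use arcs sym_E n_ge_2 assms in simp_all)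
qed

end

section \<open>Finite fields with a root of the Frobenius map\<close>

text \<open>
  A finite subfield \<open>F\<close> of an ambient field with two mutually inverse automorphisms \<open>s\<close> and
  \<open>u\<close>, where \<open>s x = (u x)\<^sup>p\<close>. If \<open>p\<close> is the characteristic, then \<open>s\<close> is a square root of the
  Frobenius map, for \<open>s (s x) = (u (s x))\<^sup>p = x\<^sup>p\<close>. With \<open>p = 1\<close> the locale also covers
  fields without any twist, where \<open>s\<close> and \<open>u\<close> are the identity.
\<close>
locale finite_field_with_twist =
  fixes F :: "'k::field set" and s u :: "'k \<Rightarrow> 'k" and p :: nat
  assumes finite_F: "finite F" and zero_F: "0 \<in> F" and one_F: "1 \<in> F"
    and add_F: "\<And>x y. x \<in> F \<Longrightarrow> y \<in> F \<Longrightarrow> x + y \<in> F"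
    and uminus_F: "\<And>x. x \<in> F \<Longrightarrow> - x \<in> F"
    and mult_F: "\<And>x y. x \<in> F \<Longrightarrow> y \<in> F \<Longrightarrow> x * y \<in> F"
    and inverse_F: "\<And>x. x \<in> F \<Longrightarrow> inverse x \<in> F"
    and s_F: "\<And>x. x \<in> F \<Longrightarrow> s x \<in> F" and u_F: "\<And>x. x \<in> F \<Longrightarrow> u x \<in> F"
    and s_add: "\<And>x y. s (x + y) = s x + s y" and s_mult: "\<And>x y. s (x * y) = s x * s y"
    and u_add: "\<And>x y. u (x + y) = u x + u y" and u_mult: "\<And>x y. u (x * y) = u x * u y"
    and s_u: "\<And>x. x \<in> F \<Longrightarrow> s (u x) = x" and u_s: "\<And>x. x \<in> F \<Longrightarrow> u (s x) = x"
    and s_eq: "\<And>x. s x = u x ^ p"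

text \<open>
  The polynomial \<open>X\<^sup>q - X\<close> has derivative \<open>-1\<close>, so its roots in an algebraically closed
  field are simple.
\<close>
lemma card_frobenius_fixed_points:
  assumes p: "prime CHAR('k::alg_closed_field)" and m: "m > 0"
  defines "q \<equiv> CHAR('k) ^ m"
  shows "finite {x :: 'k. x ^ q = x}" and "card {x :: 'k. x ^ q = x} = q"
proof -
  define f :: "'k poly" where "f = monom 1 q - monom 1 1"
  have q: "q > 1" unfolding q_def using p m by (metis one_less_power prime_gt_1_nat)
  have deg: "degree f = q"
    unfolding f_def diff_conv_add_uminus using q
    by (subst degree_add_eq_left) (auto simp: degree_monom_eq)
  have f0: "f \<noteq> 0" using deg q by auto
  have "of_nat q = (0 :: 'k)" using m by (simp add: q_def)
  then have deriv: "pderiv f = [:- 1:]"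
    by (simp add: f_def pderiv_diff pderiv_monom monom_0)
  have roots: "{x. poly f x = 0} = {x :: 'k. x ^ q = x}" by (simp add: f_def poly_monom)
  obtain A where A: "size A = degree f" "f = smult (lead_coeff f) (\<Prod>x\<in>#A. [:-x, 1:])"
    using alg_closed_imp_factorization[OF f0] by blast
  have simple: "count A x \<le> 1" for x
  proof (rule ccontr)
    assume count: "\<not> count A x \<le> 1"
    then have "x \<in># A" by (simp add: count_greater_zero_iff[symmetric] del: count_greater_zero_iff)
    then obtain A' where A': "A = add_mset x A'" by (blast dest: multi_member_split)
    then have "x \<in># A'"
      using count by (simp add: count_greater_zero_iff[symmetric] del: count_greater_zero_iff)
    then obtain B where "A' = add_mset x B" by (blast dest: multi_member_split)
    then have "f = [:-x, 1:] * ([:-x, 1:] * smult (lead_coeff f) (\<Prod>x\<in>#B. [:-x, 1:]))"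
      using A(2) A' by simp
    then obtain g where g: "f = [:-x, 1:] * ([:-x, 1:] * g)" by blast
    have "poly (pderiv f) x = 0" by (simp add: g pderiv_mult del: mult_pCons_left)
    then show False by (simp add: deriv)
  qed
  then have "A = mset_set (set_mset A)"
  proof (intro multiset_eqI)
    fix x
    show "count A x = count (mset_set (set_mset A)) x"
    proof (cases "x \<in># A")
      case True
      then have "count A x > 0" by simp
      then have "count A x = 1" using simple[of x] by linarith
      then show ?thesis using True by simp
    qed (simp add: not_in_iff)
  qed
  then have "card (set_mset A) = q" using A(1) deg by (metis size_mset_set)
  moreover have "set_mset A = {x. poly f x = 0}"
  proof -
    have "poly f x = 0 \<longleftrightarrow> x \<in># A" for x
      by (subst A(2)) (use f0 in \<open>auto simp: poly_prod_mset prod_mset_zero_iff\<close>)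
    then show ?thesis by auto
  qed
  ultimately show "finite {x :: 'k. x ^ q = x}" "card {x :: 'k. x ^ q = x} = q"
    using roots by (metis finite_set_mset)+
qed

text \<open>
  On the field with \<open>p\<^sup>2\<^sup>e\<^sup>+\<^sup>1\<close> elements the maps \<open>x \<mapsto> x ^ p\<^sup>e\<^sup>+\<^sup>1\<close> and \<open>x \<mapsto> x ^ p\<^sup>e\<close> are
  inverse to each other, because the exponents multiply to \<open>p\<^sup>2\<^sup>e\<^sup>+\<^sup>1\<close>.
\<close>
lemma finite_field_with_twist_exists:
  assumes p: "CHAR('k::alg_closed_field) = p" "prime p"
  shows "finite_field_with_twist {x :: 'k. x ^ p ^ (2 * e + 1) = x} (\<lambda>x. x ^ p ^ (e + 1)) (\<lambda>x. x ^ p ^ e) p"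
    and "card {x :: 'k. x ^ p ^ (2 * e + 1) = x} = p ^ (2 * e + 1)"
proof -
  have prime: "prime CHAR('k)" using p by simp
  have dream: "(x + y) ^ p ^ m = x ^ p ^ m + y ^ p ^ m" for x y :: 'k and m
    using freshmans_dream'[OF prime, of "p ^ m" m x y] p by simp
  have neg: "(- x) ^ p ^ m = - (x ^ p ^ m)" for x :: 'k and m
  proof -
    have "x ^ p ^ m + (- x) ^ p ^ m = 0 ^ p ^ m" using dream[of x "- x" m] by simp
    also have "\<dots> = 0" using p(2) prime_gt_0_nat by (simp add: power_0_left)
    finally show ?thesis by (simp only: eq_neg_iff_add_eq_0 add.commute)
  qed
  have pow: "(x ^ p ^ a) ^ p ^ b = x ^ p ^ (a + b)" for x :: 'k and a b
    by (simp add: power_mult[symmetric] power_add)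
  show "card {x :: 'k. x ^ p ^ (2 * e + 1) = x} = p ^ (2 * e + 1)"
    using card_frobenius_fixed_points(2)[OF prime, of "2 * e + 1"] p by simp
  show "finite_field_with_twist {x :: 'k. x ^ p ^ (2 * e + 1) = x} (\<lambda>x. x ^ p ^ (e + 1)) (\<lambda>x. x ^ p ^ e) p"
  proof
    show "finite {x :: 'k. x ^ p ^ (2 * e + 1) = x}"
      using card_frobenius_fixed_points(1)[OF prime, of "2 * e + 1"] p by simp
    show "0 \<in> {x :: 'k. x ^ p ^ (2 * e + 1) = x}" using p(2) prime_gt_0_nat by simp
    fix x y :: 'k
    have swap: "(x ^ p ^ a) ^ p ^ b = (x ^ p ^ b) ^ p ^ a" for a b by (simp add: pow add.commute)
    show "(x ^ p ^ (e + 1)) = (x ^ p ^ e) ^ p" using pow[of x e 1] by simp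
    show "(x + y) ^ p ^ (e + 1) = x ^ p ^ (e + 1) + y ^ p ^ (e + 1)"
      "(x + y) ^ p ^ e = x ^ p ^ e + y ^ p ^ e" by (rule dream)+
    show "(x * y) ^ p ^ (e + 1) = x ^ p ^ (e + 1) * y ^ p ^ (e + 1)"
      "(x * y) ^ p ^ e = x ^ p ^ e * y ^ p ^ e" by (rule power_mult_distrib)+
    assume x: "x \<in> {x :: 'k. x ^ p ^ (2 * e + 1) = x}"
    then have x': "x ^ p ^ (2 * e + 1) = x" by simp
    show "- x \<in> {x :: 'k. x ^ p ^ (2 * e + 1) = x}" using x' neg[of x "2 * e + 1"] by simp
    show "inverse x \<in> {x :: 'k. x ^ p ^ (2 * e + 1) = x}" using x' by (simp add: power_inverse)
    show "x ^ p ^ (e + 1) \<in> {x :: 'k. x ^ p ^ (2 * e + 1) = x}"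
      "x ^ p ^ e \<in> {x :: 'k. x ^ p ^ (2 * e + 1) = x}"
      using swap[of "e + 1" "2 * e + 1"] swap[of e "2 * e + 1"] by (simp_all only: mem_Collect_eq x')
    have sum: "e + (e + 1) = 2 * e + 1" "(e + 1) + e = 2 * e + 1" by simp_all
    show "(x ^ p ^ e) ^ p ^ (e + 1) = x" "(x ^ p ^ (e + 1)) ^ p ^ e = x"
      by (simp_all only: pow sum x')
    assume y: "y \<in> {x :: 'k. x ^ p ^ (2 * e + 1) = x}"
    show "x + y \<in> {x :: 'k. x ^ p ^ (2 * e + 1) = x}" using x' y dream[of x y "2 * e + 1"] by simp
    show "x * y \<in> {x :: 'k. x ^ p ^ (2 * e + 1) = x}" using x' y by (simp only: mem_Collect_eq power_mult_distrib)
  qed simp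
qed

lemma CHAR_finite_2: "CHAR(Enum.finite_2) = 2"
proof -
  have "of_nat 2 = (0 :: Enum.finite_2)" by code_simp
  then have "CHAR(Enum.finite_2) dvd 2" by (simp only: of_nat_eq_0_iff_char_dvd)
  then show ?thesis using CHAR_not_1'[where 'a = Enum.finite_2]
    by (metis One_nat_def prime_nat_iff two_is_prime_nat)
qed

lemma CHAR_finite_3: "CHAR(Enum.finite_3) = 3"
proof -
  have "of_nat 3 = (0 :: Enum.finite_3)" by code_simp
  then have "CHAR(Enum.finite_3) dvd 3" by (simp only: of_nat_eq_0_iff_char_dvd)
  moreover have "prime (3 :: nat)" by simp
  ultimately show ?thesis using CHAR_not_1'[where 'a = Enum.finite_3]
    by (metis One_nat_def prime_nat_iff)
qed

section \<open>Coordinate polygons over a field\<close>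

context coordinate_graph
begin

text \<open>
  Automorphisms that respect the trees act on paths in such a way that the image of a longer
  path extends the image of a shorter one.
\<close>
lemma prefix_map_props:
  assumes nil: "f [] = []"
    and snoc: "\<And>xs x. set xs \<subseteq> F \<Longrightarrow> x \<in> F \<Longrightarrow> Suc (length xs) < m \<Longrightarrow> \<exists>y\<in>F. f (xs @ [x]) = f xs @ [y]"
    and "set xs \<subseteq> F" "length xs < m"
  shows "set (f xs) \<subseteq> F \<and> length (f xs) = length xs"
  using assms(3,4)
proof (induction xs rule: rev_induct)
  case Nil
  then show ?case by (simp add: nil)
next
  case (snoc x xs)
  then obtain y where "y \<in> F" "f (xs @ [x]) = f xs @ [y]" using assms(2)[of xs x] by auto
  then show ?case using snoc by auto
qed

text \<open>
  The flag \<open>b\<close> tells whether the two trees are exchanged.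
\<close>
lemma automorphism_branchwise:
  assumes g: "\<And>s xs. g (s, xs) = (s \<noteq> b, f s xs)"
    and nil: "\<And>s. f s [] = []"
    and snoc: "\<And>s xs x. set xs \<subseteq> F \<Longrightarrow> x \<in> F \<Longrightarrow> Suc (length xs) < n \<Longrightarrow>
                 \<exists>y\<in>F. f s (xs @ [x]) = f s xs @ [y]"
    and inv: "\<And>s xs. set xs \<subseteq> F \<Longrightarrow> length xs < n \<Longrightarrow> f' s (f s xs) = xs"
    and R: "\<And>xs ys. set xs \<subseteq> F \<Longrightarrow> set ys \<subseteq> F \<Longrightarrow> length xs = n - 1 \<Longrightarrow> length ys = n - 1 \<Longrightarrow>
              R xs ys \<Longrightarrow> if b then R (f True ys) (f False xs) else R (f False xs) (f True ys)"
  shows "automorphism g"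
proof (rule automorphismI)
  have props: "set (f s xs) \<subseteq> F \<and> length (f s xs) = length xs" if "set xs \<subseteq> F" "length xs < n" for s xs
    using prefix_map_props[of "f s" n, OF nil snoc that] by blast
  show "g v \<in> V" if "v \<in> V" for v
    using that props by (cases v) (auto simp: V_def g)
  show "inj_on g V"
  proof (rule inj_onI)
    fix v w assume "v \<in> V" "w \<in> V" "g v = g w"
    then show "v = w" using inv by (cases v; cases w) (auto simp: V_def g, metis+)
  qed
  show "(g v, g w) \<in> E" if "(v, w) \<in> E0" for v w
    using that
  proof (cases rule: E0_cases)
    case root
    then show ?thesis using root_arc E_sym[OF root_arc] by (cases b) (auto simp: g nil)
  next
    case (tree s xs x)
    obtain y where y: "y \<in> F" "f s (xs @ [x]) = f s xs @ [y]" using snoc[OF tree(3-5), of s] by blast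
    have p: "set (f s xs) \<subseteq> F" "length (f s xs) = length xs" using props[of xs s] tree by auto
    show ?thesis unfolding tree(1,2) g y(2)
      by (rule tree_arc[OF p(1) y(1)]) (use tree(5) p(2) in simp)
  next
    case (affine xs ys)
    have n: "n - 1 < n" using n_ge_2 by simp
    have p: "set (f s xs) \<subseteq> F" "length (f s xs) = n - 1" "set (f s ys) \<subseteq> F" "length (f s ys) = n - 1" for s
      using props[of xs s] props[of ys s] affine n by auto
    show ?thesis
      using R[OF affine(3-7)] affine_arc[OF p(1,3,2,4)] E_sym[OF affine_arc[OF p(3,1,4,2)]]
      unfolding affine(1,2) g by (cases b) auto
  qed
qed

end

text \<open>
  The coordinates of a vertex belong to root subgroups whose roots are alternately short and
  long. A polarity interchanges the two root lengths and therefore applies \<open>s\<close> and its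
  inverse \<open>u\<close> in turn.
\<close>
fun alternate :: "('a \<Rightarrow> 'b) \<Rightarrow> ('a \<Rightarrow> 'b) \<Rightarrow> 'a list \<Rightarrow> 'b list" where
  "alternate f g [] = []"
| "alternate f g (x # xs) = f x # alternate g f xs"

lemma alternate_snoc:
  "alternate f g (xs @ [x]) = alternate f g xs @ [if even (length xs) then f x else g x]"
  by (induction f g xs rule: alternate.induct) auto

lemma alternate_inverse:
  assumes "\<And>x. x \<in> A \<Longrightarrow> f' (f x) = x" "\<And>x. x \<in> A \<Longrightarrow> g' (g x) = x" "set xs \<subseteq> A"
  shows "alternate f' g' (alternate f g xs) = xs"
  using assms
proof (induction xs arbitrary: f g f' g')
  case (Cons x xs)
  then show ?case by auto
qed simp

lemma length_alternate [simp]: "length (alternate f g xs) = length xs"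
  by (induction f g xs rule: alternate.induct) auto

context finite_field_with_twist
begin

lemma diff_F: "x \<in> F \<Longrightarrow> y \<in> F \<Longrightarrow> x - y \<in> F"
  using add_F[of x "- y"] uminus_F by simp

lemma power_F: "x \<in> F \<Longrightarrow> x ^ m \<in> F"
  by (induction m) (auto intro: one_F mult_F)

lemmas closed = zero_F add_F diff_F uminus_F mult_F power_F inverse_F

lemma s_diff: "s (x - y) = s x - s y" and u_diff: "u (x - y) = u x - u y"
  using s_add[of "x - y" y] u_add[of "x - y" y] by simp_all

lemma s_power: "m > 0 \<Longrightarrow> s (x ^ m) = s x ^ m" and u_power: "m > 0 \<Longrightarrow> u (x ^ m) = u x ^ m"
  by (induction m rule: nat_induct_non_zero) (simp_all add: s_mult u_mult)

end

text \<open>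
  The data from which the required automorphisms are assembled.

  \<^item> By \<open>R_dual\<close>, applying \<open>s\<close> and \<open>u\<close> alternately is a polarity.

  \<^item> The maps \<open>T t\<close> describe, on the \<open>False\<close> tree, the translation that adds \<open>t\<close> to the first
  coordinate \<open>k\<close> of the \<open>True\<close> tree.

  \<^item> The maps \<open>\<sigma>\<close>, \<open>\<mu>\<close> and \<open>\<kappa>\<close> describe the automorphism that fixes the root \<open>(False, [])\<close>
  and acts on its neighbours, a projective line, by \<open>a \<mapsto> 1/a\<close>. Here \<open>(True, [])\<close> plays the
  role of the point \<open>a = \<infinity>\<close>. So \<open>\<sigma>\<close> exchanges the subtrees of \<open>a = 0\<close> and \<open>a = \<infinity>\<close> (without
  the leaves of the \<open>True\<close> tree), \<open>\<mu> a\<close> maps the subtree of \<open>a \<noteq> 0\<close> to that of \<open>1/a\<close>, and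
  \<open>\<kappa>\<close> is the action on the leaves of the \<open>True\<close> tree, the vertices opposite to the fixed
  root.
\<close>
locale field_polygon = finite_field_with_twist F s u p for F :: "'k::field set" and s u p +
  fixes n :: nat and R :: "'k list \<Rightarrow> 'k list \<Rightarrow> bool"
    and T :: "'k \<Rightarrow> 'k list \<Rightarrow> 'k list" and \<sigma> :: "'k list \<Rightarrow> 'k list"
    and \<mu> :: "'k \<Rightarrow> 'k list \<Rightarrow> 'k list" and \<kappa> :: "'k list \<Rightarrow> 'k list"
  assumes n_ge_3: "n \<ge> 3"
    and R_dual: "\<And>xs ys. set xs \<subseteq> F \<Longrightarrow> set ys \<subseteq> F \<Longrightarrow> length xs = n - 1 \<Longrightarrow> length ys = n - 1 \<Longrightarrow>
        R xs ys \<Longrightarrow> R (alternate u s ys) (alternate s u xs)"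
    and T_Nil: "\<And>t. T t [] = []"
    and T_snoc: "\<And>t xs x. t \<in> F \<Longrightarrow> set xs \<subseteq> F \<Longrightarrow> x \<in> F \<Longrightarrow> Suc (length xs) < n \<Longrightarrow>
        \<exists>y\<in>F. T t (xs @ [x]) = T t xs @ [y]"
    and T_inverse: "\<And>t xs. t \<in> F \<Longrightarrow> set xs \<subseteq> F \<Longrightarrow> length xs < n \<Longrightarrow> T (- t) (T t xs) = xs"
    and R_T: "\<And>t xs k ys. t \<in> F \<Longrightarrow> set xs \<subseteq> F \<Longrightarrow> set (k # ys) \<subseteq> F \<Longrightarrow> length xs = n - 1 \<Longrightarrow>
        length (k # ys) = n - 1 \<Longrightarrow> R xs (k # ys) \<Longrightarrow> R (T t xs) ((k + t) # ys)"
    and \<sigma>_Nil: "\<sigma> [] = []"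
    and \<sigma>_snoc: "\<And>xs x. set xs \<subseteq> F \<Longrightarrow> x \<in> F \<Longrightarrow> Suc (length xs) < n - 1 \<Longrightarrow>
        \<exists>y\<in>F. \<sigma> (xs @ [x]) = \<sigma> xs @ [y]"
    and \<sigma>_inverse: "\<And>xs. set xs \<subseteq> F \<Longrightarrow> length xs < n - 1 \<Longrightarrow> \<sigma> (\<sigma> xs) = xs"
    and \<mu>_Nil: "\<And>a. \<mu> a [] = []"
    and \<mu>_snoc: "\<And>a xs x. a \<in> F \<Longrightarrow> a \<noteq> 0 \<Longrightarrow> set xs \<subseteq> F \<Longrightarrow> x \<in> F \<Longrightarrow> Suc (length xs) < n - 1 \<Longrightarrow>
        \<exists>y\<in>F. \<mu> a (xs @ [x]) = \<mu> a xs @ [y]"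
    and \<mu>_inverse: "\<And>a xs. a \<in> F \<Longrightarrow> a \<noteq> 0 \<Longrightarrow> set xs \<subseteq> F \<Longrightarrow> length xs < n - 1 \<Longrightarrow>
        \<mu> (inverse a) (\<mu> a xs) = xs"
    and \<kappa>_F: "\<And>ys. set ys \<subseteq> F \<Longrightarrow> length ys = n - 1 \<Longrightarrow> set (\<kappa> ys) \<subseteq> F \<and> length (\<kappa> ys) = n - 1"
    and \<kappa>_inverse: "\<And>ys. set ys \<subseteq> F \<Longrightarrow> length ys = n - 1 \<Longrightarrow> \<kappa> (\<kappa> ys) = ys"
    and R_\<mu>: "\<And>a xs ys. a \<in> F \<Longrightarrow> a \<noteq> 0 \<Longrightarrow> set xs \<subseteq> F \<Longrightarrow> set ys \<subseteq> F \<Longrightarrow> Suc (length xs) = n - 1 \<Longrightarrow>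
        length ys = n - 1 \<Longrightarrow> R (a # xs) ys \<Longrightarrow> R (inverse a # \<mu> a xs) (\<kappa> ys)"
    and R_0: "\<And>xs ys. set xs \<subseteq> F \<Longrightarrow> set ys \<subseteq> F \<Longrightarrow> Suc (length xs) = n - 1 \<Longrightarrow>
        length ys = n - 1 \<Longrightarrow> R (0 # xs) ys \<Longrightarrow> \<exists>y\<in>F. \<kappa> ys = \<sigma> xs @ [y]"
    and R_\<sigma>: "\<And>ys x. set ys \<subseteq> F \<Longrightarrow> x \<in> F \<Longrightarrow> Suc (length ys) = n - 1 \<Longrightarrow> R (0 # \<sigma> ys) (\<kappa> (ys @ [x]))"
begin

sublocale coordinate_graph n F R
  by unfold_locales (use n_ge_3 finite_F zero_F in auto)

definition polarity_map :: "'k vert \<Rightarrow> 'k vert" where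
  "polarity_map = (\<lambda>(b, xs). (\<not> b, if b then alternate u s xs else alternate s u xs))"

definition translation :: "'k \<Rightarrow> 'k vert \<Rightarrow> 'k vert" where
  "translation t = (\<lambda>(b, xs). (b, if b then (case xs of [] \<Rightarrow> [] | k # ys \<Rightarrow> (k + t) # ys) else T t xs))"

definition inversion :: "'k vert \<Rightarrow> 'k vert" where
  "inversion = (\<lambda>(b, xs).
     if b then (if length xs = n - 1 then (True, \<kappa> xs) else (False, 0 # \<sigma> xs))
     else (case xs of [] \<Rightarrow> (False, [])
             | a # cs \<Rightarrow> if a = 0 then (True, \<sigma> cs) else (False, inverse a # \<mu> a cs)))"

lemma automorphism_polarity_map: "automorphism polarity_map"
proof (rule automorphism_branchwise[where b = True and
      f = "\<lambda>b xs. if b then alternate u s xs else alternate s u xs" and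
      f' = "\<lambda>b xs. if b then alternate s u xs else alternate u s xs"])
  show "\<exists>y\<in>F. (if b then alternate u s (xs @ [x]) else alternate s u (xs @ [x])) =
      (if b then alternate u s xs else alternate s u xs) @ [y]" if "x \<in> F" for b xs x
    using that by (auto simp: alternate_snoc s_F u_F)
  show "(if b then alternate s u (if b then alternate u s xs else alternate s u xs)
      else alternate u s (if b then alternate u s xs else alternate s u xs)) = xs"
    if "set xs \<subseteq> F" for b xs
    using that by (auto intro!: alternate_inverse[where A = F] simp: s_u u_s)
qed (use R_dual in \<open>auto simp: polarity_map_def\<close>)

lemma automorphism_translation:
  assumes t: "t \<in> F"
  shows "automorphism (translation t)"
proof (rule automorphism_branchwise[where b = False and
      f = "\<lambda>b xs. if b then (case xs of [] \<Rightarrow> [] | k # ys \<Rightarrow> (k + t) # ys) else T t xs" and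
      f' = "\<lambda>b xs. if b then (case xs of [] \<Rightarrow> [] | k # ys \<Rightarrow> (k - t) # ys) else T (- t) xs"])
  show "\<exists>y\<in>F. (if b then (case xs @ [x] of [] \<Rightarrow> [] | k # ys \<Rightarrow> (k + t) # ys) else T t (xs @ [x])) =
      (if b then (case xs of [] \<Rightarrow> [] | k # ys \<Rightarrow> (k + t) # ys) else T t xs) @ [y]"
    if "set xs \<subseteq> F" "x \<in> F" "Suc (length xs) < n" for b xs x
    using T_snoc[OF t that] that t add_F by (cases b; cases xs) auto
qed (use T_inverse[OF t] R_T[OF t] n_ge_3 in \<open>auto simp: translation_def T_Nil split: list.splits\<close>)

text \<open>
  Besides the edges inside a subtree and those between leaves with \<open>a \<noteq> 0\<close>, the edges
  between the subtrees of \<open>a = 0\<close> and \<open>a = \<infinity>\<close> have to be followed: the last edge on a path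
  in the \<open>True\<close> tree is exchanged with an edge between two leaves (\<open>R_0\<close> and \<open>R_\<sigma>\<close>).
\<close>
lemma automorphism_inversion: "automorphism inversion"
proof (rule automorphismI)
  have \<sigma>: "set (\<sigma> xs) \<subseteq> F \<and> length (\<sigma> xs) = length xs" if "set xs \<subseteq> F" "length xs < n - 1" for xs
    using prefix_map_props[of \<sigma> "n - 1", OF \<sigma>_Nil \<sigma>_snoc that] by blast
  have \<mu>: "set (\<mu> a xs) \<subseteq> F \<and> length (\<mu> a xs) = length xs"
    if "a \<in> F" "a \<noteq> 0" "set xs \<subseteq> F" "length xs < n - 1" for a xs
    using prefix_map_props[of "\<mu> a" "n - 1", OF \<mu>_Nil \<mu>_snoc[OF that(1,2)] that(3,4)] by blast
  show "inversion v \<in> V" if "v \<in> V" for v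
  proof -
    obtain b xs where v: "v = (b, xs)" "set xs \<subseteq> F" "length xs < n" using \<open>v \<in> V\<close> by (auto simp: V_def)
    have "length xs = n - 1 \<or> length xs < n - 1" using v(3) by linarith
    then consider "b" "length xs = n - 1" | "b" "length xs < n - 1" | "\<not> b" "xs = []"
      | a cs where "\<not> b" "xs = a # cs" "a \<in> F" "set cs \<subseteq> F" "length cs < n - 1"
      using v by (cases b; cases xs) (auto simp: less_diff_conv)
    then show ?thesis
    proof cases
      case 1
      then show ?thesis using v \<kappa>_F[of xs] by (auto simp: inversion_def V_def)
    next
      case 2
      then show ?thesis using v \<sigma>[of xs] zero_F by (auto simp: inversion_def V_def)
    next
      case 3
      then show ?thesis using v by (simp add: inversion_def V_def)
    next
      case (4 a cs)
      then show ?thesis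
        using v(1) \<sigma>[of cs] \<mu>[of a cs] inverse_F[of a] by (auto simp: inversion_def V_def less_diff_conv)
    qed
  qed
  have "inversion (inversion v) = v" if "v \<in> V" for v
  proof -
    obtain b xs where v: "v = (b, xs)" "set xs \<subseteq> F" "length xs < n" using \<open>v \<in> V\<close> by (auto simp: V_def)
    show ?thesis
    proof (cases b)
      case True
      then show ?thesis using v \<kappa>_F[of xs] \<kappa>_inverse[of xs] \<sigma>_inverse[of xs] \<sigma>[of xs]
        by (cases "length xs = n - 1") (auto simp: inversion_def)
    next
      case False
      show ?thesis
      proof (cases xs)
        case Nil
        then show ?thesis using v False by (simp add: inversion_def)
      next
        case (Cons a cs)
        then have "a \<in> F" "set cs \<subseteq> F" "length cs < n - 1" using v by auto
        then show ?thesis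
          using v False Cons \<sigma>[of cs] \<sigma>_inverse[of cs] \<mu>_inverse[of a cs] by (auto simp: inversion_def)
      qed
    qed
  qed
  then show "inj_on inversion V" by (rule inj_on_inverseI)
  show "(inversion v, inversion w) \<in> E" if "(v, w) \<in> E0" for v w
    using that
  proof (cases rule: E0_cases)
    case root
    have "inversion (True, []) = (False, [0])" using n_ge_3 by (simp add: inversion_def \<sigma>_Nil)
    then show ?thesis using root tree_arc[of "[]" 0 False] n_ge_3 zero_F by (simp add: inversion_def)
  next
    case (affine xs ys)
    then obtain a cs where xs: "xs = a # cs" using n_ge_3 by (cases xs) auto
    have a: "a \<in> F" "set cs \<subseteq> F" "Suc (length cs) = n - 1" using affine xs by auto
    have \<kappa>: "set (\<kappa> ys) \<subseteq> F" "length (\<kappa> ys) = n - 1" using \<kappa>_F affine by auto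
    have w: "inversion w = (True, \<kappa> ys)" using affine by (simp add: inversion_def)
    show ?thesis
    proof (cases "a = 0")
      case True
      then obtain y where y: "y \<in> F" "\<kappa> ys = \<sigma> cs @ [y]" using R_0[OF a(2) affine(4) a(3)] affine xs by auto
      have "inversion v = (True, \<sigma> cs)" using affine xs True by (simp add: inversion_def)
      then show ?thesis unfolding w y using \<sigma>[of cs] a y tree_arc[of "\<sigma> cs" y True] by auto
    next
      case False
      have "inversion v = (False, inverse a # \<mu> a cs)" using affine xs False by (simp add: inversion_def)
      moreover have "R (inverse a # \<mu> a cs) (\<kappa> ys)"
        using R_\<mu>[OF a(1) False a(2) affine(4) a(3) affine(6)] affine xs by simp
      ultimately show ?thesis unfolding w
        using affine_arc[of "inverse a # \<mu> a cs" "\<kappa> ys"] \<mu>[OF a(1) False a(2)] a \<kappa> inverse_F by simp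
    qed
  next
    case (tree b xs x)
    show ?thesis
    proof (cases b)
      case True
      show ?thesis
      proof (cases "Suc (length xs) = n - 1")
        case last: True
        have "inversion v = (False, 0 # \<sigma> xs)" "inversion w = (True, \<kappa> (xs @ [x]))"
          using tree True last by (auto simp: inversion_def)
        then show ?thesis
          using affine_arc[of "0 # \<sigma> xs" "\<kappa> (xs @ [x])"] R_\<sigma>[OF tree(3,4) last] \<sigma>[of xs]
            \<kappa>_F[of "xs @ [x]"] tree last zero_F by auto
      next
        case False
        then have "Suc (length xs) < n - 1" using tree by simp
        then obtain y where y: "y \<in> F" "\<sigma> (xs @ [x]) = \<sigma> xs @ [y]" using \<sigma>_snoc tree by blast
        have "inversion v = (False, 0 # \<sigma> xs)" "inversion w = (False, (0 # \<sigma> xs) @ [y])"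
          using tree True False y by (auto simp: inversion_def)
        then show ?thesis
          using tree_arc[of "0 # \<sigma> xs" y False] \<sigma>[of xs] y tree zero_F \<open>Suc (length xs) < n - 1\<close> by auto
      qed
    next
      case False
      show ?thesis
      proof (cases xs)
        case Nil
        have v: "inversion v = (False, [])" using tree False Nil by (simp add: inversion_def)
        have "inversion w = (if x = 0 then (True, []) else (False, [inverse x]))"
          using tree False Nil by (simp add: inversion_def \<sigma>_Nil \<mu>_Nil)
        then show ?thesis
          using v root_arc tree_arc[of "[]" "inverse x" False] inverse_F[OF tree(4)] n_ge_3 by auto
      next
        case (Cons a cs)
        then have a: "a \<in> F" "set cs \<subseteq> F" "Suc (length cs) < n - 1" using tree by auto
        show ?thesis
        proof (cases "a = 0")
          case True
          obtain y where y: "y \<in> F" "\<sigma> (cs @ [x]) = \<sigma> cs @ [y]" using \<sigma>_snoc a tree by blast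
          have "inversion v = (True, \<sigma> cs)" "inversion w = (True, \<sigma> cs @ [y])"
            using tree False Cons True y by (auto simp: inversion_def)
          then show ?thesis using tree_arc[of "\<sigma> cs" y True] \<sigma>[of cs] y a by auto
        next
          case a0: False
          obtain y where y: "y \<in> F" "\<mu> a (cs @ [x]) = \<mu> a cs @ [y]" using \<mu>_snoc a a0 tree by blast
          have "inversion v = (False, inverse a # \<mu> a cs)" "inversion w = (False, (inverse a # \<mu> a cs) @ [y])"
            using tree False Cons a0 y by (auto simp: inversion_def)
          then show ?thesis
            using tree_arc[of "inverse a # \<mu> a cs" y False] \<mu>[OF a(1) a0 a(2)] y a inverse_F by auto
        qed
      qed
    qed
  qed
qed

sublocale coordinate_polygon n F R polarity_map
proof
  show "automorphism polarity_map" by (rule automorphism_polarity_map)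
  show "polarity_map (polarity_map v) = v" if "v \<in> V" for v
    using that alternate_inverse[of F s u u s "snd v"] alternate_inverse[of F u s s u "snd v"] s_u u_s
    by (cases v) (auto simp: polarity_map_def V_def)
  show "fst (polarity_map (b, xs)) = (\<not> b) \<and> length (snd (polarity_map (b, xs))) = length xs" for b xs
    by (simp add: polarity_map_def)
  show "\<exists>g. automorphism g \<and> g (False, []) = (False, []) \<and> g (False, [a]) = (True, [])" if a: "a \<in> F" for a
  proof -
    (* The polarity takes (False, [a]) to (True, [s a]), which is translated to (True, [0]);
       the polarity maps this back to (False, [0]), and the inversion moves it to (True, []).
       *)
    define t where "t = - s a"
    have t: "t \<in> F" using a s_F uminus_F by (simp add: t_def)
    let ?g = "inversion \<circ> polarity_map \<circ> translation t \<circ> polarity_map"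
    have "u 0 = 0" using u_add[of 0 0] by (metis add.right_neutral add_left_imp_eq)
    then have "?g (False, []) = (False, [])" "?g (False, [a]) = (True, [])"
      by (simp_all add: inversion_def polarity_map_def translation_def t_def \<sigma>_Nil)
    moreover have "automorphism ?g"
      using automorphism_inversion automorphism_polarity_map automorphism_translation[OF t]
      by (intro automorphism_comp)
    ultimately show ?thesis by blast
  qed
qed

text \<open>
  The result inherited from \<open>coordinate_polygon\<close>, in a form that can be instantiated outside
  this locale.
\<close>
theorem admissible_order: "card F \<ge> 2 \<Longrightarrow> admissible n (card F)"
  by (rule admissible_card)

end

section \<open>Planes, quadrangles and hexagons\<close>

lemma length_eq_3: "length xs = 3 \<longleftrightarrow> (\<exists>a b c. xs = [a, b, c])"
  and length_eq_5: "length xs = 5 \<longleftrightarrow> (\<exists>a b c d e. xs = [a, b, c, d, e])"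
  and length_eq_2: "length xs = 2 \<longleftrightarrow> (\<exists>a b. xs = [a, b])"
  and length_eq_4: "length xs = 4 \<longleftrightarrow> (\<exists>a b c d. xs = [a, b, c, d])"
  by (auto simp: length_Suc_conv eval_nat_numeral)

lemma short_list_cases:
  obtains "xs = []" | a where "xs = [a]" | a b where "xs = [a, b]" | a b c where "xs = [a, b, c]"
    | a b c d where "xs = [a, b, c, d]" | a b c d e where "xs = [a, b, c, d, e]" | "length xs \<ge> 6"
proof -
  consider "length xs = 0" | "length xs = 1" | "length xs = 2" | "length xs = 3" | "length xs = 4"
    | "length xs = 5" | "length xs \<ge> 6" by linarith
  then show thesis
    using that by cases (auto simp: length_eq_2 length_eq_3 length_eq_4 length_eq_5 length_Suc_conv)
qed

text \<open>
  Up to duality, the affine plane with points \<open>(a, c)\<close> and lines \<open>[k, f]\<close>, where \<open>(a, c)\<close>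
  lies on \<open>[k, f]\<close> if \<open>c + f = a k\<close>. This equation is symmetric, so exchanging points and
  lines is a polarity.
\<close>
definition plane_incident :: "'k::field list \<Rightarrow> 'k list \<Rightarrow> bool" where
  "plane_incident xs ys \<longleftrightarrow> xs ! 1 + ys ! 1 = xs ! 0 * ys ! 0"

fun plane_shift :: "'k::field \<Rightarrow> 'k list \<Rightarrow> 'k list" where
  "plane_shift t [a, c] = [a, c + a * t]"
| "plane_shift t xs = xs"

fun plane_scale :: "'k::field \<Rightarrow> 'k list \<Rightarrow> 'k list" where
  "plane_scale a [c] = [- (c * inverse a)]"
| "plane_scale a xs = xs"

lemma (in finite_field_with_twist) field_polygon_plane:
  "field_polygon F (\<lambda>x. x) (\<lambda>x. x) 1 3 plane_incident plane_shift (map uminus) plane_scale rev"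
proof
  show "plane_incident (alternate (\<lambda>x. x) (\<lambda>x. x) ys) (alternate (\<lambda>x. x) (\<lambda>x. x) xs)"
    if "length xs = 3 - 1" "length ys = 3 - 1" "plane_incident xs ys" for xs ys
    using that by (auto simp: length_eq_2 plane_incident_def algebra_simps)
  show "\<exists>y\<in>F. plane_shift t (xs @ [x]) = plane_shift t xs @ [y]"
    if "t \<in> F" "set xs \<subseteq> F" "x \<in> F" "Suc (length xs) < 3" for t xs x
    using that by (cases xs rule: short_list_cases) (auto intro: closed)
  show "plane_shift (- t) (plane_shift t xs) = xs" if "length xs < 3" for t and xs :: "'k list"
    using that by (cases xs rule: short_list_cases) auto
  show "plane_incident (plane_shift t xs) ((k + t) # ys)"
    if "length xs = 3 - 1" "length (k # ys) = 3 - 1" "plane_incident xs (k # ys)" for t xs k ys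
    using that by (auto simp: length_eq_2 length_Suc_conv plane_incident_def algebra_simps)
  show "\<exists>y\<in>F. map uminus (xs @ [x]) = map uminus xs @ [y]" if "x \<in> F" for xs x
    using that uminus_F by simp
  show "\<exists>y\<in>F. plane_scale a (xs @ [x]) = plane_scale a xs @ [y]"
    if "a \<in> F" "x \<in> F" "Suc (length xs) < 3 - 1" for a xs x
    using that by (auto intro!: closed)
  show "plane_scale (inverse a) (plane_scale a xs) = xs" if "a \<noteq> 0" "length xs < 3 - 1" for a and xs :: "'k list"
    using that by (cases xs rule: short_list_cases) auto
  show "plane_incident (inverse a # plane_scale a xs) (rev ys)"
    if "a \<noteq> 0" "Suc (length xs) = 3 - 1" "length ys = 3 - 1" "plane_incident (a # xs) ys" for a xs ys
    using that by (auto simp: length_eq_2 length_Suc_conv plane_incident_def field_simps)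
  show "\<exists>y\<in>F. rev ys = map uminus xs @ [y]"
    if "set ys \<subseteq> F" "Suc (length xs) = 3 - 1" "length ys = 3 - 1" "plane_incident (0 # xs) ys" for xs ys
    using that by (auto simp: length_eq_2 length_Suc_conv plane_incident_def eq_neg_iff_add_eq_0 add.commute)
  show "plane_incident (0 # map uminus ys) (rev (ys @ [x]))" if "Suc (length ys) = 3 - 1" for ys and x :: 'k
    using that by (auto simp: length_Suc_conv plane_incident_def)
qed (auto simp: finite_F closed one_F comp_def)

text \<open>
  The affine part of the symplectic quadrangle, with leaves \<open>(a, c\<^sub>2, c\<^sub>1)\<close> and
  \<open>[k, f\<^sub>1, f\<^sub>2]\<close> and the equations \<open>f\<^sub>2 = c\<^sub>2 + a\<^sup>2 k\<close> and \<open>c\<^sub>1 = f\<^sub>1 + a k\<close>. The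
  coordinates are indexed by the positive roots of a system of type \<open>B\<^sub>2\<close> with simple roots
  \<open>\<alpha>\<close> (for \<open>a\<close>) and \<open>\<beta>\<close> (for \<open>k\<close>), in the order \<open>\<alpha>, 2\<alpha> + \<beta>, \<alpha> + \<beta>, \<beta>\<close>, read from the left
  for the one tree and from the right for the other. In characteristic \<open>2\<close> the substitution
  \<open>a \<mapsto> u k\<close>, \<open>k \<mapsto> s a\<close> turns \<open>a\<^sup>2 k\<close> into \<open>s (a k)\<close> and \<open>a k\<close> into \<open>u (a\<^sup>2 k)\<close>, so the two
  equations are interchanged.
\<close>
definition quadrangle_incident :: "'k::field list \<Rightarrow> 'k list \<Rightarrow> bool" where
  "quadrangle_incident xs ys \<longleftrightarrow>
     ys ! 2 = xs ! 1 + xs ! 0 ^ 2 * ys ! 0 \<and> xs ! 2 = ys ! 1 + xs ! 0 * ys ! 0"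

fun quadrangle_shift :: "'k::field \<Rightarrow> 'k list \<Rightarrow> 'k list" where
  "quadrangle_shift t [a, c2] = [a, c2 - a ^ 2 * t]"
| "quadrangle_shift t [a, c2, c1] = [a, c2 - a ^ 2 * t, c1 + a * t]"
| "quadrangle_shift t xs = xs"

fun quadrangle_scale :: "'k::field \<Rightarrow> 'k list \<Rightarrow> 'k list" where
  "quadrangle_scale a [c2] = [inverse a ^ 2 * c2]"
| "quadrangle_scale a [c2, c1] = [inverse a ^ 2 * c2, c1 + inverse a * c2]"
| "quadrangle_scale a xs = xs"

text \<open>
  As \<open>2 = 0\<close>, the subtrees of \<open>a = 0\<close> and \<open>a = \<infinity>\<close> can be exchanged by the identity on
  coordinates.
\<close>
lemma (in finite_field_with_twist) field_polygon_quadrangle: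
  assumes p: "p = 2" and two: "(2 :: 'k) = 0"
  shows "field_polygon F s u p 4 quadrangle_incident quadrangle_shift (\<lambda>xs. xs) quadrangle_scale rev"
proof
  have s_u_sq: "s x = u x * u x" for x using s_eq[of x] by (simp add: p power2_eq_square)
  show "quadrangle_incident (alternate u s ys) (alternate s u xs)"
    if "length xs = 4 - 1" "length ys = 4 - 1" "quadrangle_incident xs ys" for xs ys
    using that by (auto simp: length_eq_3 quadrangle_incident_def s_add s_mult u_add u_mult s_u_sq
        power2_eq_square algebra_simps two)
  show "\<exists>y\<in>F. quadrangle_shift t (xs @ [x]) = quadrangle_shift t xs @ [y]"
    if "t \<in> F" "set xs \<subseteq> F" "x \<in> F" "Suc (length xs) < 4" for t xs x
    using that by (cases xs rule: short_list_cases) (auto intro!: closed)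
  show "quadrangle_shift (- t) (quadrangle_shift t xs) = xs" if "length xs < 4" for t and xs :: "'k list"
    using that by (cases xs rule: short_list_cases) auto
  show "quadrangle_incident (quadrangle_shift t xs) ((k + t) # ys)"
    if "length xs = 4 - 1" "length (k # ys) = 4 - 1" "quadrangle_incident xs (k # ys)" for t xs k ys
    using that by (auto simp: length_eq_3 length_eq_2 length_Suc_conv quadrangle_incident_def algebra_simps)
  show "\<exists>y\<in>F. quadrangle_scale a (xs @ [x]) = quadrangle_scale a xs @ [y]"
    if "a \<in> F" "set xs \<subseteq> F" "x \<in> F" "Suc (length xs) < 4 - 1" for a xs x
    using that by (cases xs rule: short_list_cases) (auto intro!: closed)
  show "quadrangle_scale (inverse a) (quadrangle_scale a xs) = xs"
    if "a \<noteq> 0" "length xs < 4 - 1" for a and xs :: "'k list"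
  proof -
    define b where "b = inverse a"
    have ab: "a * b = 1" using that by (simp add: b_def)
    have "a ^ 2 * (b ^ 2 * c2) = c2" for c2 using ab by Groebner_Basis.algebra
    moreover have "c1 + b * c2 + a * (b ^ 2 * c2) = c1" for c1 c2
    proof -
      have "c1 + b * c2 + a * (b ^ 2 * c2) = c1 + 2 * (b * c2)" using ab by Groebner_Basis.algebra
      then show ?thesis by (simp add: two)
    qed
    ultimately show ?thesis
      using that by (cases xs rule: short_list_cases) (simp_all add: b_def)
  qed
  show "quadrangle_incident (inverse a # quadrangle_scale a xs) (rev ys)"
    if h: "a \<noteq> 0" "Suc (length xs) = 4 - 1" "length ys = 4 - 1" "quadrangle_incident (a # xs) ys" for a :: 'k and xs ys
  proof -
    define b where "b = inverse a"
    have ab: "a * b = 1" using that by (simp add: b_def)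
    obtain c2 c1 k f1 f2 where [simp]: "xs = [c2, c1]" "ys = [k, f1, f2]"
      using h by (auto simp: length_eq_2 length_eq_3)
    have "f2 = c2 + a ^ 2 * k" "c1 = f1 + a * k" using that by (auto simp: quadrangle_incident_def)
    then have "b ^ 2 * c2 + b ^ 2 * f2 = k + 2 * (b ^ 2 * c2)" "c1 + b * c2 = f1 + b * f2"
      using ab by - Groebner_Basis.algebra+
    then have "k = b ^ 2 * c2 + b ^ 2 * f2" "c1 + b * c2 = f1 + b * f2"
      by (simp_all add: two)
    then show ?thesis by (simp add: quadrangle_incident_def b_def)
  qed
  show "\<exists>y\<in>F. rev ys = xs @ [y]"
    if "set ys \<subseteq> F" "Suc (length xs) = 4 - 1" "length ys = 4 - 1" "quadrangle_incident (0 # xs) ys" for xs ys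
    using that by (auto simp: length_eq_2 length_eq_3 quadrangle_incident_def)
  show "quadrangle_incident (0 # ys) (rev (ys @ [x]))" if "Suc (length ys) = 4 - 1" for ys and x :: 'k
    using that by (auto simp: length_eq_2 quadrangle_incident_def)
qed auto

text \<open>
  The affine part of the split Cayley hexagon in characteristic \<open>3\<close>, with leaves
  \<open>(a, c\<^sub>3, c\<^sub>2, z', c\<^sub>1)\<close> and \<open>[k, f\<^sub>1, z, f\<^sub>2, f\<^sub>3]\<close>. The positive roots of a system of
  type \<open>G\<^sub>2\<close>, in the order \<open>\<alpha>, 3\<alpha> + \<beta>, 2\<alpha> + \<beta>, 3\<alpha> + 2\<beta>, \<alpha> + \<beta>, \<beta>\<close>, index the coordinates as
  in the case of the quadrangle. Read in terms of a leaf of the \<open>True\<close> tree,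
  \<open>(k, f\<^sub>1, f\<^sub>2, f\<^sub>3)\<close> is, up to signs, a vector of the four-dimensional space spanned by
  the twisted cubic \<open>(1, a, a\<^sup>2, a\<^sup>3)\<close>, and the coordinates \<open>c\<^sub>3, c\<^sub>2, c\<^sub>1\<close> of its
  neighbours are obtained from functionals that vanish on the osculating plane, the tangent
  and the point of that cubic with parameter \<open>a\<close>. The coordinates \<open>z\<close> and \<open>z'\<close> of the centre
  are normalized so that, in characteristic \<open>3\<close>, the first equation is interchanged with the
  second one and the third with the fourth by \<open>a \<mapsto> u k\<close>, \<open>k \<mapsto> s a\<close>.
\<close>
definition hexagon_incident :: "'k::field list \<Rightarrow> 'k list \<Rightarrow> bool" where
  "hexagon_incident xs ys \<longleftrightarrow>
     xs ! 4 = ys ! 1 + xs ! 0 * ys ! 0 \<and>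
     ys ! 4 = xs ! 1 + xs ! 0 ^ 3 * ys ! 0 \<and>
     xs ! 2 = ys ! 3 - xs ! 0 * ys ! 1 + xs ! 0 ^ 2 * ys ! 0 \<and>
     ys ! 2 = xs ! 3 - ys ! 0 * xs ! 1 + xs ! 0 ^ 3 * ys ! 0 ^ 2"

fun hexagon_shift :: "'k::field \<Rightarrow> 'k list \<Rightarrow> 'k list" where
  "hexagon_shift t [a, c3] = [a, c3 - a ^ 3 * t]"
| "hexagon_shift t [a, c3, c2] = [a, c3 - a ^ 3 * t, c2 + a ^ 2 * t]"
| "hexagon_shift t [a, c3, c2, z] = [a, c3 - a ^ 3 * t, c2 + a ^ 2 * t, z + t * c3 + a ^ 3 * t ^ 2]"
| "hexagon_shift t [a, c3, c2, z, c1] =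
     [a, c3 - a ^ 3 * t, c2 + a ^ 2 * t, z + t * c3 + a ^ 3 * t ^ 2, c1 + a * t]"
| "hexagon_shift t xs = xs"

fun hexagon_flip :: "'k::field list \<Rightarrow> 'k list" where
  "hexagon_flip [] = []"
| "hexagon_flip (x # xs) = x # map uminus xs"

fun hexagon_scale :: "'k::field \<Rightarrow> 'k list \<Rightarrow> 'k list" where
  "hexagon_scale a [c3] = [- (inverse a ^ 3 * c3)]"
| "hexagon_scale a [c3, c2] = [- (inverse a ^ 3 * c3), inverse a * c2 + inverse a ^ 2 * c3]"
| "hexagon_scale a [c3, c2, z] =
     [- (inverse a ^ 3 * c3), inverse a * c2 + inverse a ^ 2 * c3, inverse a ^ 3 * c3 ^ 2 - z]"
| "hexagon_scale a [c3, c2, z, c1] =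
     [- (inverse a ^ 3 * c3), inverse a * c2 + inverse a ^ 2 * c3, inverse a ^ 3 * c3 ^ 2 - z,
      inverse a * c3 - c2 - a * c1]"
| "hexagon_scale a xs = xs"

fun hexagon_reverse :: "'k::field list \<Rightarrow> 'k list" where
  "hexagon_reverse [k, f1, z, f2, f3] = [f3, - f2, - (z + k * f3), - f1, k]"
| "hexagon_reverse xs = xs"

text \<open>
  All conditions are polynomial identities modulo \<open>3\<close>. Each one is proved as an identity
  over an arbitrary field with an explicit multiple of \<open>3\<close> as error term, and with \<open>b\<close> for
  \<open>1/a\<close>.
\<close>
lemma (in finite_field_with_twist) field_polygon_hexagon:
  assumes p: "p = 3" and three: "(3 :: 'k) = 0"
  shows "field_polygon F s u p 6 hexagon_incident hexagon_shift hexagon_flip hexagon_scale hexagon_reverse"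
proof
  have s_cube: "s x = u x ^ 3" for x using s_eq[of x] by (simp add: p)
  show "hexagon_incident (alternate u s ys) (alternate s u xs)"
    if "length xs = 6 - 1" "length ys = 6 - 1" "hexagon_incident xs ys" for xs ys
    using that by (auto simp: length_eq_5 hexagon_incident_def s_add s_mult s_diff s_power
        u_add u_mult u_diff u_power s_cube[symmetric])
  show "\<exists>y\<in>F. hexagon_shift t (xs @ [x]) = hexagon_shift t xs @ [y]"
    if "t \<in> F" "set xs \<subseteq> F" "x \<in> F" "Suc (length xs) < 6" for t xs x
    using that by (cases xs rule: short_list_cases) (auto intro!: closed)
  show "hexagon_shift (- t) (hexagon_shift t xs) = xs" if "length xs < 6" for t and xs :: "'k list"
  proof -
    have "z + t * c3 + a ^ 3 * t ^ 2 + - t * (c3 - a ^ 3 * t) + a ^ 3 * (- t) ^ 2 =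
        z + 3 * (a ^ 3 * t ^ 2)" for z c3 a
      by (simp add: algebra_simps power2_eq_square)
    then have "z + t * c3 + a ^ 3 * t ^ 2 + - t * (c3 - a ^ 3 * t) + a ^ 3 * (- t) ^ 2 = z" for z c3 a
      by (simp add: three)
    then show ?thesis using that by (cases xs rule: short_list_cases) auto
  qed
  show "hexagon_incident (hexagon_shift t xs) ((k + t) # ys)"
    if h: "length xs = 6 - 1" "length (k # ys) = 6 - 1" "hexagon_incident xs (k # ys)" for t :: 'k and xs k ys
  proof -
    obtain a c3 c2 z' c1 f1 z f2 f3 where [simp]: "xs = [a, c3, c2, z', c1]" "ys = [f1, z, f2, f3]"
      using h by (auto simp: length_eq_5 length_eq_4)
    have "c1 = f1 + a * k" "f3 = c3 + a ^ 3 * k" "c2 = f2 - a * f1 + a ^ 2 * k"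
      "z = z' - k * c3 + a ^ 3 * k ^ 2"
      using that by (auto simp: hexagon_incident_def)
    then have "c1 + a * t = f1 + a * (k + t)" "f3 = c3 - a ^ 3 * t + a ^ 3 * (k + t)"
      "c2 + a ^ 2 * t = f2 - a * f1 + a ^ 2 * (k + t)"
      "z' + t * c3 + a ^ 3 * t ^ 2 - (k + t) * (c3 - a ^ 3 * t) + a ^ 3 * (k + t) ^ 2 =
        z + 3 * (a ^ 3 * t ^ 2 + a ^ 3 * k * t)"
      by (simp_all add: algebra_simps power2_eq_square)
    then show ?thesis by (simp add: hexagon_incident_def three)
  qed
  show "\<exists>y\<in>F. hexagon_flip (xs @ [x]) = hexagon_flip xs @ [y]" if "x \<in> F" for xs x
    using that uminus_F by (cases xs) auto
  show "hexagon_flip (hexagon_flip xs) = xs" for xs :: "'k list"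
    by (cases xs) (auto simp: comp_def)
  show "\<exists>y\<in>F. hexagon_scale a (xs @ [x]) = hexagon_scale a xs @ [y]"
    if "a \<in> F" "set xs \<subseteq> F" "x \<in> F" "Suc (length xs) < 6 - 1" for a xs x
    using that by (cases xs rule: short_list_cases) (auto intro!: closed)
  show "hexagon_scale (inverse a) (hexagon_scale a xs) = xs"
    if "a \<noteq> 0" "length xs < 6 - 1" for a and xs :: "'k list"
  proof -
    define b where "b = inverse a"
    have ab: "a * b = 1" using that by (simp add: b_def)
    have "a ^ 3 * (b ^ 3 * c3) = c3" "a * (b * c2 + b ^ 2 * c3) - a ^ 2 * (b ^ 3 * c3) = c2"
      "a ^ 3 * (b ^ 3 * c3) ^ 2 - (b ^ 3 * c3 ^ 2 - z) = z"
      "- (a * (b ^ 3 * c3)) - (b * c2 + b ^ 2 * c3) - b * (b * c3 - c2 - a * c1) =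
         c1 - 3 * (b ^ 2 * c3)" for c3 c2 z c1
      using ab by - Groebner_Basis.algebra+
    then show ?thesis
      using that by (cases xs rule: short_list_cases) (simp_all add: b_def three)
  qed
  show "set (hexagon_reverse ys) \<subseteq> F \<and> length (hexagon_reverse ys) = 6 - 1"
    if "set ys \<subseteq> F" "length ys = 6 - 1" for ys
    using that by (auto simp: length_eq_5 intro!: closed)
  show "hexagon_reverse (hexagon_reverse ys) = ys" if "length ys = 6 - 1" for ys :: "'k list"
    using that by (auto simp: length_eq_5)
  show "hexagon_incident (inverse a # hexagon_scale a xs) (hexagon_reverse ys)"
    if h: "a \<noteq> 0" "Suc (length xs) = 6 - 1" "length ys = 6 - 1" "hexagon_incident (a # xs) ys" for a :: 'k and xs ys
  proof -
    define b where "b = inverse a"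
    have ab: "a * b = 1" using that by (simp add: b_def)
    obtain c3 c2 z' c1 k f1 z f2 f3 where [simp]: "xs = [c3, c2, z', c1]" "ys = [k, f1, z, f2, f3]"
      using h by (auto simp: length_eq_5 length_eq_4)
    have "c1 = f1 + a * k" "f3 = c3 + a ^ 3 * k" "c2 = f2 - a * f1 + a ^ 2 * k"
      "z = z' - k * c3 + a ^ 3 * k ^ 2"
      using that by (auto simp: hexagon_incident_def)
    then have "- f2 + b * f3 = b * c3 - c2 - a * c1 + 3 * (a ^ 2 * k)"
      "k = - (b ^ 3 * c3) + b ^ 3 * f3"
      "b * c2 + b ^ 2 * c3 = - f1 - b * (- f2) + b ^ 2 * f3"
      "b ^ 3 * c3 ^ 2 - z' - f3 * (- (b ^ 3 * c3)) + b ^ 3 * f3 ^ 2 =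
        - (z + k * f3) + 3 * (b ^ 3 * c3 ^ 2 + c3 * k + a ^ 3 * k ^ 2)"
      using ab by - Groebner_Basis.algebra+
    then have "b * c3 - c2 - a * c1 = - f2 + b * f3"
      "k = - (b ^ 3 * c3) + b ^ 3 * f3"
      "b * c2 + b ^ 2 * c3 = - f1 - b * (- f2) + b ^ 2 * f3"
      "- (z + k * f3) = b ^ 3 * c3 ^ 2 - z' - f3 * (- (b ^ 3 * c3)) + b ^ 3 * f3 ^ 2"
      by (simp_all add: three)
    then show ?thesis by (simp add: hexagon_incident_def b_def)
  qed
  show "\<exists>y\<in>F. hexagon_reverse ys = hexagon_flip xs @ [y]"
    if "set ys \<subseteq> F" "Suc (length xs) = 6 - 1" "length ys = 6 - 1" "hexagon_incident (0 # xs) ys" for xs ys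
    using that by (auto simp: length_eq_4 length_eq_5 hexagon_incident_def)
  show "hexagon_incident (0 # hexagon_flip ys) (hexagon_reverse (ys @ [x]))"
    if "Suc (length ys) = 6 - 1" for ys and x :: 'k
    using that by (auto simp: length_eq_4 hexagon_incident_def)
qed auto


section \<open>Infinitely many admissible orders\<close>

lemma infinite_odd_powers:
  assumes "p \<ge> (2 :: nat)" and S: "\<And>e. p ^ (2 * e + 1) \<in> S"
  shows "infinite S"
proof -
  have "inj (\<lambda>e. p ^ (2 * e + 1))"
    using assms(1) by (intro injI) (simp add: power_inject_exp)
  then have "infinite (range (\<lambda>e. p ^ (2 * e + 1)))" by (rule range_inj_infinite)
  then show ?thesis using S by (meson image_subsetI infinite_super)
qed

text \<open>
  Odd powers of \<open>2\<close> are admissible for \<open>n \<in> {3, 4}\<close> and odd powers of \<open>3\<close> for \<open>n = 6\<close>. The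
  fields are found inside the algebraic closures of the prime fields.
\<close>
lemma infinite_admissible:
  assumes "n \<in> {3, 4, 6}"
  shows "infinite {r. admissible n r}"
proof -
  have char2: "CHAR(Enum.finite_2 alg_closure) = 2" and char3: "CHAR(Enum.finite_3 alg_closure) = 3"
    by (simp_all add: CHAR_finite_2 CHAR_finite_3)
  have two: "(2 :: Enum.finite_2 alg_closure) = 0" and three: "(3 :: Enum.finite_3 alg_closure) = 0"
    using of_nat_CHAR[where 'a = "Enum.finite_2 alg_closure"] of_nat_CHAR[where 'a = "Enum.finite_3 alg_closure"]
    unfolding char2 char3 by simp_all
  have ge2: "2 \<le> p ^ (2 * e + 1)" if "p \<ge> 2" for p e :: nat
    by (rule order.trans[OF that self_le_power]) (use that in auto)
  note field2 = finite_field_with_twist_exists[OF char2 two_is_prime_nat]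
  have "prime (3 :: nat)" by simp
  note field3 = finite_field_with_twist_exists[OF char3 this]
  consider "n = 3" | "n = 4" | "n = 6" using assms by blast
  then show ?thesis
  proof cases
    case 1
    have "admissible 3 (2 ^ (2 * e + 1))" for e
      using field_polygon.admissible_order[OF finite_field_with_twist.field_polygon_plane[OF field2(1)[of e]]]
        ge2[of 2 e] unfolding field2(2) by simp
    then show ?thesis using 1 by (intro infinite_odd_powers[of 2]) auto
  next
    case 2
    have "admissible 4 (2 ^ (2 * e + 1))" for e
      using field_polygon.admissible_order[OF
          finite_field_with_twist.field_polygon_quadrangle[OF field2(1)[of e] refl two]]
        ge2[of 2 e] unfolding field2(2) by simp
    then show ?thesis using 2 by (intro infinite_odd_powers[of 2]) auto
  next
    case 3
    have "admissible 6 (3 ^ (2 * e + 1))" for e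
      using field_polygon.admissible_order[OF
          finite_field_with_twist.field_polygon_hexagon[OF field3(1)[of e] refl three]]
        ge2[of 3 e] unfolding field3(2) by simp
    then show ?thesis using 3 by (intro infinite_odd_powers[of 3]) auto
  qed
qed

theorem theorem1p3:
  fixes n q :: nat
    and \<Gamma> :: "('p, 'l) geometry" and \<rho> :: "'p + 'l \<Rightarrow> 'p + 'l"
  assumes "n \<in> {3, 4, 6}" and "q > 0" and "polarized_polygon n q \<Gamma> \<rho>"
  shows
    "(\<forall>r (\<Gamma>' :: ('c, 'd) geometry) \<rho>'. r > 0 \<and> polarized_polygon n r \<Gamma>' \<rho>' \<longrightarrow>
        graph_isomorphic
          (delete_loops (composed_quotient \<Gamma> \<rho> \<Gamma>' \<rho>'))
          (delete_loops (polarity_quotient (incidence_graph \<Gamma>) \<rho> \<otimes>\<^sub>K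
                         polarity_quotient (incidence_graph \<Gamma>') \<rho>'))) \<and>
     infinite {r. admissible n r} \<and>
     (\<forall>r r'. \<forall>K \<in> family_members n \<Gamma> \<rho> r. \<forall>K' \<in> family_members n \<Gamma> \<rho> r'.
        r \<noteq> r' \<longrightarrow>
        \<not> graph_isomorphic
            (K :: (('p + 'l) \<times> ('c + 'd)) set pair_pre_digraph)
            (K' :: (('p + 'l) \<times> ('c + 'd)) set pair_pre_digraph)) \<and>
     (\<forall>r. \<forall>K \<in> family_members n \<Gamma> \<rho> r.
        pair_graph (K :: (('p + 'l) \<times> ('c + 'd)) set pair_pre_digraph) \<and>
        graph_degree K = (q + 1) * (r + 1) \<and>
        graph_diameter K = ereal (real (n - 1))) \<and>
     (\<forall>K :: nat \<Rightarrow> (('p + 'l) \<times> ('c + 'd)) set pair_pre_digraph.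
        (\<forall>r. admissible n r \<longrightarrow> K r \<in> family_members n \<Gamma> \<rho> r) \<longrightarrow>
        ((\<lambda>r. real (graph_order (K r)) / moore_bound ((q + 1) * (r + 1)) (n - 1))
           \<longlongrightarrow> (\<Sum>i<n. real q ^ i) / (real q + 1) ^ (n - 1))
          (inf sequentially (principal {r. admissible n r})))"
proof -
  note facts = composed_quotient_properties[OF assms]
  have member: "pair_graph K \<and> graph_degree K = (q + 1) * (r + 1) \<and>
      graph_diameter K = ereal (real (n - 1)) \<and>
      graph_order K = (\<Sum>i<n. q ^ i) * (\<Sum>i<n. r ^ i)"
    if K: "K \<in> family_members n \<Gamma> \<rho> r"
    for r and K :: "(('p + 'l) \<times> ('c + 'd)) set pair_pre_digraph"
  proof -
    obtain \<Gamma>' :: "('c, 'd) geometry" and \<rho>' where r: "r > 0" "polarized_polygon n r \<Gamma>' \<rho>'"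
      and "K = delete_loops (composed_quotient \<Gamma> \<rho> \<Gamma>' \<rho>')"
      using K unfolding family_members_def by blast
    then show ?thesis using facts(2-5)[OF r] by simp
  qed
  have distinct: "\<not> graph_isomorphic K K'"
    if "K \<in> family_members n \<Gamma> \<rho> r" "K' \<in> family_members n \<Gamma> \<rho> r'" "r \<noteq> r'"
    for r r' and K K' :: "(('p + 'l) \<times> ('c + 'd)) set pair_pre_digraph"
  proof
    assume "graph_isomorphic K K'"
    then have "(q + 1) * (r + 1) = (q + 1) * (r' + 1)"
      using graph_isomorphic_degree member[OF that(1)] member[OF that(2)] by metis
    then show False using \<open>r \<noteq> r'\<close> by (simp only: mult_cancel1) simp
  qed
  have limit: "((\<lambda>r. real (graph_order (K r)) / moore_bound ((q + 1) * (r + 1)) (n - 1))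
       \<longlongrightarrow> (\<Sum>i<n. real q ^ i) / (real q + 1) ^ (n - 1))
      (inf sequentially (principal {r. admissible n r}))"
    if K: "\<And>r. admissible n r \<Longrightarrow> K r \<in> family_members n \<Gamma> \<rho> r"
    for K :: "nat \<Rightarrow> (('p + 'l) \<times> ('c + 'd)) set pair_pre_digraph"
  proof -
    have "n \<ge> 2" using assms(1) by auto
    then have "((\<lambda>r. real ((\<Sum>i<n. q ^ i) * (\<Sum>i<n. r ^ i)) / moore_bound ((q + 1) * (r + 1)) (n - 1))
       \<longlongrightarrow> (\<Sum>i<n. real q ^ i) / (real q + 1) ^ (n - 1))
      (inf sequentially (principal {r. admissible n r}))"
      by (intro tendsto_mono[OF inf_le1 moore_ratio_tendsto])
    moreover have "\<forall>\<^sub>F r in inf sequentially (principal {r. admissible n r}).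
        real ((\<Sum>i<n. q ^ i) * (\<Sum>i<n. r ^ i)) / moore_bound ((q + 1) * (r + 1)) (n - 1) =
        real (graph_order (K r)) / moore_bound ((q + 1) * (r + 1)) (n - 1)"
      unfolding eventually_inf_principal
    proof (intro always_eventually allI impI)
      fix r assume "r \<in> {r. admissible n r}"
      then have "K r \<in> family_members n \<Gamma> \<rho> r" using K by simp
      from member[OF this]
      show "real ((\<Sum>i<n. q ^ i) * (\<Sum>i<n. r ^ i)) / moore_bound ((q + 1) * (r + 1)) (n - 1) =
        real (graph_order (K r)) / moore_bound ((q + 1) * (r + 1)) (n - 1)" by simp
    qed
    ultimately show ?thesis by (rule Lim_transform_eventually)
  qed
  show ?thesis
  proof (intro conjI allI ballI impI)
    show "graph_isomorphic (delete_loops (composed_quotient \<Gamma> \<rho> \<Gamma>' \<rho>'))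
        (delete_loops (polarity_quotient (incidence_graph \<Gamma>) \<rho> \<otimes>\<^sub>K
           polarity_quotient (incidence_graph \<Gamma>') \<rho>'))"
      if "r > 0 \<and> polarized_polygon n r \<Gamma>' \<rho>'" for r \<rho>' and \<Gamma>' :: "('c, 'd) geometry"
      using that by (intro facts(1)) auto
  qed (use infinite_admissible[OF assms(1)] distinct member limit in blast)+
qed

end
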